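(* Let $R$ be a commutative noetherian domain, let $C,D$ be $R$-coalgebras that are flat as $R$-modules, and let $f:C\to D$ be a homomorphism of $R$-coalgebras. Let $\omega:\mathrm{comod}(C)\to\mathrm{comod}(D)$ be the induced functor on comodule categories. Then: (1) The image of $\omega$ is closed under taking saturated subcomodules of $R$-torsion-free comodules if and only if $f$ is injective. In this case the image of $\omega$ is also closed under taking saturated subcomodules of any comodules, and the restriction of $\omega$ to the full subcategory of $R$-torsion-free comodules is full. (2) The image of $\omega$ is closed under taking subcomodules of any comodules if and only if $f$ is injective and pure. In this case $\omega$ is full.
   Context: For an $R$-coalgebra $C$ (coassociative, counital), $\mathrm{comod}(C)$ is the category of all right $C$-comodules (no finiteness condition). A coalgebra homomorphism $f:C\to D$ induces the functor $\omega$ sending $(M,\delta:M\to M\otimes_R C)$ to $(M,(\mathrm{id}\otimes f)\circ\delta)$; it is the identity on underlying $R$-modules. A subcomodule of a $D$-comodule $(M,\delta)$ ($D$ flat over $R$) is an $R$-submodule $N$ with $\delta(N)\subset N\otimes_R D$ (regarded inside $M\otimes_R D$). A subcomodule $N$ of $M$ is called saturated if $M/N$ is $R$-torsion-free. A comodule is $R$-torsion-free if its underlying $R$-module is. A homomorphism $f:C\to D$ of flat $R$-coalgebras is called pure if it is a pure homomorphism of $R$-modules; for injective $f$ this is the same as requiring $D/f(C)$ to be $R$-flat. "The image of $\omega$ is closed under taking subcomodules (resp. saturated subcomodules) of comodules of a certain class" means: for every $M\in\mathrm{comod}(C)$ in that class and every $D$-subcomodule (resp. saturated $D$-subcomodule)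 $N$ of $\omega(M)$, there is a $C$-subcomodule $M'$ of $M$ with $\omega(M')=N$. *)

theory Defs
  imports "HOL-Algebra.Algebra" "HOL-Library.Equipollence"
begin

section \<open>Modules\<close>

text \<open>The fields \<^term>\<open>monoid.mult\<close> and \<^term>\<open>one\<close>, which a module record inherits from \<open>ring\<close>,
  carry no meaning for modules.\<close>

definition mod_hom ::
  "('r, 'x) ring_scheme \<Rightarrow> ('r, 'a, 'y) module_scheme \<Rightarrow> ('r, 'b, 'z) module_scheme \<Rightarrow> ('a \<Rightarrow> 'b) set"
  where "mod_hom R M N = {h \<in> carrier M \<rightarrow> carrier N.
    (\<forall>x\<in>carrier M. \<forall>y\<in>carrier M. h (x \<oplus>\<^bsub>M\<^esub> y) = h x \<oplus>\<^bsub>N\<^esub> h y) \<and>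
    (\<forall>r\<in>carrier R. \<forall>x\<in>carrier M. h (r \<odot>\<^bsub>M\<^esub> x) = r \<odot>\<^bsub>N\<^esub> h x)}"

definition torsion_free :: "('r, 'x) ring_scheme \<Rightarrow> ('r, 'a, 'y) module_scheme \<Rightarrow> bool"
  where "torsion_free R M \<longleftrightarrow>
    (\<forall>r\<in>carrier R. \<forall>x\<in>carrier M. r \<odot>\<^bsub>M\<^esub> x = \<zero>\<^bsub>M\<^esub> \<longrightarrow> r = \<zero>\<^bsub>R\<^esub> \<or> x = \<zero>\<^bsub>M\<^esub>)"

definition regular_module :: "('r, 'x) ring_scheme \<Rightarrow> ('r, 'r) module"
  where "regular_module R = \<lparr>carrier = carrier R, monoid.mult = monoid.mult R, one = one R,
    ring.zero = ring.zero R, ring.add = ring.add R, module.smult = monoid.mult R\<rparr>"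

definition quotient_module ::
  "('r, 'x) ring_scheme \<Rightarrow> ('r, 'a, 'y) module_scheme \<Rightarrow> 'a set \<Rightarrow> ('r, 'a set) module"
  where "quotient_module R M H = \<lparr>carrier = a_rcosets\<^bsub>M\<^esub> H, monoid.mult = undefined, one = undefined,
    ring.zero = H, ring.add = set_add M, module.smult = (\<lambda>r K. \<Union>x\<in>K. H +>\<^bsub>M\<^esub> (r \<odot>\<^bsub>M\<^esub> x))\<rparr>"

definition submodule_gen ::
  "('r, 'x) ring_scheme \<Rightarrow> ('r, 'a, 'y) module_scheme \<Rightarrow> 'a set \<Rightarrow> 'a set"
  where "submodule_gen R M S = \<Inter>{H. submodule H R M \<and> S \<subseteq> H}"

section \<open>Tensor products\<close>

text \<open>The free module on \<open>S\<close>: finitely supported functions with support in \<open>S\<close>.\<close>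

definition free_module :: "('r, 'x) ring_scheme \<Rightarrow> 'a set \<Rightarrow> ('r, 'a \<Rightarrow> 'r) module"
  where "free_module R S = \<lparr>carrier = {\<phi>. (\<forall>p. \<phi> p \<in> carrier R) \<and> finite {p. \<phi> p \<noteq> \<zero>\<^bsub>R\<^esub>} \<and>
      {p. \<phi> p \<noteq> \<zero>\<^bsub>R\<^esub>} \<subseteq> S},
    monoid.mult = undefined, one = undefined, ring.zero = (\<lambda>p. \<zero>\<^bsub>R\<^esub>),
    ring.add = (\<lambda>\<phi> \<psi> p. \<phi> p \<oplus>\<^bsub>R\<^esub> \<psi> p), module.smult = (\<lambda>r \<phi> p. r \<otimes>\<^bsub>R\<^esub> \<phi> p)\<rparr>"

definition free_gen :: "('r, 'x) ring_scheme \<Rightarrow> 'a \<Rightarrow> 'a \<Rightarrow> 'r"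
  where "free_gen R a = (\<lambda>p. if p = a then \<one>\<^bsub>R\<^esub> else \<zero>\<^bsub>R\<^esub>)"

text \<open>The elements of the free module on \<open>M \<times> N\<close> that express bilinearity of \<open>(x, y) \<mapsto> x \<otimes> y\<close>.\<close>

definition tensor_gens ::
  "('r, 'x) ring_scheme \<Rightarrow> ('r, 'a, 'y) module_scheme \<Rightarrow> ('r, 'b, 'z) module_scheme \<Rightarrow> ('a \<times> 'b \<Rightarrow> 'r) set"
  where "tensor_gens R M N =
    (let F = free_module R (carrier M \<times> carrier N); e = (\<lambda>x y. free_gen R (x, y)) in
        {e (x \<oplus>\<^bsub>M\<^esub> x') y \<ominus>\<^bsub>F\<^esub> (e x y \<oplus>\<^bsub>F\<^esub> e x' y) | x x' y.
            x \<in> carrier M \<and> x' \<in> carrier M \<and> y \<in> carrier N} \<union>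
        {e x (y \<oplus>\<^bsub>N\<^esub> y') \<ominus>\<^bsub>F\<^esub> (e x y \<oplus>\<^bsub>F\<^esub> e x y') | x y y'.
            x \<in> carrier M \<and> y \<in> carrier N \<and> y' \<in> carrier N} \<union>
        {e (r \<odot>\<^bsub>M\<^esub> x) y \<ominus>\<^bsub>F\<^esub> r \<odot>\<^bsub>F\<^esub> e x y | r x y.
            r \<in> carrier R \<and> x \<in> carrier M \<and> y \<in> carrier N} \<union>
        {e x (r \<odot>\<^bsub>N\<^esub> y) \<ominus>\<^bsub>F\<^esub> r \<odot>\<^bsub>F\<^esub> e x y | r x y.
            r \<in> carrier R \<and> x \<in> carrier M \<and> y \<in> carrier N})"

definition tensor_rel ::
  "('r, 'x) ring_scheme \<Rightarrow> ('r, 'a, 'y) module_scheme \<Rightarrow> ('r, 'b, 'z) module_scheme \<Rightarrow> ('a \<times> 'b \<Rightarrow> 'r) set"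
  where "tensor_rel R M N =
    submodule_gen R (free_module R (carrier M \<times> carrier N)) (tensor_gens R M N)"

definition tensor ::
  "('r, 'x) ring_scheme \<Rightarrow> ('r, 'a, 'y) module_scheme \<Rightarrow> ('r, 'b, 'z) module_scheme
    \<Rightarrow> ('r, ('a \<times> 'b \<Rightarrow> 'r) set) module"
  where "tensor R M N =
    quotient_module R (free_module R (carrier M \<times> carrier N)) (tensor_rel R M N)"

definition tens ::
  "('r, 'x) ring_scheme \<Rightarrow> ('r, 'a, 'y) module_scheme \<Rightarrow> ('r, 'b, 'z) module_scheme
    \<Rightarrow> 'a \<Rightarrow> 'b \<Rightarrow> ('a \<times> 'b \<Rightarrow> 'r) set"
  where "tens R M N x y =
    tensor_rel R M N +>\<^bsub>free_module R (carrier M \<times> carrier N)\<^esub> free_gen R (x, y)"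

definition bilinear_map ::
  "('r, 'x) ring_scheme \<Rightarrow> ('r, 'a, 'y) module_scheme \<Rightarrow> ('r, 'b, 'z) module_scheme
    \<Rightarrow> ('r, 'p, 'w) module_scheme \<Rightarrow> ('a \<Rightarrow> 'b \<Rightarrow> 'p) \<Rightarrow> bool"
  where "bilinear_map R M N P b \<longleftrightarrow>
    (\<forall>x\<in>carrier M. b x \<in> mod_hom R N P) \<and> (\<forall>y\<in>carrier N. (\<lambda>x. b x y) \<in> mod_hom R M P)"

text \<open>The map out of a tensor product that is induced by a bilinear map \<open>b\<close> into \<open>P\<close>: a class
  \<open>[\<Sum>\<^sub>p \<phi>(p) p]\<close> is sent to \<open>\<Sum>\<^sub>p \<phi>(p) b(p)\<close>. By bilinearity the choice of the
  representative is immaterial, see \<open>tensor_lift_hom\<close> and \<open>tensor_lift_tens\<close> below.\<close>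

definition tensor_lift ::
  "('r, 'x) ring_scheme \<Rightarrow> ('r, 'p, 'y) module_scheme \<Rightarrow> ('a \<Rightarrow> 'b \<Rightarrow> 'p) \<Rightarrow> ('a \<times> 'b \<Rightarrow> 'r) set \<Rightarrow> 'p"
  where "tensor_lift R P b t =
    (let \<phi> = (SOME \<phi>. \<phi> \<in> t)
     in \<Oplus>\<^bsub>P\<^esub>p\<in>{p. \<phi> p \<noteq> \<zero>\<^bsub>R\<^esub>}. \<phi> p \<odot>\<^bsub>P\<^esub> b (fst p) (snd p))"

text \<open>\<open>tensor_map R M' N' g h\<close> is \<open>g \<otimes> h\<close> with codomain \<open>M' \<otimes> N'\<close>.\<close>

definition tensor_map ::
  "('r, 'x) ring_scheme \<Rightarrow> ('r, 'a2, 'y) module_scheme \<Rightarrow> ('r, 'b2, 'z) module_scheme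
    \<Rightarrow> ('a \<Rightarrow> 'a2) \<Rightarrow> ('b \<Rightarrow> 'b2) \<Rightarrow> ('a \<times> 'b \<Rightarrow> 'r) set \<Rightarrow> ('a2 \<times> 'b2 \<Rightarrow> 'r) set"
  where "tensor_map R M' N' g h = tensor_lift R (tensor R M' N') (\<lambda>x y. tens R M' N' (g x) (h y))"

text \<open>The associativity isomorphism \<open>(M \<otimes> N) \<otimes> P \<rightarrow> M \<otimes> (N \<otimes> P)\<close>.\<close>

definition tensor_assoc ::
  "('r, 'x) ring_scheme \<Rightarrow> ('r, 'a, 'y) module_scheme \<Rightarrow> ('r, 'b, 'z) module_scheme
    \<Rightarrow> ('r, 'c, 'w) module_scheme
    \<Rightarrow> (('a \<times> 'b \<Rightarrow> 'r) set \<times> 'c \<Rightarrow> 'r) set \<Rightarrow> ('a \<times> ('b \<times> 'c \<Rightarrow> 'r) set \<Rightarrow> 'r) set"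
  where "tensor_assoc R M N P =
    tensor_lift R (tensor R M (tensor R N P))
      (\<lambda>t z. tensor_lift R (tensor R M (tensor R N P))
        (\<lambda>x y. tens R M (tensor R N P) x (tens R N P y z)) t)"

subsection \<open>Basic facts\<close>


lemma (in cring) free_module_module: "module R (free_module R (S :: 's set))"
proof (rule moduleI)
  show "cring R" ..
  have *: "finite {p. \<phi> p \<oplus> \<psi> p \<noteq> \<zero>}" "{p. \<phi> p \<oplus> \<psi> p \<noteq> \<zero>} \<subseteq> S"
    if "finite {p. \<phi> p \<noteq> \<zero>}" "finite {p. \<psi> p \<noteq> \<zero>}" "{p. \<phi> p \<noteq> \<zero>} \<subseteq> S" "{p. \<psi> p \<noteq> \<zero>} \<subseteq> S"
    for \<phi> \<psi> :: "'s \<Rightarrow> 'a"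
  proof -
    have "{p. \<phi> p \<oplus> \<psi> p \<noteq> \<zero>} \<subseteq> {p. \<phi> p \<noteq> \<zero>} \<union> {p. \<psi> p \<noteq> \<zero>}" by auto
    then show "finite {p. \<phi> p \<oplus> \<psi> p \<noteq> \<zero>}" "{p. \<phi> p \<oplus> \<psi> p \<noteq> \<zero>} \<subseteq> S"
      using that finite_subset by (blast, blast)
  qed
  show "abelian_group (free_module R S)"
  proof (rule abelian_groupI)
    fix \<phi> assume p: "\<phi> \<in> carrier (free_module R S)"
    then have "{p. \<ominus> \<phi> p \<noteq> \<zero>} = {p. \<phi> p \<noteq> \<zero>}"
      by (auto simp: free_module_def)
    with p show "\<exists>\<psi>\<in>carrier (free_module R S). \<psi> \<oplus>\<^bsub>free_module R S\<^esub> \<phi> = \<zero>\<^bsub>free_module R S\<^esub>"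
      by (intro bexI[where x="\<lambda>p. \<ominus> \<phi> p"]) (auto simp: free_module_def l_neg)
  qed (auto simp: free_module_def fun_eq_iff a_ac *[simplified])
  fix a \<phi> assume a: "a \<in> carrier R" and p: "\<phi> \<in> carrier (free_module R S)"
  have "{p. a \<otimes> \<phi> p \<noteq> \<zero>} \<subseteq> {p. \<phi> p \<noteq> \<zero>}" using a by auto
  with a p show "a \<odot>\<^bsub>free_module R S\<^esub> \<phi> \<in> carrier (free_module R S)"
    by (auto simp: free_module_def intro: finite_subset)
qed (auto simp: free_module_def fun_eq_iff l_distr r_distr m_assoc)

lemma (in module) quotient_basic:
  assumes H: "submodule H R M"
  shows "K \<in> carrier (quotient_module R M H) \<longleftrightarrow> (\<exists>x\<in>carrier M. K = H +>\<^bsub>M\<^esub> x)"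
    "\<lbrakk>x \<in> carrier M; y \<in> carrier M\<rbrakk> \<Longrightarrow>
      (H +>\<^bsub>M\<^esub> x) \<oplus>\<^bsub>quotient_module R M H\<^esub> (H +>\<^bsub>M\<^esub> y) = H +>\<^bsub>M\<^esub> (x \<oplus>\<^bsub>M\<^esub> y)"
    "\<lbrakk>r \<in> carrier R; x \<in> carrier M\<rbrakk> \<Longrightarrow>
      r \<odot>\<^bsub>quotient_module R M H\<^esub> (H +>\<^bsub>M\<^esub> x) = H +>\<^bsub>M\<^esub> (r \<odot>\<^bsub>M\<^esub> x)"
    "\<lbrakk>x \<in> carrier M; y \<in> carrier M\<rbrakk> \<Longrightarrow> H +>\<^bsub>M\<^esub> x = H +>\<^bsub>M\<^esub> y \<longleftrightarrow> x \<ominus>\<^bsub>M\<^esub> y \<in> H"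
    "x \<in> carrier M \<Longrightarrow> y \<in> H +>\<^bsub>M\<^esub> x \<Longrightarrow> y \<in> carrier M \<and> y \<ominus>\<^bsub>M\<^esub> x \<in> H"
    "x \<in> carrier M \<Longrightarrow> x \<in> H +>\<^bsub>M\<^esub> x"
proof -
  interpret H: submodule H R M by (rule H)
  interpret A: abelian_subgroup H M
    by (rule abelian_subgroupI2[OF M.a_comm_group H.subgroup_axioms])
  have HM: "H \<subseteq> carrier M" using submoduleE(1)[OF H] .
  show "K \<in> carrier (quotient_module R M H) \<longleftrightarrow> (\<exists>x\<in>carrier M. K = H +>\<^bsub>M\<^esub> x)"
    by (auto simp: quotient_module_def A_RCOSETS_def')
  show "(H +>\<^bsub>M\<^esub> x) \<oplus>\<^bsub>quotient_module R M H\<^esub> (H +>\<^bsub>M\<^esub> y) = H +>\<^bsub>M\<^esub> (x \<oplus>\<^bsub>M\<^esub> y)"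
    if "x \<in> carrier M" "y \<in> carrier M"
    using A.a_rcos_sum[OF that] by (simp add: quotient_module_def)
  show 3: "x \<in> carrier M \<Longrightarrow> x \<in> H +>\<^bsub>M\<^esub> x" for x using A.a_rcos_self by auto
  show "r \<odot>\<^bsub>quotient_module R M H\<^esub> (H +>\<^bsub>M\<^esub> x) = H +>\<^bsub>M\<^esub> (r \<odot>\<^bsub>M\<^esub> x)"
    if r: "r \<in> carrier R" and x: "x \<in> carrier M"
  proof -
    have "H +>\<^bsub>M\<^esub> (r \<odot>\<^bsub>M\<^esub> y) = H +>\<^bsub>M\<^esub> (r \<odot>\<^bsub>M\<^esub> x)" if yx: "y \<in> H +>\<^bsub>M\<^esub> x" for y
    proof -
      obtain h where h: "h \<in> H" "y = h \<oplus>\<^bsub>M\<^esub> x" using yx by (auto simp: a_r_coset_def')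
      have "r \<odot>\<^bsub>M\<^esub> y = r \<odot>\<^bsub>M\<^esub> h \<oplus>\<^bsub>M\<^esub> r \<odot>\<^bsub>M\<^esub> x" using h r x HM smult_r_distr by auto
      then have "r \<odot>\<^bsub>M\<^esub> y \<in> H +>\<^bsub>M\<^esub> (r \<odot>\<^bsub>M\<^esub> x)" using h r by (auto simp: a_r_coset_def')
      then show ?thesis using r x M.a_repr_independence[OF _ _ H.subgroup_axioms] by (metis smult_closed)
    qed
    with 3[OF x] have "(\<Union>y\<in>H +>\<^bsub>M\<^esub> x. H +>\<^bsub>M\<^esub> (r \<odot>\<^bsub>M\<^esub> y)) = H +>\<^bsub>M\<^esub> (r \<odot>\<^bsub>M\<^esub> x)" by blast
    then show ?thesis by (simp add: quotient_module_def)
  qed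
  show 5: "y \<in> carrier M \<and> y \<ominus>\<^bsub>M\<^esub> x \<in> H" if yx: "x \<in> carrier M" "y \<in> H +>\<^bsub>M\<^esub> x" for x y
  proof -
    obtain h where h: "h \<in> H" "y = h \<oplus>\<^bsub>M\<^esub> x" using yx by (auto simp: a_r_coset_def')
    then show ?thesis using yx HM by (auto simp: a_minus_def M.a_assoc M.r_neg subset_iff)
  qed
  show "H +>\<^bsub>M\<^esub> x = H +>\<^bsub>M\<^esub> y \<longleftrightarrow> x \<ominus>\<^bsub>M\<^esub> y \<in> H" if xy: "x \<in> carrier M" "y \<in> carrier M"
  proof
    assume "H +>\<^bsub>M\<^esub> x = H +>\<^bsub>M\<^esub> y"
    then show "x \<ominus>\<^bsub>M\<^esub> y \<in> H" using 5[of y x] 3[OF xy(1)] xy by auto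
  next
    assume a: "x \<ominus>\<^bsub>M\<^esub> y \<in> H"
    have "x = (x \<ominus>\<^bsub>M\<^esub> y) \<oplus>\<^bsub>M\<^esub> y" using xy by (simp add: a_minus_def M.a_assoc M.l_neg)
    then have "x \<in> H +>\<^bsub>M\<^esub> y" using a by (auto simp: a_r_coset_def')
    then show "H +>\<^bsub>M\<^esub> x = H +>\<^bsub>M\<^esub> y" using xy M.a_repr_independence[OF _ _ H.subgroup_axioms] by metis
  qed
qed

lemma (in module) quotient_module_module:
  assumes H: "submodule H R M"
  shows "module R (quotient_module R M H)"
proof -
  interpret H: submodule H R M by (rule H)
  interpret A: abelian_subgroup H M
    by (rule abelian_subgroupI2[OF M.a_comm_group H.subgroup_axioms])
  let ?Q = "quotient_module R M H"
  have HM: "H \<subseteq> carrier M" using submoduleE(1)[OF H] .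
  have cg: "comm_group (M A_Mod H)" by (rule A.a_factorgroup_is_comm_group)
  interpret G: comm_group "M A_Mod H" by (rule cg)
  have ag: "abelian_group ?Q"
  proof (rule abelian_groupI)
    fix x assume "x \<in> carrier ?Q"
    then have "x \<in> carrier (M A_Mod H)" by (simp add: quotient_module_def A_FactGroup_def')
    from G.l_inv_ex[OF this] show "\<exists>y\<in>carrier ?Q. y \<oplus>\<^bsub>?Q\<^esub> x = \<zero>\<^bsub>?Q\<^esub>"
      by (simp add: quotient_module_def A_FactGroup_def')
  qed (use G.m_closed G.one_closed G.m_assoc G.m_comm G.l_one in
      \<open>simp_all add: quotient_module_def A_FactGroup_def'\<close>)
  show ?thesis
    by (rule moduleI)
      (auto simp: quotient_basic[OF H] R.is_cring ag smult_l_distr smult_r_distr smult_assoc1)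
qed


lemma (in module) submodule_gen_submodule:
  assumes "S \<subseteq> carrier M"
  shows "submodule (submodule_gen R M S) R M"
proof (rule submoduleI)
  have "submodule (carrier M) R M" by (rule carrier_is_submodule)
  then show "submodule_gen R M S \<subseteq> carrier M" using assms by (auto simp: submodule_gen_def)
  show "\<zero>\<^bsub>M\<^esub> \<in> submodule_gen R M S"
    by (auto simp: submodule_gen_def submodule_def dest: subgroup.one_closed)
qed (auto simp: submodule_gen_def dest: submoduleE)

lemma (in module) hom_zero:
  assumes "module R P" and h: "h \<in> mod_hom R M P"
  shows "h \<zero>\<^bsub>M\<^esub> = \<zero>\<^bsub>P\<^esub>"
proof -
  interpret P: module R P by fact
  have "h (\<zero>\<^bsub>R\<^esub> \<odot>\<^bsub>M\<^esub> \<zero>\<^bsub>M\<^esub>) = \<zero>\<^bsub>R\<^esub> \<odot>\<^bsub>P\<^esub> h \<zero>\<^bsub>M\<^esub>" "h \<zero>\<^bsub>M\<^esub> \<in> carrier P"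
    using h R.zero_closed M.zero_closed unfolding mod_hom_def by blast+
  then show ?thesis by simp
qed

lemma (in module) hom_neg:
  assumes "module R P" and h: "h \<in> mod_hom R M P" and x: "x \<in> carrier M"
  shows "h (\<ominus>\<^bsub>M\<^esub> x) = \<ominus>\<^bsub>P\<^esub> h x"
proof -
  interpret P: module R P by fact
  have "h (\<ominus>\<^bsub>M\<^esub> x \<oplus>\<^bsub>M\<^esub> x) = h (\<ominus>\<^bsub>M\<^esub> x) \<oplus>\<^bsub>P\<^esub> h x" and 1: "h (\<ominus>\<^bsub>M\<^esub> x) \<in> carrier P" "h x \<in> carrier P"
    using h x by (auto simp: mod_hom_def simp del: M.l_neg)
  then have "h (\<ominus>\<^bsub>M\<^esub> x) \<oplus>\<^bsub>P\<^esub> h x = \<zero>\<^bsub>P\<^esub>" using x hom_zero[OF assms(1,2)] by (simp add: M.l_neg)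
  then show ?thesis using 1 by (metis P.M.minus_equality)
qed

lemma (in module) kernel_submodule:
  assumes P: "module R P" and h: "h \<in> mod_hom R M P"
  shows "submodule {x \<in> carrier M. h x = \<zero>\<^bsub>P\<^esub>} R M"
proof -
  interpret P: module R P by fact
  show ?thesis
    by (rule submoduleI) (use h hom_zero[OF P h] hom_neg[OF P h] in \<open>auto simp: mod_hom_def\<close>)
qed

definition free_ext where
  "free_ext R P b = (\<lambda>\<phi>. \<Oplus>\<^bsub>P\<^esub>p\<in>{p. \<phi> p \<noteq> \<zero>\<^bsub>R\<^esub>}. \<phi> p \<odot>\<^bsub>P\<^esub> b p)"

lemma (in module) free_ext_eq:
  assumes phi: "\<phi> \<in> carrier (free_module R S)" and b: "b \<in> S \<rightarrow> carrier M"
    and A: "finite A" "{p. \<phi> p \<noteq> \<zero>\<^bsub>R\<^esub>} \<subseteq> A" "A \<subseteq> S"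
  shows "free_ext R M b \<phi> = (\<Oplus>\<^bsub>M\<^esub>p\<in>A. \<phi> p \<odot>\<^bsub>M\<^esub> b p)"
  unfolding free_ext_def
  by (rule M.add.finprod_mono_neutral_cong_left) (use assms in \<open>auto simp: free_module_def Pi_iff subset_iff\<close>)

lemma (in module) free_ext_hom:
  assumes b: "b \<in> S \<rightarrow> carrier M"
  shows "free_ext R M b \<in> mod_hom R (free_module R S) M"
proof -
  interpret F: module R "free_module R S" by (rule R.free_module_module)
  have cl: "\<phi> p \<odot>\<^bsub>M\<^esub> b p \<in> carrier M" if "\<phi> \<in> carrier (free_module R S)" "p \<in> S" for \<phi> p
    using that b by (auto simp: free_module_def)
  note eq = free_ext_eq[OF _ b]
  show ?thesis unfolding mod_hom_def
  proof (intro CollectI conjI ballI funcsetI)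
    fix \<phi> assume p: "\<phi> \<in> carrier (free_module R S)"
    then have A: "finite {p. \<phi> p \<noteq> \<zero>\<^bsub>R\<^esub>}" "{p. \<phi> p \<noteq> \<zero>\<^bsub>R\<^esub>} \<subseteq> S" by (auto simp: free_module_def)
    show "free_ext R M b \<phi> \<in> carrier M"
      unfolding free_ext_def using cl[OF p] A by (intro M.finsum_closed) auto
    { fix \<psi> assume q: "\<psi> \<in> carrier (free_module R S)"
      then have B: "finite {p. \<psi> p \<noteq> \<zero>\<^bsub>R\<^esub>}" "{p. \<psi> p \<noteq> \<zero>\<^bsub>R\<^esub>} \<subseteq> S" by (auto simp: free_module_def)
      let ?A = "{p. \<phi> p \<noteq> \<zero>\<^bsub>R\<^esub>} \<union> {p. \<psi> p \<noteq> \<zero>\<^bsub>R\<^esub>}"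
      have S: "finite ?A" "?A \<subseteq> S" using A B by auto
      have pq: "\<phi> \<oplus>\<^bsub>free_module R S\<^esub> \<psi> \<in> carrier (free_module R S)" using p q by simp
      have "free_ext R M b (\<phi> \<oplus>\<^bsub>free_module R S\<^esub> \<psi>) = (\<Oplus>\<^bsub>M\<^esub>p\<in>?A. (\<phi> \<oplus>\<^bsub>free_module R S\<^esub> \<psi>) p \<odot>\<^bsub>M\<^esub> b p)"
        using S p q by (intro eq[OF pq]) (auto simp: free_module_def)
      also have "\<dots> = (\<Oplus>\<^bsub>M\<^esub>p\<in>?A. \<phi> p \<odot>\<^bsub>M\<^esub> b p \<oplus>\<^bsub>M\<^esub> \<psi> p \<odot>\<^bsub>M\<^esub> b p)"
      proof (rule M.finsum_cong')
        show "(\<lambda>p. \<phi> p \<odot>\<^bsub>M\<^esub> b p \<oplus>\<^bsub>M\<^esub> \<psi> p \<odot>\<^bsub>M\<^esub> b p) \<in> ?A \<rightarrow> carrier M"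
          using cl[OF p] cl[OF q] S by auto
        fix i assume "i \<in> ?A"
        then have "b i \<in> carrier M" using S b by auto
        then show "(\<phi> \<oplus>\<^bsub>free_module R S\<^esub> \<psi>) i \<odot>\<^bsub>M\<^esub> b i = \<phi> i \<odot>\<^bsub>M\<^esub> b i \<oplus>\<^bsub>M\<^esub> \<psi> i \<odot>\<^bsub>M\<^esub> b i"
          using p q smult_l_distr by (auto simp: free_module_def)
      qed simp
      also have "\<dots> = (\<Oplus>\<^bsub>M\<^esub>p\<in>?A. \<phi> p \<odot>\<^bsub>M\<^esub> b p) \<oplus>\<^bsub>M\<^esub> (\<Oplus>\<^bsub>M\<^esub>p\<in>?A. \<psi> p \<odot>\<^bsub>M\<^esub> b p)"
        using cl[OF p] cl[OF q] S by (intro M.finsum_addf) auto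
      also have "(\<Oplus>\<^bsub>M\<^esub>p\<in>?A. \<phi> p \<odot>\<^bsub>M\<^esub> b p) = free_ext R M b \<phi>"
        using S by (intro eq[OF p, symmetric]) auto
      also have "(\<Oplus>\<^bsub>M\<^esub>p\<in>?A. \<psi> p \<odot>\<^bsub>M\<^esub> b p) = free_ext R M b \<psi>"
        using S by (intro eq[OF q, symmetric]) auto
      finally show "free_ext R M b (\<phi> \<oplus>\<^bsub>free_module R S\<^esub> \<psi>) = free_ext R M b \<phi> \<oplus>\<^bsub>M\<^esub> free_ext R M b \<psi>" . }
    { fix r assume r: "r \<in> carrier R"
      have rp: "r \<odot>\<^bsub>free_module R S\<^esub> \<phi> \<in> carrier (free_module R S)" using p r by simp
      have "free_ext R M b (r \<odot>\<^bsub>free_module R S\<^esub> \<phi>) = (\<Oplus>\<^bsub>M\<^esub>p\<in>{p. \<phi> p \<noteq> \<zero>\<^bsub>R\<^esub>}. (r \<odot>\<^bsub>free_module R S\<^esub> \<phi>) p \<odot>\<^bsub>M\<^esub> b p)"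
        using A r by (intro eq[OF rp]) (auto simp: free_module_def)
      also have "\<dots> = (\<Oplus>\<^bsub>M\<^esub>p\<in>{p. \<phi> p \<noteq> \<zero>\<^bsub>R\<^esub>}. r \<odot>\<^bsub>M\<^esub> (\<phi> p \<odot>\<^bsub>M\<^esub> b p))"
      proof (rule M.finsum_cong')
        show "(\<lambda>p. r \<odot>\<^bsub>M\<^esub> (\<phi> p \<odot>\<^bsub>M\<^esub> b p)) \<in> {p. \<phi> p \<noteq> \<zero>\<^bsub>R\<^esub>} \<rightarrow> carrier M"
          using cl[OF p] A r by auto
        fix i assume "i \<in> {p. \<phi> p \<noteq> \<zero>\<^bsub>R\<^esub>}"
        then have "b i \<in> carrier M" using A b by auto
        then show "(r \<odot>\<^bsub>free_module R S\<^esub> \<phi>) i \<odot>\<^bsub>M\<^esub> b i = r \<odot>\<^bsub>M\<^esub> (\<phi> i \<odot>\<^bsub>M\<^esub> b i)"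
          using p r smult_assoc1 by (auto simp: free_module_def)
      qed simp
      also have "\<dots> = r \<odot>\<^bsub>M\<^esub> (\<Oplus>\<^bsub>M\<^esub>p\<in>{p. \<phi> p \<noteq> \<zero>\<^bsub>R\<^esub>}. \<phi> p \<odot>\<^bsub>M\<^esub> b p)"
        using cl[OF p] A r by (intro finsum_smult_ldistr[symmetric]) auto
      finally show "free_ext R M b (r \<odot>\<^bsub>free_module R S\<^esub> \<phi>) = r \<odot>\<^bsub>M\<^esub> free_ext R M b \<phi>"
        by (simp add: free_ext_def) }
  qed
qed

lemma (in cring) free_gen_closed: "a \<in> S \<Longrightarrow> free_gen R a \<in> carrier (free_module R S)"
  by (auto simp: free_module_def free_gen_def)

lemma (in module) free_ext_gen:
  assumes b: "b \<in> S \<rightarrow> carrier M" and a: "a \<in> S"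
  shows "free_ext R M b (free_gen R a) = b a"
proof -
  have "free_ext R M b (free_gen R a) = (\<Oplus>\<^bsub>M\<^esub>p\<in>{a}. free_gen R a p \<odot>\<^bsub>M\<^esub> b p)"
    using a by (intro free_ext_eq[OF R.free_gen_closed[OF a] b]) (auto simp: free_gen_def)
  then show ?thesis using a b by (auto simp: free_gen_def Pi_iff)
qed

lemma tensor_gens_closed:
  assumes "module R M" "module R N"
  shows "tensor_gens R M N \<subseteq> carrier (free_module R (carrier M \<times> carrier N))"
proof -
  interpret M: module R M by fact
  interpret N: module R N by fact
  interpret F: module R "free_module R (carrier M \<times> carrier N)" by (rule M.R.free_module_module)
  show ?thesis unfolding tensor_gens_def Let_def
    by (auto intro!: F.M.minus_closed F.M.a_closed F.smult_closed M.R.free_gen_closed)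
qed

lemma tensor_rel_submodule:
  assumes "module R M" "module R N"
  shows "submodule (tensor_rel R M N) R (free_module R (carrier M \<times> carrier N))"
proof -
  interpret M: module R M by fact
  interpret F: module R "free_module R (carrier M \<times> carrier N)" by (rule M.R.free_module_module)
  show ?thesis unfolding tensor_rel_def
    by (rule F.submodule_gen_submodule[OF tensor_gens_closed[OF assms]])
qed

lemma tensor_module:
  assumes "module R M" "module R N"
  shows "module R (tensor R M N)"
proof -
  interpret M: module R M by fact
  interpret F: module R "free_module R (carrier M \<times> carrier N)" by (rule M.R.free_module_module)
  show ?thesis unfolding tensor_def by (rule F.quotient_module_module[OF tensor_rel_submodule[OF assms]])
qed

lemma tensor_carrier:
  assumes "module R M" "module R N"
  shows "t \<in> carrier (tensor R M N) \<longleftrightarrow> (\<exists>\<phi>\<in>carrier (free_module R (carrier M \<times> carrier N)).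
      t = tensor_rel R M N +>\<^bsub>free_module R (carrier M \<times> carrier N)\<^esub> \<phi>)"
proof -
  interpret M: module R M by fact
  interpret F: module R "free_module R (carrier M \<times> carrier N)" by (rule M.R.free_module_module)
  show ?thesis unfolding tensor_def by (rule F.quotient_basic(1)[OF tensor_rel_submodule[OF assms]])
qed

lemma tensor_lift_coset:
  assumes M: "module R M" and N: "module R N" and P: "module R P"
    and b: "bilinear_map R M N P b"
    and phi: "\<phi> \<in> carrier (free_module R (carrier M \<times> carrier N))"
  shows "tensor_lift R P b (tensor_rel R M N +>\<^bsub>free_module R (carrier M \<times> carrier N)\<^esub> \<phi>)
    = free_ext R P (\<lambda>p. b (fst p) (snd p)) \<phi>"
proof -
  interpret M: module R M by fact
  interpret N: module R N by fact
  interpret P: module R P by fact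
  let ?F = "free_module R (carrier M \<times> carrier N)"
  let ?b = "\<lambda>p. b (fst p) (snd p)"
  let ?h = "free_ext R P ?b"
  interpret F: module R ?F by (rule M.R.free_module_module)
  have bc: "?b \<in> carrier M \<times> carrier N \<rightarrow> carrier P"
    using b by (auto simp: bilinear_map_def mod_hom_def Pi_iff)
  have h: "?h \<in> mod_hom R ?F P" by (rule P.free_ext_hom[OF bc])
  have g: "?h (free_gen R (x, y)) = b x y" if "x \<in> carrier M" "y \<in> carrier N" for x y
    using P.free_ext_gen[OF bc] that by auto
  have gc: "free_gen R (x, y) \<in> carrier ?F" if "x \<in> carrier M" "y \<in> carrier N" for x y
    using that by (intro M.R.free_gen_closed) auto
  have hm: "?h (\<phi> \<ominus>\<^bsub>?F\<^esub> \<psi>) = ?h \<phi> \<ominus>\<^bsub>P\<^esub> ?h \<psi>" if "\<phi> \<in> carrier ?F" "\<psi> \<in> carrier ?F" for \<phi> \<psi>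
    using that h F.hom_neg[OF P h] by (auto simp: a_minus_def mod_hom_def)
  have ha: "?h (\<phi> \<oplus>\<^bsub>?F\<^esub> \<psi>) = ?h \<phi> \<oplus>\<^bsub>P\<^esub> ?h \<psi>" if "\<phi> \<in> carrier ?F" "\<psi> \<in> carrier ?F" for \<phi> \<psi>
    using that h by (auto simp: mod_hom_def Pi_iff)
  have hs: "?h (r \<odot>\<^bsub>?F\<^esub> \<psi>) = r \<odot>\<^bsub>P\<^esub> ?h \<psi>" if "r \<in> carrier R" "\<psi> \<in> carrier ?F" for r \<psi>
    using that h by (auto simp: mod_hom_def Pi_iff)
  have bP: "b x y \<in> carrier P" if "x \<in> carrier M" "y \<in> carrier N" for x y
    using funcset_mem[OF bc, of "(x, y)"] that by auto
  have b1: "b (x \<oplus>\<^bsub>M\<^esub> x') y = b x y \<oplus>\<^bsub>P\<^esub> b x' y" if "x \<in> carrier M" "x' \<in> carrier M" "y \<in> carrier N" for x x' y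
    using b that by (auto simp: bilinear_map_def mod_hom_def Pi_iff)
  have b2: "b x (y \<oplus>\<^bsub>N\<^esub> y') = b x y \<oplus>\<^bsub>P\<^esub> b x y'" if "x \<in> carrier M" "y' \<in> carrier N" "y \<in> carrier N" for x y' y
    using b that by (auto simp: bilinear_map_def mod_hom_def Pi_iff)
  have b3: "b (r \<odot>\<^bsub>M\<^esub> x) y = r \<odot>\<^bsub>P\<^esub> b x y" "b x (r \<odot>\<^bsub>N\<^esub> y) = r \<odot>\<^bsub>P\<^esub> b x y"
    if "x \<in> carrier M" "r \<in> carrier R" "y \<in> carrier N" for x r y
    using b that by (auto simp: bilinear_map_def mod_hom_def Pi_iff)
  have gk: "tensor_gens R M N \<subseteq> {\<phi> \<in> carrier ?F. ?h \<phi> = \<zero>\<^bsub>P\<^esub>}"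
    using tensor_gens_closed[OF M N]
    unfolding tensor_gens_def Let_def
    by (auto simp: hm ha hs g gc bP b1 b2 b3 P.M.r_neg a_minus_def[of P])
  have rk: "tensor_rel R M N \<subseteq> {\<phi> \<in> carrier ?F. ?h \<phi> = \<zero>\<^bsub>P\<^esub>}"
    unfolding tensor_rel_def submodule_gen_def using F.kernel_submodule[OF P h] gk by blast
  note qb = F.quotient_basic[OF tensor_rel_submodule[OF M N]]
  define \<psi> where "\<psi> = (SOME \<psi>. \<psi> \<in> tensor_rel R M N +>\<^bsub>?F\<^esub> \<phi>)"
  have "\<psi> \<in> tensor_rel R M N +>\<^bsub>?F\<^esub> \<phi>"
    unfolding \<psi>_def using qb(6)[OF phi] by (rule someI[where P="\<lambda>\<psi>. \<psi> \<in> _"])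
  from qb(5)[OF phi this] have psi: "\<psi> \<in> carrier ?F" and "\<psi> \<ominus>\<^bsub>?F\<^esub> \<phi> \<in> tensor_rel R M N" by auto
  then have "?h \<psi> \<ominus>\<^bsub>P\<^esub> ?h \<phi> = \<zero>\<^bsub>P\<^esub>" using rk hm[OF psi phi] by auto
  moreover have "?h \<psi> \<in> carrier P" "?h \<phi> \<in> carrier P" using psi phi h by (auto simp: mod_hom_def Pi_iff)
  ultimately have "?h \<psi> = ?h \<phi>"
    using P.M.minus_equality[of "?h \<psi>" "\<ominus>\<^bsub>P\<^esub> ?h \<phi>"] by (simp add: a_minus_def)
  then show ?thesis by (simp add: tensor_lift_def free_ext_def Let_def \<psi>_def)
qed

lemma tens_closed:
  assumes "module R M" "module R N" "x \<in> carrier M" "y \<in> carrier N"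
  shows "tens R M N x y \<in> carrier (tensor R M N)"
proof -
  interpret M: module R M by fact
  show ?thesis using assms M.R.free_gen_closed[of "(x,y)" "carrier M \<times> carrier N"]
    by (auto simp: tensor_carrier tens_def)
qed

lemma tensor_lift_tens:
  assumes M: "module R M" and N: "module R N" and P: "module R P"
    and b: "bilinear_map R M N P b" and x: "x \<in> carrier M" and y: "y \<in> carrier N"
  shows "tensor_lift R P b (tens R M N x y) = b x y"
proof -
  interpret M: module R M by fact
  interpret P: module R P by fact
  have bc: "(\<lambda>p. b (fst p) (snd p)) \<in> carrier M \<times> carrier N \<rightarrow> carrier P"
    using b by (auto simp: bilinear_map_def mod_hom_def Pi_iff)
  have "free_gen R (x, y) \<in> carrier (free_module R (carrier M \<times> carrier N))"
    using x y by (intro M.R.free_gen_closed) auto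
  from tensor_lift_coset[OF M N P b this] P.free_ext_gen[OF bc, of "(x,y)"] x y
  show ?thesis by (simp add: tens_def)
qed

lemma tensor_lift_hom:
  assumes M: "module R M" and N: "module R N" and P: "module R P"
    and b: "bilinear_map R M N P b"
  shows "tensor_lift R P b \<in> mod_hom R (tensor R M N) P"
proof -
  interpret M: module R M by fact
  interpret P: module R P by fact
  let ?F = "free_module R (carrier M \<times> carrier N)"
  interpret F: module R ?F by (rule M.R.free_module_module)
  have bc: "(\<lambda>p. b (fst p) (snd p)) \<in> carrier M \<times> carrier N \<rightarrow> carrier P"
    using b by (auto simp: bilinear_map_def mod_hom_def Pi_iff)
  note h = P.free_ext_hom[OF bc]
  note qb = F.quotient_basic[OF tensor_rel_submodule[OF M N]]
  note l = tensor_lift_coset[OF M N P b]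
  show ?thesis unfolding mod_hom_def
  proof (intro CollectI conjI ballI funcsetI)
    fix t assume "t \<in> carrier (tensor R M N)"
    then obtain \<phi> where p: "\<phi> \<in> carrier ?F" "t = tensor_rel R M N +>\<^bsub>?F\<^esub> \<phi>"
      using tensor_carrier[OF M N] by blast
    then show "tensor_lift R P b t \<in> carrier P" using l h by (auto simp: mod_hom_def Pi_iff)
    { fix r assume "r \<in> carrier R"
      then show "tensor_lift R P b (r \<odot>\<^bsub>tensor R M N\<^esub> t) = r \<odot>\<^bsub>P\<^esub> tensor_lift R P b t"
        using p h by (auto simp: tensor_def qb(3) l mod_hom_def) }
    { fix s assume "s \<in> carrier (tensor R M N)"
      then obtain \<psi> where q: "\<psi> \<in> carrier ?F" "s = tensor_rel R M N +>\<^bsub>?F\<^esub> \<psi>"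
        using tensor_carrier[OF M N] by blast
      then show "tensor_lift R P b (t \<oplus>\<^bsub>tensor R M N\<^esub> s) = tensor_lift R P b t \<oplus>\<^bsub>P\<^esub> tensor_lift R P b s"
        using p h by (auto simp: tensor_def qb(2) l mod_hom_def) }
  qed
qed

lemma tens_bilinear:
  assumes M: "module R M" and N: "module R N"
  shows "bilinear_map R M N (tensor R M N) (tens R M N)"
proof -
  interpret M: module R M by fact
  interpret N: module R N by fact
  let ?F = "free_module R (carrier M \<times> carrier N)"
  interpret F: module R ?F by (rule M.R.free_module_module)
  note qb = F.quotient_basic[OF tensor_rel_submodule[OF M N]]
  have gc: "free_gen R (x, y) \<in> carrier ?F" if "x \<in> carrier M" "y \<in> carrier N" for x y
    using that by (intro M.R.free_gen_closed) auto
  have g: "tensor_gens R M N \<subseteq> tensor_rel R M N"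
    by (auto simp: tensor_rel_def submodule_gen_def)
  show ?thesis unfolding bilinear_map_def mod_hom_def
  proof (intro CollectI conjI ballI funcsetI)
    fix x x' y assume A: "x \<in> carrier M" "x' \<in> carrier M" "y \<in> carrier N"
    show "tens R M N (x \<oplus>\<^bsub>M\<^esub> x') y = tens R M N x y \<oplus>\<^bsub>tensor R M N\<^esub> tens R M N x' y"
      unfolding tens_def tensor_def using A
      by (simp add: qb(2) gc, subst qb(4))
        (auto simp: gc intro!: subsetD[OF g], auto simp: tensor_gens_def Let_def)
  next
    fix x y y' assume A: "x \<in> carrier M" "y \<in> carrier N" "y' \<in> carrier N"
    show "tens R M N x (y \<oplus>\<^bsub>N\<^esub> y') = tens R M N x y \<oplus>\<^bsub>tensor R M N\<^esub> tens R M N x y'"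
      unfolding tens_def tensor_def using A
      by (simp add: qb(2) gc, subst qb(4))
        (auto simp: gc intro!: subsetD[OF g], auto simp: tensor_gens_def Let_def)
  next
    fix x r y assume A: "x \<in> carrier M" "r \<in> carrier R" "y \<in> carrier N"
    show "tens R M N (r \<odot>\<^bsub>M\<^esub> x) y = r \<odot>\<^bsub>tensor R M N\<^esub> tens R M N x y"
      unfolding tens_def tensor_def using A
      by (simp add: qb(3) gc, subst qb(4))
        (auto simp: gc intro!: subsetD[OF g], auto simp: tensor_gens_def Let_def)
    show "tens R M N x (r \<odot>\<^bsub>N\<^esub> y) = r \<odot>\<^bsub>tensor R M N\<^esub> tens R M N x y"
      unfolding tens_def tensor_def using A
      by (simp add: qb(3) gc, subst qb(4))
        (auto simp: gc intro!: subsetD[OF g], auto simp: tensor_gens_def Let_def)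
  qed (auto intro: tens_closed assms)
qed


lemma tensor_hom_eq:
  assumes M: "module R M" and N: "module R N" and P: "module R P"
    and g: "g \<in> mod_hom R (tensor R M N) P" and h: "h \<in> mod_hom R (tensor R M N) P"
    and eq: "\<And>x y. x \<in> carrier M \<Longrightarrow> y \<in> carrier N \<Longrightarrow> g (tens R M N x y) = h (tens R M N x y)"
    and t: "t \<in> carrier (tensor R M N)"
  shows "g t = h t"
proof -
  interpret M: module R M by fact
  interpret N: module R N by fact
  interpret P: module R P by fact
  let ?F = "free_module R (carrier M \<times> carrier N)"
  interpret F: module R ?F by (rule M.R.free_module_module)
  interpret T: module R "tensor R M N" by (rule tensor_module[OF M N])
  note qb = F.quotient_basic[OF tensor_rel_submodule[OF M N]]
  let ?c = "\<lambda>\<phi>. tensor_rel R M N +>\<^bsub>?F\<^esub> \<phi>"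
  have c_add: "?c (\<phi> \<oplus>\<^bsub>?F\<^esub> \<psi>) = ?c \<phi> \<oplus>\<^bsub>tensor R M N\<^esub> ?c \<psi>"
    if "\<phi> \<in> carrier ?F" "\<psi> \<in> carrier ?F" for \<phi> \<psi>
    using qb(2)[OF that] by (simp add: tensor_def)
  have c_sm: "?c (r \<odot>\<^bsub>?F\<^esub> \<phi>) = r \<odot>\<^bsub>tensor R M N\<^esub> ?c \<phi>"
    if "r \<in> carrier R" "\<phi> \<in> carrier ?F" for r \<phi>
    using qb(3)[OF that] by (simp add: tensor_def)
  have c_in: "?c \<phi> \<in> carrier (tensor R M N)" if "\<phi> \<in> carrier ?F" for \<phi>
    using that tensor_carrier[OF M N] by blast
  have main: "\<phi> \<in> carrier ?F \<Longrightarrow> {p. \<phi> p \<noteq> \<zero>\<^bsub>R\<^esub>} = A \<Longrightarrow> g (?c \<phi>) = h (?c \<phi>)" if "finite A" for A \<phi>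
    using that
  proof (induction A arbitrary: \<phi> rule: finite_induct)
    case empty
    then have "\<phi> = \<zero>\<^bsub>?F\<^esub>" by (auto simp: free_module_def fun_eq_iff)
    then have "?c \<phi> = ?c (\<zero>\<^bsub>R\<^esub> \<odot>\<^bsub>?F\<^esub> \<zero>\<^bsub>?F\<^esub>)" by simp
    also have "\<dots> = \<zero>\<^bsub>tensor R M N\<^esub>" using c_in[OF F.M.zero_closed] by (simp only: c_sm M.R.zero_closed F.M.zero_closed T.smult_l_null)
    finally show ?case using T.hom_zero[OF P g] T.hom_zero[OF P h] by simp
  next
    case (insert a A)
    obtain x y where a: "a = (x, y)" "x \<in> carrier M" "y \<in> carrier N"
      using insert.prems by (auto simp: free_module_def)
    define \<psi> where "\<psi> = \<phi>(a := \<zero>\<^bsub>R\<^esub>)"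
    have r: "\<phi> a \<in> carrier R" using insert.prems by (auto simp: free_module_def)
    have supp: "{p. \<psi> p \<noteq> \<zero>\<^bsub>R\<^esub>} = A" using insert.prems insert.hyps by (auto simp: \<psi>_def)
    have psi: "\<psi> \<in> carrier ?F"
      using insert.prems supp insert.hyps(1) by (auto simp: free_module_def) (auto simp: \<psi>_def)
    have gen: "free_gen R a \<in> carrier ?F" using a by (intro M.R.free_gen_closed) auto
    have eqphi: "\<phi> = \<phi> a \<odot>\<^bsub>?F\<^esub> free_gen R a \<oplus>\<^bsub>?F\<^esub> \<psi>"
      using insert.prems(1) r by (auto simp: free_module_def free_gen_def \<psi>_def fun_eq_iff)
    have "?c \<phi> = \<phi> a \<odot>\<^bsub>tensor R M N\<^esub> ?c (free_gen R a) \<oplus>\<^bsub>tensor R M N\<^esub> ?c \<psi>"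
      by (subst eqphi) (simp only: c_add c_sm r gen psi F.smult_closed)
    then have "?c \<phi> = \<phi> a \<odot>\<^bsub>tensor R M N\<^esub> tens R M N x y \<oplus>\<^bsub>tensor R M N\<^esub> ?c \<psi>"
      by (simp add: tens_def a)
    moreover have "tens R M N x y \<in> carrier (tensor R M N)" using tens_closed[OF M N] a by blast
    ultimately show ?case
      using g h insert.IH[OF psi supp] eq[OF a(2,3)] r c_in[OF psi]
      by (simp add: mod_hom_def)
  qed
  obtain \<phi> where "\<phi> \<in> carrier ?F" "t = ?c \<phi>" using t tensor_carrier[OF M N] by blast
  moreover then have "finite {p. \<phi> p \<noteq> \<zero>\<^bsub>R\<^esub>}" by (auto simp: free_module_def)
  ultimately show ?thesis using main by blast
qed

lemma bilinear_map_comp: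
  assumes "bilinear_map R M' N' P b" "g \<in> mod_hom R M M'" "h \<in> mod_hom R N N'"
  shows "bilinear_map R M N P (\<lambda>x y. b (g x) (h y))"
  using assms by (auto simp: bilinear_map_def mod_hom_def Pi_iff)

lemma tensor_map_hom:
  assumes "module R M" "module R N" "module R M'" "module R N'"
    and "g \<in> mod_hom R M M'" "h \<in> mod_hom R N N'"
  shows "tensor_map R M' N' g h \<in> mod_hom R (tensor R M N) (tensor R M' N')"
  unfolding tensor_map_def
  by (rule tensor_lift_hom) (auto intro: tensor_module bilinear_map_comp[OF tens_bilinear] assms)

lemma tensor_map_tens:
  assumes "module R M" "module R N" "module R M'" "module R N'"
    and "g \<in> mod_hom R M M'" "h \<in> mod_hom R N N'" "x \<in> carrier M" "y \<in> carrier N"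
  shows "tensor_map R M' N' g h (tens R M N x y) = tens R M' N' (g x) (h y)"
  unfolding tensor_map_def
  by (rule tensor_lift_tens) (auto intro: tensor_module bilinear_map_comp[OF tens_bilinear] assms)

lemma tensor_assoc_bilinear:
  assumes M: "module R M" and N: "module R N" and P: "module R P"
  shows "z \<in> carrier P \<Longrightarrow> bilinear_map R M N (tensor R M (tensor R N P))
      (\<lambda>x y. tens R M (tensor R N P) x (tens R N P y z))"
    and "bilinear_map R (tensor R M N) P (tensor R M (tensor R N P))
      (\<lambda>t z. tensor_lift R (tensor R M (tensor R N P))
        (\<lambda>x y. tens R M (tensor R N P) x (tens R N P y z)) t)"
proof -
  note NP = tensor_module[OF N P]
  note MNP = tensor_module[OF M NP]
  note MN = tensor_module[OF M N]
  interpret T: module R "tensor R M (tensor R N P)" by (rule MNP)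
  let ?T = "tensor R M (tensor R N P)"
  let ?b = "\<lambda>z x y. tens R M (tensor R N P) x (tens R N P y z)"
  show 1: "bilinear_map R M N ?T (?b z)" if "z \<in> carrier P" for z
    using tens_bilinear[OF M NP] tens_bilinear[OF N P] that tens_closed[OF N P]
    by (auto simp: bilinear_map_def mod_hom_def Pi_iff)
  let ?l = "\<lambda>z. tensor_lift R ?T (?b z)"
  note lt = tensor_lift_tens[OF M N MNP 1] and lh = tensor_lift_hom[OF M N MNP 1]
  have lc: "?l z t \<in> carrier ?T" if "z \<in> carrier P" "t \<in> carrier (tensor R M N)" for z t
    using lh that by (auto simp: mod_hom_def Pi_iff)
  have l: "?l z (t \<oplus>\<^bsub>tensor R M N\<^esub> s) = ?l z t \<oplus>\<^bsub>?T\<^esub> ?l z s"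
    if "z \<in> carrier P" "t \<in> carrier (tensor R M N)" "s \<in> carrier (tensor R M N)" for z t s
    using lh that by (auto simp: mod_hom_def Pi_iff)
  have ls: "?l z (r \<odot>\<^bsub>tensor R M N\<^esub> t) = r \<odot>\<^bsub>?T\<^esub> ?l z t"
    if "z \<in> carrier P" "t \<in> carrier (tensor R M N)" "r \<in> carrier R" for z t r
    using lh that by (auto simp: mod_hom_def Pi_iff)
  interpret P: module R P by (rule P)
  have add: "?l (z \<oplus>\<^bsub>P\<^esub> z') t = ?l z t \<oplus>\<^bsub>?T\<^esub> ?l z' t"
    if z: "z \<in> carrier P" "z' \<in> carrier P" and t: "t \<in> carrier (tensor R M N)" for z z' t
  proof (rule tensor_hom_eq[OF M N MNP lh _ _ t])
    show "(\<lambda>t. ?l z t \<oplus>\<^bsub>?T\<^esub> ?l z' t) \<in> mod_hom R (tensor R M N) ?T"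
      using z by (auto simp: mod_hom_def lc l ls T.M.a_ac T.smult_r_distr)
    fix x y assume "x \<in> carrier M" "y \<in> carrier N"
    then show "?l (z \<oplus>\<^bsub>P\<^esub> z') (tens R M N x y) = ?l z (tens R M N x y) \<oplus>\<^bsub>?T\<^esub> ?l z' (tens R M N x y)"
      using z tens_bilinear[OF M NP] tens_bilinear[OF N P] tens_closed[OF N P]
      by (auto simp: lt bilinear_map_def mod_hom_def Pi_iff)
  qed (use z in auto)
  have sm: "?l (r \<odot>\<^bsub>P\<^esub> z) t = r \<odot>\<^bsub>?T\<^esub> ?l z t"
    if z: "z \<in> carrier P" "r \<in> carrier R" and t: "t \<in> carrier (tensor R M N)" for z r t
  proof (rule tensor_hom_eq[OF M N MNP lh _ _ t])
    show "(\<lambda>t. r \<odot>\<^bsub>?T\<^esub> ?l z t) \<in> mod_hom R (tensor R M N) ?T"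
      using z by (auto simp: mod_hom_def lc l ls T.smult_r_distr T.smult_assoc1[symmetric] T.R.m_comm)
    fix x y assume "x \<in> carrier M" "y \<in> carrier N"
    then show "?l (r \<odot>\<^bsub>P\<^esub> z) (tens R M N x y) = r \<odot>\<^bsub>?T\<^esub> ?l z (tens R M N x y)"
      using z tens_bilinear[OF M NP] tens_bilinear[OF N P] tens_closed[OF N P]
      by (auto simp: lt bilinear_map_def mod_hom_def Pi_iff)
  qed (use z in auto)
  show "bilinear_map R (tensor R M N) P ?T (\<lambda>t z. ?l z t)"
    unfolding bilinear_map_def using lh by (auto simp: mod_hom_def lc add sm)
qed

lemma tensor_assoc_hom:
  assumes M: "module R M" and N: "module R N" and P: "module R P"
  shows "tensor_assoc R M N P \<in> mod_hom R (tensor R (tensor R M N) P) (tensor R M (tensor R N P))"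
  unfolding tensor_assoc_def
  by (rule tensor_lift_hom) (auto intro: tensor_module tensor_assoc_bilinear assms)

lemma tensor_assoc_tens:
  assumes M: "module R M" and N: "module R N" and P: "module R P"
    and xyz: "x \<in> carrier M" "y \<in> carrier N" "z \<in> carrier P"
  shows "tensor_assoc R M N P (tens R (tensor R M N) P (tens R M N x y) z) =
    tens R M (tensor R N P) x (tens R N P y z)"
  unfolding tensor_assoc_def
  by (subst tensor_lift_tens[OF tensor_module[OF M N] P tensor_module[OF M tensor_module[OF N P]]
        tensor_assoc_bilinear(2)[OF M N P] tens_closed[OF M N xyz(1,2)] xyz(3)])
    (rule tensor_lift_tens[OF M N tensor_module[OF M tensor_module[OF N P]]
        tensor_assoc_bilinear(1)[OF M N P xyz(3)] xyz(1,2)])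

section \<open>Flatness and purity\<close>

text \<open>Both notions quantify over all \<open>R\<close>-modules, which HOL only permits over one type of elements at a
  time; the type \<open>'u\<close> plays the role of the universe. As soon as \<open>carrier R\<close> embeds into
  \<open>'u\<close>, copies of all inclusions of ideals into \<open>R\<close> occur among the test maps, so that
  \<open>flat TYPE('u)\<close> is flatness in the usual sense. Likewise comodules are taken with elements in a
  type \<open>'u\<close>. If \<open>'u\<close> is infinite and the carriers of \<open>R\<close>, \<open>C\<close>, \<open>D\<close> embed into it,
  then, up to isomorphism, the modules over \<open>'u\<close> contain \<open>R\<close>, \<open>C\<close>, \<open>D\<close> and are closed under
  submodules, quotients, finite direct sums and tensor products.\<close>

definition flat :: "'u itself \<Rightarrow> ('r, 'x) ring_scheme \<Rightarrow> ('r, 'a, 'y) module_scheme \<Rightarrow> bool"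
  where "flat U R C \<longleftrightarrow>
    (\<forall>(N :: ('r, 'u) module) (N' :: ('r, 'u) module) g.
      module R N \<and> module R N' \<and> g \<in> mod_hom R N N' \<and> inj_on g (carrier N) \<longrightarrow>
      inj_on (tensor_map R N' C g (\<lambda>x. x)) (carrier (tensor R N C)))"

definition pure_hom ::
  "'u itself \<Rightarrow> ('r, 'x) ring_scheme \<Rightarrow> ('r, 'a, 'y) module_scheme \<Rightarrow> ('r, 'b, 'z) module_scheme
    \<Rightarrow> ('a \<Rightarrow> 'b) \<Rightarrow> bool"
  where "pure_hom U R C D f \<longleftrightarrow> f \<in> mod_hom R C D \<and>
    (\<forall>N :: ('r, 'u) module. module R N \<longrightarrow>
      inj_on (tensor_map R D N f (\<lambda>x. x)) (carrier (tensor R C N)))"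

section \<open>Coalgebras and comodules\<close>

record ('r, 'c) coalg = "('r, 'c) module" +
  comul :: "'c \<Rightarrow> ('c \<times> 'c \<Rightarrow> 'r) set"
  counit :: "'c \<Rightarrow> 'r"

text \<open>The counit laws are stated in \<open>C \<otimes> R\<close> and \<open>R \<otimes> C\<close>, i.e. without applying the
  canonical isomorphisms with \<open>C\<close>.\<close>

locale coalgebra = C: module R C
  for R :: "('r, 'x) ring_scheme" and C :: "('r, 'c, 'y) coalg_scheme" +
  assumes comul_hom: "comul C \<in> mod_hom R C (tensor R C C)"
    and counit_hom: "counit C \<in> mod_hom R C (regular_module R)"
    and coassoc: "x \<in> carrier C \<Longrightarrow>
      tensor_assoc R C C C (tensor_map R (tensor R C C) C (comul C) (\<lambda>y. y) (comul C x)) =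
      tensor_map R C (tensor R C C) (\<lambda>y. y) (comul C) (comul C x)"
    and counit_right: "x \<in> carrier C \<Longrightarrow>
      tensor_map R C (regular_module R) (\<lambda>y. y) (counit C) (comul C x) =
      tens R C (regular_module R) x \<one>\<^bsub>R\<^esub>"
    and counit_left: "x \<in> carrier C \<Longrightarrow>
      tensor_map R (regular_module R) C (counit C) (\<lambda>y. y) (comul C x) =
      tens R (regular_module R) C \<one>\<^bsub>R\<^esub> x"

definition coalg_hom ::
  "('r, 'x) ring_scheme \<Rightarrow> ('r, 'c, 'y) coalg_scheme \<Rightarrow> ('r, 'd, 'z) coalg_scheme \<Rightarrow> ('c \<Rightarrow> 'd) set"
  where "coalg_hom R C D = {f \<in> mod_hom R C D.
    (\<forall>x\<in>carrier C. comul D (f x) = tensor_map R D D f f (comul C x)) \<and>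
    (\<forall>x\<in>carrier C. counit D (f x) = counit C x)}"

record ('r, 'm, 'c) comod = "('r, 'm) module" +
  coact :: "'m \<Rightarrow> ('m \<times> 'c \<Rightarrow> 'r) set"

locale comodule = coalgebra R C + M: module R M
  for R :: "('r, 'x) ring_scheme" and C :: "('r, 'c, 'y) coalg_scheme"
    and M :: "('r, 'm, 'c) comod" +
  assumes coact_hom: "coact M \<in> mod_hom R M (tensor R M C)"
    and coact_coassoc: "x \<in> carrier M \<Longrightarrow>
      tensor_assoc R M C C (tensor_map R (tensor R M C) C (coact M) (\<lambda>y. y) (coact M x)) =
      tensor_map R M (tensor R C C) (\<lambda>y. y) (comul C) (coact M x)"
    and coact_counit: "x \<in> carrier M \<Longrightarrow>
      tensor_map R M (regular_module R) (\<lambda>y. y) (counit C) (coact M x) =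
      tens R M (regular_module R) x \<one>\<^bsub>R\<^esub>"

definition comod_hom ::
  "('r, 'x) ring_scheme \<Rightarrow> ('r, 'c, 'y) coalg_scheme \<Rightarrow> ('r, 'm, 'c) comod \<Rightarrow> ('r, 'n, 'c) comod
    \<Rightarrow> ('m \<Rightarrow> 'n) set"
  where "comod_hom R C M N = {g \<in> mod_hom R M N.
    \<forall>x\<in>carrier M. coact N (g x) = tensor_map R N C g (\<lambda>y. y) (coact M x)}"

text \<open>For a submodule \<open>N\<close> of \<open>M\<close>, the record \<open>M\<lparr>carrier := N\<rparr>\<close> is \<open>N\<close> as a
  module; \<open>N \<otimes> C\<close> is regarded inside \<open>M \<otimes> C\<close> via the map induced by the inclusion.\<close>

definition subcomodule ::
  "('r, 'x) ring_scheme \<Rightarrow> ('r, 'c, 'y) coalg_scheme \<Rightarrow> ('r, 'm, 'c) comod \<Rightarrow> 'm set \<Rightarrow> bool"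
  where "subcomodule R C M N \<longleftrightarrow> submodule N R M \<and>
    coact M ` N \<subseteq> tensor_map R M C (\<lambda>x. x) (\<lambda>y. y) ` carrier (tensor R (M\<lparr>carrier := N\<rparr>) C)"

definition saturated_subcomodule ::
  "('r, 'x) ring_scheme \<Rightarrow> ('r, 'c, 'y) coalg_scheme \<Rightarrow> ('r, 'm, 'c) comod \<Rightarrow> 'm set \<Rightarrow> bool"
  where "saturated_subcomodule R C M N \<longleftrightarrow>
    subcomodule R C M N \<and> torsion_free R (quotient_module R M N)"

text \<open>A subcomodule as a comodule in its own right. For flat \<open>C\<close> the map \<open>N \<otimes> C \<rightarrow> M \<otimes> C\<close>
  is injective, so the element described here is unique.\<close>

definition induced_comod ::
  "('r, 'x) ring_scheme \<Rightarrow> ('r, 'c, 'y) coalg_scheme \<Rightarrow> ('r, 'm, 'c) comod \<Rightarrow> 'm set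
    \<Rightarrow> ('r, 'm, 'c) comod"
  where "induced_comod R C M N = M\<lparr>carrier := N, coact := (\<lambda>x\<in>N.
    THE t. t \<in> carrier (tensor R (M\<lparr>carrier := N\<rparr>) C) \<and>
      tensor_map R M C (\<lambda>x. x) (\<lambda>y. y) t = coact M x)\<rparr>"

section \<open>The functor induced by a coalgebra homomorphism\<close>

definition omega ::
  "('r, 'x) ring_scheme \<Rightarrow> ('r, 'd, 'y) coalg_scheme \<Rightarrow> ('c \<Rightarrow> 'd) \<Rightarrow> ('r, 'm, 'c) comod
    \<Rightarrow> ('r, 'm, 'd) comod"
  where "omega R D f M = \<lparr>carrier = carrier M, monoid.mult = monoid.mult M, one = one M,
    ring.zero = ring.zero M, ring.add = ring.add M, module.smult = module.smult M,
    coact = (\<lambda>x\<in>carrier M. tensor_map R M D (\<lambda>y. y) f (coact M x))\<rparr>"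

text \<open>The image of \<open>omega\<close> is closed under passing to the subobjects singled out by \<open>sub\<close> of
  comodules that belong to the class \<open>cls\<close>.\<close>

definition image_closed ::
  "('r, 'x) ring_scheme \<Rightarrow> ('r, 'c, 'y) coalg_scheme \<Rightarrow> ('r, 'd, 'z) coalg_scheme \<Rightarrow> ('c \<Rightarrow> 'd)
    \<Rightarrow> (('r, 'm, 'c) comod \<Rightarrow> bool) \<Rightarrow> (('r, 'm, 'd) comod \<Rightarrow> 'm set \<Rightarrow> bool) \<Rightarrow> bool"
  where "image_closed R C D f cls sub \<longleftrightarrow>
    (\<forall>M. comodule R C M \<and> cls M \<longrightarrow> (\<forall>N. sub (omega R D f M) N \<longrightarrow>
      (\<exists>M'. subcomodule R C M M' \<and>
        omega R D f (induced_comod R C M M') = induced_comod R D (omega R D f M) N)))"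

text \<open>Fullness on the class \<open>cls\<close>. On morphisms \<open>omega\<close> is the identity on underlying maps, so
  surjectivity on Hom-sets is an inclusion.\<close>

definition omega_full ::
  "('r, 'x) ring_scheme \<Rightarrow> ('r, 'c, 'y) coalg_scheme \<Rightarrow> ('r, 'd, 'z) coalg_scheme \<Rightarrow> ('c \<Rightarrow> 'd)
    \<Rightarrow> (('r, 'm, 'c) comod \<Rightarrow> bool) \<Rightarrow> bool"
  where "omega_full R C D f cls \<longleftrightarrow>
    (\<forall>M N. comodule R C M \<and> cls M \<and> comodule R C N \<and> cls N \<longrightarrow>
      comod_hom R D (omega R D f M) (omega R D f N) \<subseteq> comod_hom R C M N)"

end

(*
  Let N be a D-subcomodule of omega(M) and Q = M/N. Composed with the map from Q (x) C to Q (x) D,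
  the image in Q (x) C of the coaction of an element of N vanishes. So if that map is injective,
  right exactness of the tensor product shows that N is a C-subcomodule; injectivity on N' (x) C gives in
  the same way that D-linear maps into N' are C-linear. For pure f injectivity always holds. For
  injective f and torsion-free Q it is enough to treat a submodule generated by finitely many elements,
  where one adds one generator q at a time to a submodule H: either H + Rq is a direct sum with Rq free,
  or a nonzero r maps H + Rq injectively into H and flatness of C applies.

  Conversely, for a module N let K be the kernel of id (x) f from the cofree comodule N (x) C to N (x) D.
  By flatness of D it is a D-subcomodule, saturated if N is torsion-free. If it is a C-subcomodule,
  then the counit, which factors through D and hence kills K, shows K = 0. For N = R this
  says that f is injective, and for all N that f is pure.
*)
theory Submission
  imports Defs
begin

section \<open>Module homomorphisms and tensor products\<close>

text \<open>The obstacle is the universe. \<open>flat\<close> and \<open>pure_hom\<close> test only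
  modules whose elements have type \<open>'u\<close>, whereas quotients and tensor products live on
  other types. Injectivity is therefore moved along isomorphic copies, which exist as soon as a
  carrier injects into \<open>'u\<close>; that \<open>N \<otimes> C\<close> still fits is where the
  infinity of \<open>'u\<close> enters. For the same reason the cofree comodule is a copy of
  \<open>N \<otimes> C\<close> rather than the tensor product itself. Both directions meet in a
  single condition, injectivity of \<open>id \<otimes> f\<close> on \<open>N \<otimes> C\<close>:
  for all torsion-free \<open>N\<close> it amounts to injectivity of \<open>f\<close>, for all
  \<open>N\<close> over \<open>'u\<close> it is purity. The torsion-free case does not pass to the
  fraction field; the dichotomy for an adjoined generator takes its place.\<close>

lemma mod_hom_closed: "h \<in> mod_hom R M N \<Longrightarrow> x \<in> carrier M \<Longrightarrow> h x \<in> carrier N"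
  by (auto simp: mod_hom_def)

lemma mod_hom_add:
  "h \<in> mod_hom R M N \<Longrightarrow> x \<in> carrier M \<Longrightarrow> y \<in> carrier M \<Longrightarrow> h (x \<oplus>\<^bsub>M\<^esub> y) = h x \<oplus>\<^bsub>N\<^esub> h y"
  by (auto simp: mod_hom_def)

lemma mod_hom_smult:
  "h \<in> mod_hom R M N \<Longrightarrow> r \<in> carrier R \<Longrightarrow> x \<in> carrier M \<Longrightarrow> h (r \<odot>\<^bsub>M\<^esub> x) = r \<odot>\<^bsub>N\<^esub> h x"
  by (auto simp: mod_hom_def)

lemma mod_hom_zero: "module R M \<Longrightarrow> module R N \<Longrightarrow> h \<in> mod_hom R M N \<Longrightarrow> h \<zero>\<^bsub>M\<^esub> = \<zero>\<^bsub>N\<^esub>"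
  using module.hom_zero .

lemma mod_hom_minus:
  assumes "module R M" "module R N" "h \<in> mod_hom R M N" "x \<in> carrier M" "y \<in> carrier M"
  shows "h (x \<ominus>\<^bsub>M\<^esub> y) = h x \<ominus>\<^bsub>N\<^esub> h y"
proof -
  interpret M: module R M by fact
  show ?thesis
    using assms M.hom_neg[OF assms(2,3,5)] by (simp add: a_minus_def mod_hom_add)
qed

lemma mod_hom_id: "(\<lambda>x. x) \<in> mod_hom R M M"
  by (auto simp: mod_hom_def)

lemma mod_hom_comp:
  "g \<in> mod_hom R M N \<Longrightarrow> h \<in> mod_hom R N P \<Longrightarrow> (\<lambda>x. h (g x)) \<in> mod_hom R M P"
  by (auto simp: mod_hom_def Pi_iff)

lemma mod_hom_incl: "submodule H R M \<Longrightarrow> module R M \<Longrightarrow> (\<lambda>x. x) \<in> mod_hom R (M\<lparr>carrier := H\<rparr>) M"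
  using module.submoduleE(1) by (fastforce simp: mod_hom_def)

lemma mod_hom_inj_iff:
  assumes "module R M" "module R N" "h \<in> mod_hom R M N"
  shows "inj_on h (carrier M) \<longleftrightarrow> (\<forall>x\<in>carrier M. h x = \<zero>\<^bsub>N\<^esub> \<longrightarrow> x = \<zero>\<^bsub>M\<^esub>)"
proof -
  interpret M: module R M by fact
  interpret N: module R N by fact
  show ?thesis
  proof
    show "\<forall>x\<in>carrier M. h x = \<zero>\<^bsub>N\<^esub> \<longrightarrow> x = \<zero>\<^bsub>M\<^esub>" if "inj_on h (carrier M)"
      using that mod_hom_zero[OF assms] by (metis M.M.zero_closed inj_onD)
    show "inj_on h (carrier M)" if ker: "\<forall>x\<in>carrier M. h x = \<zero>\<^bsub>N\<^esub> \<longrightarrow> x = \<zero>\<^bsub>M\<^esub>"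
    proof (rule inj_onI)
      fix x y assume xy: "x \<in> carrier M" "y \<in> carrier M" "h x = h y"
      then have "h (x \<ominus>\<^bsub>M\<^esub> y) = \<zero>\<^bsub>N\<^esub>"
        using mod_hom_closed[OF assms(3)] by (simp add: mod_hom_minus[OF assms] N.M.r_neg a_minus_def[of N])
      then have "x \<ominus>\<^bsub>M\<^esub> y = \<zero>\<^bsub>M\<^esub>" using ker xy by simp
      then have "\<ominus>\<^bsub>M\<^esub> (\<ominus>\<^bsub>M\<^esub> y) = x"
        using xy by (intro M.M.minus_equality) (auto simp: a_minus_def)
      then show "x = y" using xy by simp
    qed
  qed
qed

lemma mod_hom_image_submodule:
  assumes "module R M" "module R N" "h \<in> mod_hom R M N"
  shows "submodule (h ` carrier M) R N"
proof -
  interpret M: module R M by fact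
  interpret N: module R N by fact
  show ?thesis
  proof (rule N.submoduleI)
    show "\<zero>\<^bsub>N\<^esub> \<in> h ` carrier M" using mod_hom_zero[OF assms, symmetric] by simp
    show "\<ominus>\<^bsub>N\<^esub> a \<in> h ` carrier M" if "a \<in> h ` carrier M" for a
      using that M.hom_neg[OF assms(2,3), symmetric] by auto
    show "a \<oplus>\<^bsub>N\<^esub> b \<in> h ` carrier M" if "a \<in> h ` carrier M" "b \<in> h ` carrier M" for a b
      using that mod_hom_add[OF assms(3), symmetric] by auto
    show "a \<odot>\<^bsub>N\<^esub> x \<in> h ` carrier M" if "a \<in> carrier R" "x \<in> h ` carrier M" for a x
      using that mod_hom_smult[OF assms(3), symmetric] by auto
  qed (use mod_hom_closed[OF assms(3)] in auto)
qed

lemma submodule_module: "submodule H R M \<Longrightarrow> module R M \<Longrightarrow> module R (M\<lparr>carrier := H\<rparr>)"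
  using submodule.submodule_is_module .

lemma mod_hom_quotient:
  assumes "module R M" "submodule H R M"
  shows "(\<lambda>x. H +>\<^bsub>M\<^esub> x) \<in> mod_hom R M (quotient_module R M H)"
proof -
  interpret M: module R M by fact
  show ?thesis unfolding mod_hom_def
    by (auto simp: M.quotient_basic(2,3)[OF assms(2)] M.quotient_basic(1)[OF assms(2)])
qed

text \<open>The zero of the quotient record is \<open>H\<close> itself; once it is recognised as the
  coset of zero, the criterion for equality of cosets decides.\<close>

lemma quotient_eq_zero_iff:
  assumes "module R M" "submodule H R M" "x \<in> carrier M"
  shows "H +>\<^bsub>M\<^esub> x = \<zero>\<^bsub>quotient_module R M H\<^esub> \<longleftrightarrow> x \<in> H"
proof -
  interpret M: module R M by fact
  have "H +>\<^bsub>M\<^esub> \<zero>\<^bsub>M\<^esub> = \<zero>\<^bsub>quotient_module R M H\<^esub>"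
    by (rule mod_hom_zero[OF assms(1) M.quotient_module_module mod_hom_quotient]) fact+
  then show ?thesis
    using M.quotient_basic(4)[OF assms(2,3) M.M.zero_closed] assms(3)
    by (simp add: a_minus_def M.M.add.inv_one[folded a_inv_def])
qed

section \<open>Tensors and the linear maps determined by them\<close>

lemma tens_add_left:
  "\<lbrakk>module R M; module R N; x \<in> carrier M; x' \<in> carrier M; y \<in> carrier N\<rbrakk> \<Longrightarrow>
    tens R M N (x \<oplus>\<^bsub>M\<^esub> x') y = tens R M N x y \<oplus>\<^bsub>tensor R M N\<^esub> tens R M N x' y"
  using tens_bilinear[of R M N] by (auto simp: bilinear_map_def mod_hom_def)

lemma tens_smult_left:
  "\<lbrakk>module R M; module R N; r \<in> carrier R; x \<in> carrier M; y \<in> carrier N\<rbrakk> \<Longrightarrow>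
    tens R M N (r \<odot>\<^bsub>M\<^esub> x) y = r \<odot>\<^bsub>tensor R M N\<^esub> tens R M N x y"
  using tens_bilinear[of R M N] by (auto simp: bilinear_map_def mod_hom_def)

lemma tens_hom_left:
  "module R M \<Longrightarrow> module R N \<Longrightarrow> y \<in> carrier N \<Longrightarrow> (\<lambda>x. tens R M N x y) \<in> mod_hom R M (tensor R M N)"
  using tens_bilinear[of R M N] by (auto simp: bilinear_map_def)

lemma tens_hom_right:
  "module R M \<Longrightarrow> module R N \<Longrightarrow> x \<in> carrier M \<Longrightarrow> (\<lambda>y. tens R M N x y) \<in> mod_hom R N (tensor R M N)"
  using tens_bilinear[of R M N] by (auto simp: bilinear_map_def)

text \<open>A class has a finitely supported representative, and the induction runs over that
  support. A coefficient \<open>r\<close> is absorbed as \<open>(r x) \<otimes> y\<close>, so no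
  separate case for scalars arises.\<close>

lemma tensor_induct [consumes 3, case_names zero add]:
  assumes M: "module R M" and N: "module R N" and t: "t \<in> carrier (tensor R M N)"
    and zero: "P \<zero>\<^bsub>tensor R M N\<^esub>"
    and add: "\<And>t x y. \<lbrakk>t \<in> carrier (tensor R M N); P t; x \<in> carrier M; y \<in> carrier N\<rbrakk> \<Longrightarrow>
      P (t \<oplus>\<^bsub>tensor R M N\<^esub> tens R M N x y)"
  shows "P t"
proof -
  interpret M: module R M by fact
  let ?T = "tensor R M N"
  let ?F = "free_module R (carrier M \<times> carrier N)"
  interpret F: module R ?F by (rule M.R.free_module_module)
  interpret T: module R ?T by (rule tensor_module[OF M N])
  let ?c = "\<lambda>\<phi>. tensor_rel R M N +>\<^bsub>?F\<^esub> \<phi>"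
  have c: "?c \<in> mod_hom R ?F ?T"
    unfolding tensor_def by (rule mod_hom_quotient[OF F.module_axioms tensor_rel_submodule[OF M N]])
  have main: "\<phi> \<in> carrier ?F \<Longrightarrow> {p. \<phi> p \<noteq> \<zero>\<^bsub>R\<^esub>} = A \<Longrightarrow> P (?c \<phi>)" if "finite A" for A \<phi>
    using that
  proof (induction A arbitrary: \<phi> rule: finite_induct)
    case empty
    then have "\<phi> = \<zero>\<^bsub>?F\<^esub>" by (auto simp: free_module_def fun_eq_iff)
    then show ?case using zero F.hom_zero[OF T.module_axioms c] by simp
  next
    case (insert a A)
    obtain x y where a: "a = (x, y)" "x \<in> carrier M" "y \<in> carrier N"
      using insert.prems by (auto simp: free_module_def)
    define \<psi> where "\<psi> = \<phi>(a := \<zero>\<^bsub>R\<^esub>)"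
    have r: "\<phi> a \<in> carrier R" using insert.prems by (auto simp: free_module_def)
    have supp: "{p. \<psi> p \<noteq> \<zero>\<^bsub>R\<^esub>} = A" using insert.prems insert.hyps by (auto simp: \<psi>_def)
    have psi: "\<psi> \<in> carrier ?F"
      using insert.prems supp insert.hyps(1) by (auto simp: free_module_def) (auto simp: \<psi>_def)
    have gen: "free_gen R a \<in> carrier ?F" using a by (intro M.R.free_gen_closed) auto
    have "\<phi> = \<psi> \<oplus>\<^bsub>?F\<^esub> \<phi> a \<odot>\<^bsub>?F\<^esub> free_gen R a"
      using insert.prems(1) r by (auto simp: free_module_def free_gen_def \<psi>_def fun_eq_iff)
    then have "?c \<phi> = ?c \<psi> \<oplus>\<^bsub>?T\<^esub> \<phi> a \<odot>\<^bsub>?T\<^esub> ?c (free_gen R a)"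
      using mod_hom_add[OF c psi F.smult_closed[OF r gen]] mod_hom_smult[OF c r gen] by simp
    also have "\<phi> a \<odot>\<^bsub>?T\<^esub> ?c (free_gen R a) = tens R M N (\<phi> a \<odot>\<^bsub>M\<^esub> x) y"
      using a r by (simp add: tens_smult_left[OF M N], simp add: tens_def)
    finally show ?case
      using add[OF mod_hom_closed[OF c psi] insert.IH[OF psi supp] M.smult_closed[OF r a(2)] a(3)] by simp
  qed
  obtain \<phi> where "\<phi> \<in> carrier ?F" "t = ?c \<phi>" using t tensor_carrier[OF M N] by blast
  moreover then have "finite {p. \<phi> p \<noteq> \<zero>\<^bsub>R\<^esub>}" by (auto simp: free_module_def)
  ultimately show ?thesis using main by blast
qed

lemma tensor_map_comp:
  assumes "module R M" "module R N" "module R M'" "module R N'" "module R M''" "module R N''"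
    and "g \<in> mod_hom R M M'" "h \<in> mod_hom R N N'" "g' \<in> mod_hom R M' M''" "h' \<in> mod_hom R N' N''"
    and "t \<in> carrier (tensor R M N)"
  shows "tensor_map R M'' N'' g' h' (tensor_map R M' N' g h t) =
    tensor_map R M'' N'' (\<lambda>x. g' (g x)) (\<lambda>y. h' (h y)) t"
  by (rule tensor_hom_eq[where g = "\<lambda>t. tensor_map R M'' N'' g' h' (tensor_map R M' N' g h t)",
        OF assms(1,2) tensor_module[OF assms(5,6)]
        mod_hom_comp[OF tensor_map_hom tensor_map_hom] tensor_map_hom _ assms(11)])
    (use assms in \<open>simp_all add: tensor_map_tens mod_hom_comp mod_hom_closed
      tensor_map_tens[where g = "\<lambda>x. g' (g x)"]\<close>)

text \<open>Functions in HOL are total, so homomorphisms that agree on the carriers may still be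
  different terms; this allows rewriting inside a \<open>tensor_map\<close>.\<close>

lemma tensor_map_cong:
  assumes "module R M" "module R N" "module R M'" "module R N'"
    and "g \<in> mod_hom R M M'" "h \<in> mod_hom R N N'"
    and "\<And>x. x \<in> carrier M \<Longrightarrow> g' x = g x" "\<And>y. y \<in> carrier N \<Longrightarrow> h' y = h y"
    and t: "t \<in> carrier (tensor R M N)"
  shows "tensor_map R M' N' g' h' t = tensor_map R M' N' g h t"
proof -
  interpret M: module R M by fact
  interpret N: module R N by fact
  have "g' \<in> mod_hom R M M'" "h' \<in> mod_hom R N N'"
    using assms(5-8) by (auto simp: mod_hom_def Pi_iff)
  then show ?thesis
    by (intro tensor_hom_eq[OF assms(1,2) tensor_module[OF assms(3,4)] tensor_map_hom tensor_map_hom _ t])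
      (use assms in \<open>simp_all add: tensor_map_tens\<close>)
qed

lemma tensor_map_id:
  assumes "module R M" "module R N" "t \<in> carrier (tensor R M N)"
  shows "tensor_map R M N (\<lambda>x. x) (\<lambda>y. y) t = t"
  by (rule tensor_hom_eq[OF assms(1,2) tensor_module[OF assms(1,2)] tensor_map_hom mod_hom_id _ assms(3)])
    (use assms in \<open>simp_all add: tensor_map_tens mod_hom_id\<close>)

lemma tensor_map_ident:
  assumes "module R M" "module R N" "t \<in> carrier (tensor R M N)"
    and "\<And>x. x \<in> carrier M \<Longrightarrow> g x = x" "\<And>y. y \<in> carrier N \<Longrightarrow> h y = y"
  shows "tensor_map R M N g h t = t"
  using tensor_map_cong[OF assms(1,2,1,2) mod_hom_id mod_hom_id assms(4,5,3)] tensor_map_id[OF assms(1-3)]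
  by simp

text \<open>Retractions of both factors tensor to a retraction, whence injectivity without flatness.
  This serves the passage to isomorphic copies.\<close>

lemma tensor_map_inj_left:
  assumes "module R M" "module R N" "module R M'" "module R N'"
    and "g \<in> mod_hom R M M'" "h \<in> mod_hom R N N'" "g' \<in> mod_hom R M' M" "h' \<in> mod_hom R N' N"
    and "\<And>x. x \<in> carrier M \<Longrightarrow> g' (g x) = x" "\<And>y. y \<in> carrier N \<Longrightarrow> h' (h y) = y"
  shows "inj_on (tensor_map R M' N' g h) (carrier (tensor R M N))"
  by (rule inj_on_inverseI[where g = "tensor_map R M N g' h'"])
    (use assms in \<open>simp add: tensor_map_comp[where M' = M' and N' = N'] tensor_map_ident\<close>)

text \<open>A tensor product only sees the carrier, the addition and the scalar multiplication of its
  factors. This identifies tensor products whose factors are records of different types.\<close>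

lemma tensor_rel_cong:
  assumes "carrier M = carrier M'" "ring.add M = ring.add M'" "module.smult M = module.smult M'"
  shows "tensor_rel R M N = tensor_rel R M' N"
  unfolding tensor_rel_def tensor_gens_def assms ..

lemma tensor_cong:
  assumes "carrier M = carrier M'" "ring.add M = ring.add M'" "module.smult M = module.smult M'"
  shows "tensor R M N = tensor R M' N"
  unfolding tensor_def tensor_rel_cong[OF assms] assms(1) ..

lemma tens_cong:
  assumes "carrier M = carrier M'" "ring.add M = ring.add M'" "module.smult M = module.smult M'"
  shows "tens R M N = tens R M' N"
  unfolding tens_def tensor_rel_cong[OF assms] assms(1) ..

lemma tensor_map_codomain_cong:
  assumes "carrier M = carrier M'" "ring.add M = ring.add M'" "module.smult M = module.smult M'"
  shows "tensor_map R M N = tensor_map R M' N"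
  unfolding tensor_map_def tensor_cong[OF assms] tens_cong[OF assms] ..

text \<open>The commutativity isomorphism. Coactions and \<open>flat\<close> have the module on the
  left of the coalgebra, \<open>pure_hom\<close> has the test module on the right.\<close>

definition tensor_swap where
  "tensor_swap R M N = tensor_lift R (tensor R N M) (\<lambda>x y. tens R N M y x)"

lemma tensor_swap_bilinear:
  "module R M \<Longrightarrow> module R N \<Longrightarrow> bilinear_map R M N (tensor R N M) (\<lambda>x y. tens R N M y x)"
  by (simp add: bilinear_map_def tens_hom_left tens_hom_right)

lemma tensor_swap_hom:
  "module R M \<Longrightarrow> module R N \<Longrightarrow> tensor_swap R M N \<in> mod_hom R (tensor R M N) (tensor R N M)"
  unfolding tensor_swap_def by (intro tensor_lift_hom tensor_module tensor_swap_bilinear)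

lemma tensor_swap_tens:
  "\<lbrakk>module R M; module R N; x \<in> carrier M; y \<in> carrier N\<rbrakk> \<Longrightarrow>
    tensor_swap R M N (tens R M N x y) = tens R N M y x"
  unfolding tensor_swap_def by (intro tensor_lift_tens tensor_module tensor_swap_bilinear)

lemma tensor_swap_swap:
  assumes "module R M" "module R N" "t \<in> carrier (tensor R M N)"
  shows "tensor_swap R N M (tensor_swap R M N t) = t"
  by (rule tensor_hom_eq[where h = "\<lambda>t. t", OF assms(1,2) tensor_module[OF assms(1,2)]
        mod_hom_comp[OF tensor_swap_hom tensor_swap_hom] mod_hom_id _ assms(3)])
    (use assms in \<open>simp_all add: tensor_swap_tens\<close>)

lemma tensor_swap_map:
  assumes "module R M" "module R N" "module R M'" "module R N'"
    and "g \<in> mod_hom R M M'" "h \<in> mod_hom R N N'" "t \<in> carrier (tensor R M N)"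
  shows "tensor_swap R M' N' (tensor_map R M' N' g h t) = tensor_map R N' M' h g (tensor_swap R M N t)"
  by (rule tensor_hom_eq[where g = "\<lambda>t. tensor_swap R M' N' (tensor_map R M' N' g h t)"
        and h = "\<lambda>t. tensor_map R N' M' h g (tensor_swap R M N t)",
        OF assms(1,2) tensor_module[OF assms(4,3)]
        mod_hom_comp[OF tensor_map_hom tensor_swap_hom] mod_hom_comp[OF tensor_swap_hom tensor_map_hom]
        _ assms(7)])
    (use assms in \<open>simp_all add: tensor_map_tens tensor_swap_tens mod_hom_closed\<close>)

text \<open>Conjugation by the swap, which is its own inverse up to exchanging the factors, turns
  one map into the other.\<close>

lemma tensor_map_inj_swap:
  assumes "module R M" "module R N" "module R M'" "module R N'"
    and "g \<in> mod_hom R M M'" "h \<in> mod_hom R N N'"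
    and inj: "inj_on (tensor_map R M' N' g h) (carrier (tensor R M N))"
  shows "inj_on (tensor_map R N' M' h g) (carrier (tensor R N M))"
proof (rule inj_onI)
  fix s t
  assume st: "s \<in> carrier (tensor R N M)" "t \<in> carrier (tensor R N M)"
    and "tensor_map R N' M' h g s = tensor_map R N' M' h g t"
  then have "tensor_map R M' N' g h (tensor_swap R N M s) = tensor_map R M' N' g h (tensor_swap R N M t)"
    using assms by (metis tensor_swap_map)
  then have "tensor_swap R N M s = tensor_swap R N M t"
    using inj st mod_hom_closed[OF tensor_swap_hom[OF assms(2,1)]] by (simp add: inj_on_eq_iff)
  then show "s = t" using tensor_swap_swap[OF assms(2,1)] st by metis
qed

section \<open>Exactness and change of universe\<close>

text \<open>Let \<open>I\<close> be the image of \<open>K \<otimes> C\<close> in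
  \<open>A \<otimes> C\<close>, where \<open>K\<close> is the kernel of \<open>h\<close>. Lifting
  elements of \<open>B\<close> to \<open>A\<close> gives a well-defined map from
  \<open>B \<otimes> C\<close> to the quotient by \<open>I\<close>. Composed with
  \<open>h \<otimes> id\<close> it is the projection, so whatever \<open>h \<otimes> id\<close>
  kills lies in \<open>I\<close>.\<close>

lemma tensor_right_exact:
  assumes A: "module R A" and B: "module R B" and C: "module R C"
    and h: "h \<in> mod_hom R A B" and surj: "carrier B \<subseteq> h ` carrier A"
    and t: "t \<in> carrier (tensor R A C)"
    and t0: "tensor_map R B C h (\<lambda>y. y) t = \<zero>\<^bsub>tensor R B C\<^esub>"
  shows "t \<in> tensor_map R A C (\<lambda>x. x) (\<lambda>y. y) `
    carrier (tensor R (A\<lparr>carrier := {x \<in> carrier A. h x = \<zero>\<^bsub>B\<^esub>}\<rparr>) C)"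
proof -
  interpret A: module R A by fact
  interpret B: module R B by fact
  interpret C: module R C by fact
  let ?T = "tensor R A C"
  interpret T: module R ?T by (rule tensor_module[OF A C])
  define K where "K = {x \<in> carrier A. h x = \<zero>\<^bsub>B\<^esub>}"
  let ?K = "A\<lparr>carrier := K\<rparr>"
  have subK: "submodule K R A" unfolding K_def by (rule A.kernel_submodule[OF B h])
  have K: "module R ?K" by (rule submodule_module[OF subK A])
  let ?i = "tensor_map R A C (\<lambda>x. x) (\<lambda>y. y)"
  have i: "?i \<in> mod_hom R (tensor R ?K C) ?T"
    by (rule tensor_map_hom[OF K C A C mod_hom_incl[OF subK A] mod_hom_id])
  define I where "I = ?i ` carrier (tensor R ?K C)"
  have subI: "submodule I R ?T"
    unfolding I_def by (rule mod_hom_image_submodule[OF tensor_module[OF K C] tensor_module[OF A C] i])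
  let ?Q = "quotient_module R ?T I"
  interpret Q: module R ?Q by (rule T.quotient_module_module[OF subI])
  note qb = T.quotient_basic[OF subI]
  have q: "(\<lambda>t. I +>\<^bsub>?T\<^esub> t) \<in> mod_hom R ?T ?Q" by (rule mod_hom_quotient[OF T.module_axioms subI])
  define b where "b = (\<lambda>x c. I +>\<^bsub>?T\<^esub> tens R A C x c)"
  have bil: "bilinear_map R A C ?Q b"
    unfolding bilinear_map_def b_def
    using mod_hom_comp[OF tens_hom_left[OF A C] q] mod_hom_comp[OF tens_hom_right[OF A C] q] by simp
  \<comment> \<open>Two lifts of one element of \<open>B\<close> differ by an element of
    \<open>K\<close>, whose tensors with \<open>c\<close> lie in \<open>I\<close>.\<close>
  have b_eq: "b x c = b x' c" if "x \<in> carrier A" "x' \<in> carrier A" "c \<in> carrier C" "h x = h x'" for x x' c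
  proof -
    have "x \<ominus>\<^bsub>A\<^esub> x' \<in> K"
      using that mod_hom_closed[OF h]
      by (simp add: K_def mod_hom_minus[OF A B h] B.M.r_neg a_minus_def[of B])
    then have "tens R A C (x \<ominus>\<^bsub>A\<^esub> x') c \<in> I"
      unfolding I_def using tens_closed[OF K C, of "x \<ominus>\<^bsub>A\<^esub> x'" c] that(3)
      by (auto intro!: image_eqI simp: tensor_map_tens[OF K C A C mod_hom_incl[OF subK A] mod_hom_id])
    then show ?thesis
      unfolding b_def using that
      by (simp add: qb(4) tens_closed[OF A C] mod_hom_minus[OF A T.module_axioms tens_hom_left[OF A C]])
  qed
  \<comment> \<open>An arbitrary section of \<open>h\<close>, not assumed linear; as
    \<open>b\<close> cannot tell two lifts apart, \<open>b (s x) c\<close> is linear in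
    \<open>x\<close> nevertheless.\<close>
  define s where "s = (\<lambda>y. SOME x. x \<in> carrier A \<and> h x = y)"
  have s: "s y \<in> carrier A \<and> h (s y) = y" if "y \<in> carrier B" for y
    unfolding s_def by (rule someI_ex) (use surj that in blast)
  have bs: "b (s (h x)) c = b x c" if "x \<in> carrier A" "c \<in> carrier C" for x c
    using that s mod_hom_closed[OF h] by (intro b_eq) auto
  have bs': "(\<lambda>x. b (s x) c) \<in> mod_hom R B ?Q" if c: "c \<in> carrier C" for c
    unfolding mod_hom_def
  proof (intro CollectI conjI ballI funcsetI)
    have bc: "(\<lambda>x. b x c) \<in> mod_hom R A ?Q" using bil c by (auto simp: bilinear_map_def)
    show "b (s x) c \<in> carrier ?Q" if "x \<in> carrier B" for x
      using mod_hom_closed[OF bc] s that by blast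
    show "b (s (x \<oplus>\<^bsub>B\<^esub> y)) c = b (s x) c \<oplus>\<^bsub>?Q\<^esub> b (s y) c" if "x \<in> carrier B" "y \<in> carrier B" for x y
    proof -
      have "b (s (x \<oplus>\<^bsub>B\<^esub> y)) c = b (s x \<oplus>\<^bsub>A\<^esub> s y) c"
        using that s c by (intro b_eq) (auto simp: mod_hom_add[OF h])
      then show ?thesis using mod_hom_add[OF bc] s that by simp
    qed
    show "b (s (r \<odot>\<^bsub>B\<^esub> x)) c = r \<odot>\<^bsub>?Q\<^esub> b (s x) c" if "r \<in> carrier R" "x \<in> carrier B" for r x
    proof -
      have "b (s (r \<odot>\<^bsub>B\<^esub> x)) c = b (r \<odot>\<^bsub>A\<^esub> s x) c"
        using that s c by (intro b_eq) (auto simp: mod_hom_smult[OF h])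
      then show ?thesis using mod_hom_smult[OF bc] s that by simp
    qed
  qed
  have bil': "bilinear_map R B C ?Q (\<lambda>x c. b (s x) c)"
    using bil bs' s by (simp add: bilinear_map_def)
  let ?l = "tensor_lift R ?Q (\<lambda>x c. b (s x) c)"
  have l: "?l \<in> mod_hom R (tensor R B C) ?Q" by (rule tensor_lift_hom[OF B C Q.module_axioms bil'])
  have hC: "tensor_map R B C h (\<lambda>y. y) \<in> mod_hom R ?T (tensor R B C)"
    by (rule tensor_map_hom[OF A C B C h mod_hom_id])
  have "?l (tensor_map R B C h (\<lambda>y. y) t) = I +>\<^bsub>?T\<^esub> t"
    by (rule tensor_hom_eq[where g = "\<lambda>t. ?l (tensor_map R B C h (\<lambda>y. y) t)",
          OF A C Q.module_axioms mod_hom_comp[OF hC l] q _ t])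
      (use bs in \<open>simp add: tensor_map_tens[OF A C B C h mod_hom_id]
        tensor_lift_tens[OF B C Q.module_axioms bil'] mod_hom_closed[OF h]\<close>, simp add: b_def)
  then have "I +>\<^bsub>?T\<^esub> t = \<zero>\<^bsub>?Q\<^esub>"
    using t0 mod_hom_zero[OF tensor_module[OF B C] Q.module_axioms l] by simp
  then have "t \<in> I" using quotient_eq_zero_iff[OF T.module_axioms subI t] by simp
  then show ?thesis by (simp add: I_def K_def)
qed

section \<open>Copies of modules over \<open>'u\<close>; flatness and purity for all modules that
  fit\<close>

text \<open>Transport of structure along an injection into \<open>'u\<close>: the copy is its image,
  with \<open>i\<close> and \<open>j\<close> mutually inverse isomorphisms.\<close>

lemma module_copy:
  assumes M: "module R M" and U: "carrier M \<lesssim> (UNIV :: 'u set)"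
  obtains N :: "('r, 'u) module" and i j where "module R N"
    "i \<in> mod_hom R M N" "j \<in> mod_hom R N M"
    "\<forall>x\<in>carrier M. j (i x) = x" "\<forall>y\<in>carrier N. i (j y) = y"
proof -
  interpret M: module R M by fact
  obtain i :: "'b \<Rightarrow> 'u" where inj: "inj_on i (carrier M)" using U by (auto simp: lepoll_def)
  define j where "j = inv_into (carrier M) i"
  have ji: "j (i x) = x" if "x \<in> carrier M" for x using inj that by (simp add: j_def)
  define N :: "('r, 'u) module" where "N = \<lparr>carrier = i ` carrier M, monoid.mult = undefined,
    one = undefined, ring.zero = i \<zero>\<^bsub>M\<^esub>, ring.add = (\<lambda>x y. i (j x \<oplus>\<^bsub>M\<^esub> j y)),
    module.smult = (\<lambda>r x. i (r \<odot>\<^bsub>M\<^esub> j x))\<rparr>"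
  have ag: "abelian_group N"
  proof (rule abelian_groupI)
    show "\<exists>y\<in>carrier N. y \<oplus>\<^bsub>N\<^esub> x = \<zero>\<^bsub>N\<^esub>" if "x \<in> carrier N" for x
      using that by (auto simp: N_def ji M.M.l_neg intro!: bexI[where x = "\<ominus>\<^bsub>M\<^esub> j x"])
  qed (auto simp: N_def ji M.M.a_ac)
  show thesis
  proof (rule that[of N i j])
    show "module R N"
      by (rule moduleI) (auto simp: M.R.is_cring ag, auto simp: N_def ji M.smult_l_distr M.smult_r_distr
          M.smult_assoc1)
  qed (auto simp: mod_hom_def N_def ji)
qed

text \<open>In the square formed by \<open>g \<otimes> h\<close>, \<open>g1 \<otimes> h\<close> and
  the comparison maps, \<open>i \<otimes> id\<close> is injective because \<open>j\<close> retracts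
  \<open>i\<close>. Hence injectivity of \<open>g1 \<otimes> h\<close> passes to
  \<open>g \<otimes> h\<close>.\<close>

lemma tensor_map_inj_transfer:
  assumes mods: "module R N" "module R N'" "module R N1" "module R N1'" "module R C" "module R D"
    and i: "i \<in> mod_hom R N N1" and i': "i' \<in> mod_hom R N' N1'" and j: "j \<in> mod_hom R N1 N"
    and ji: "\<And>x. x \<in> carrier N \<Longrightarrow> j (i x) = x"
    and g: "g \<in> mod_hom R N N'" and g1: "g1 \<in> mod_hom R N1 N1'" and h: "h \<in> mod_hom R C D"
    and comm: "\<And>x. x \<in> carrier N \<Longrightarrow> g1 (i x) = i' (g x)"
    and inj: "inj_on (tensor_map R N1' D g1 h) (carrier (tensor R N1 C))"
  shows "inj_on (tensor_map R N' D g h) (carrier (tensor R N C))"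
proof (rule inj_onI)
  let ?i = "tensor_map R N1 C i (\<lambda>y. y)"
  have eq: "tensor_map R N1' D g1 h (?i t) = tensor_map R N1' D i' (\<lambda>y. y) (tensor_map R N' D g h t)"
    if t: "t \<in> carrier (tensor R N C)" for t
  proof -
    have "tensor_map R N1' D g1 h (?i t) = tensor_map R N1' D (\<lambda>x. g1 (i x)) h t"
      by (rule tensor_map_comp[OF mods(1,5,3,5,4,6) i mod_hom_id g1 h t])
    also have "\<dots> = tensor_map R N1' D (\<lambda>x. i' (g x)) h t"
      by (rule tensor_map_cong[OF mods(1,5,4,6) mod_hom_comp[OF g i'] h comm refl t])
    also have "\<dots> = tensor_map R N1' D i' (\<lambda>y. y) (tensor_map R N' D g h t)"
      by (rule tensor_map_comp[OF mods(1,5,2,6,4,6) g h i' mod_hom_id t, symmetric])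
    finally show ?thesis .
  qed
  have ii: "inj_on ?i (carrier (tensor R N C))"
    by (rule tensor_map_inj_left[OF mods(1,5,3,5) i mod_hom_id j mod_hom_id ji refl])
  have ic: "?i \<in> mod_hom R (tensor R N C) (tensor R N1 C)"
    by (rule tensor_map_hom[OF mods(1,5,3,5) i mod_hom_id])
  fix s t assume st: "s \<in> carrier (tensor R N C)" "t \<in> carrier (tensor R N C)"
    and "tensor_map R N' D g h s = tensor_map R N' D g h t"
  then have "tensor_map R N1' D g1 h (?i s) = tensor_map R N1' D g1 h (?i t)" by (simp add: eq)
  then have "?i s = ?i t" using inj st mod_hom_closed[OF ic] by (simp add: inj_on_eq_iff)
  then show "s = t" using ii st by (simp add: inj_on_eq_iff)
qed

text \<open>Replacing both modules by copies extends \<open>flat\<close> from the element type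
  \<open>'u\<close> to any element type, as long as the carriers inject into
  \<open>'u\<close>.\<close>

lemma flat_inj:
  assumes flat: "flat TYPE('u) R C" and C: "module R C" and N: "module R N" and N': "module R N'"
    and U: "carrier N \<lesssim> (UNIV :: 'u set)" "carrier N' \<lesssim> (UNIV :: 'u set)"
    and g: "g \<in> mod_hom R N N'" and inj: "inj_on g (carrier N)"
  shows "inj_on (tensor_map R N' C g (\<lambda>y. y)) (carrier (tensor R N C))"
proof -
  obtain N1 :: "('a, 'u) module" and i j where c: "module R N1"
    "i \<in> mod_hom R N N1" "j \<in> mod_hom R N1 N"
    "\<forall>x\<in>carrier N. j (i x) = x" "\<forall>y\<in>carrier N1. i (j y) = y"
    by (rule module_copy[OF N U(1)])
  obtain N1' :: "('a, 'u) module" and i' j' where c': "module R N1'"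
    "i' \<in> mod_hom R N' N1'" "j' \<in> mod_hom R N1' N'"
    "\<forall>x\<in>carrier N'. j' (i' x) = x" "\<forall>y\<in>carrier N1'. i' (j' y) = y"
    by (rule module_copy[OF N' U(2)])
  let ?g = "\<lambda>x. i' (g (j x))"
  have g1: "?g \<in> mod_hom R N1 N1'" using mod_hom_comp[OF mod_hom_comp[OF c(3) g] c'(2)] .
  have "inj_on ?g (carrier N1)"
  proof (rule inj_onI)
    fix x y assume xy: "x \<in> carrier N1" "y \<in> carrier N1" "i' (g (j x)) = i' (g (j y))"
    then have "g (j x) = g (j y)" using c'(4) mod_hom_closed[OF g] mod_hom_closed[OF c(3)] by metis
    then have "j x = j y" using inj mod_hom_closed[OF c(3)] xy by (simp add: inj_on_eq_iff)
    then show "x = y" using c(5) xy by metis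
  qed
  then have "inj_on (tensor_map R N1' C ?g (\<lambda>y. y)) (carrier (tensor R N1 C))"
    using flat c(1) c'(1) g1 by (auto simp: flat_def)
  then show ?thesis
    by (rule tensor_map_inj_transfer[OF N N' c(1) c'(1) C C c(2) c'(2) c(3) _ g g1 mod_hom_id, rotated 2])
      (simp_all add: c(4))
qed

text \<open>The analogue for purity, with the test module moved to the left, where coactions have
  it.\<close>

lemma pure_hom_inj:
  assumes pure: "pure_hom TYPE('u) R C D f" and C: "module R C" and D: "module R D"
    and N: "module R N" and U: "carrier N \<lesssim> (UNIV :: 'u set)"
  shows "inj_on (tensor_map R N D (\<lambda>x. x) f) (carrier (tensor R N C))"
proof -
  have f: "f \<in> mod_hom R C D" using pure by (simp add: pure_hom_def)
  obtain N1 :: "('a, 'u) module" and i j where c: "module R N1"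
    "i \<in> mod_hom R N N1" "j \<in> mod_hom R N1 N" "\<forall>x\<in>carrier N. j (i x) = x"
    by (rule module_copy[OF N U])
  have "inj_on (tensor_map R D N1 f (\<lambda>x. x)) (carrier (tensor R C N1))"
    using pure c(1) by (auto simp: pure_hom_def)
  then have "inj_on (tensor_map R N1 D (\<lambda>x. x) f) (carrier (tensor R N1 C))"
    by (rule tensor_map_inj_swap[OF C c(1) D c(1) f mod_hom_id])
  then show ?thesis
    by (rule tensor_map_inj_transfer[OF N N c(1) c(1) C D c(2) c(2) c(3) _ mod_hom_id mod_hom_id f refl, rotated])
      (simp add: c(4))
qed

lemma lepoll_UNIV: "(A :: 'a set) \<lesssim> (UNIV :: 'a set)"
  by (rule subset_imp_lepoll[OF subset_UNIV])

lemma submodule_lepoll: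
  "submodule H R M \<Longrightarrow> module R M \<Longrightarrow> carrier M \<lesssim> U \<Longrightarrow> carrier (M\<lparr>carrier := H\<rparr>) \<lesssim> U"
  using lepoll_trans[OF subset_imp_lepoll[OF module.submoduleE(1)[of R M H]]] by simp

lemma quotient_module_lepoll:
  assumes "module R M" "submodule H R M" "carrier M \<lesssim> U"
  shows "carrier (quotient_module R M H) \<lesssim> U"
proof -
  have "carrier (quotient_module R M H) \<subseteq> (\<lambda>x. H +>\<^bsub>M\<^esub> x) ` carrier M"
    using module.quotient_basic(1)[OF assms(1,2)] by blast
  from lepoll_trans[OF subset_image_lepoll[OF this] assms(3)] show ?thesis .
qed

text \<open>Factor \<open>h\<close> through its image. By flatness the tensor product of the image
  with \<open>C\<close> embeds into \<open>B \<otimes> C\<close>, so \<open>t\<close> already dies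
  there, and right exactness applies to the surjection of \<open>A\<close> onto the image.\<close>

lemma flat_kernel:
  assumes flat: "flat TYPE('u) R C" and C: "module R C" and A: "module R A" and B: "module R B"
    and U: "carrier A \<lesssim> (UNIV :: 'u set)" "carrier B \<lesssim> (UNIV :: 'u set)"
    and h: "h \<in> mod_hom R A B" and t: "t \<in> carrier (tensor R A C)"
    and t0: "tensor_map R B C h (\<lambda>y. y) t = \<zero>\<^bsub>tensor R B C\<^esub>"
  shows "t \<in> tensor_map R A C (\<lambda>x. x) (\<lambda>y. y) `
    carrier (tensor R (A\<lparr>carrier := {x \<in> carrier A. h x = \<zero>\<^bsub>B\<^esub>}\<rparr>) C)"
proof -
  let ?I = "B\<lparr>carrier := h ` carrier A\<rparr>"
  have sub: "submodule (h ` carrier A) R B" by (rule mod_hom_image_submodule[OF A B h])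
  have I: "module R ?I" by (rule submodule_module[OF sub B])
  have hI: "h \<in> mod_hom R A ?I" using h by (auto simp: mod_hom_def)
  have hIC: "tensor_map R ?I C h (\<lambda>y. y) \<in> mod_hom R (tensor R A C) (tensor R ?I C)"
    by (rule tensor_map_hom[OF A C I C hI mod_hom_id])
  have iC: "tensor_map R B C (\<lambda>x. x) (\<lambda>y. y) \<in> mod_hom R (tensor R ?I C) (tensor R B C)"
    by (rule tensor_map_hom[OF I C B C mod_hom_incl[OF sub B] mod_hom_id])
  have "inj_on (tensor_map R B C (\<lambda>x. x) (\<lambda>y. y)) (carrier (tensor R ?I C))"
    by (rule flat_inj[OF flat C I B submodule_lepoll[OF sub B U(2)] U(2) mod_hom_incl[OF sub B]]) simp
  moreover have "tensor_map R B C (\<lambda>x. x) (\<lambda>y. y) (tensor_map R ?I C h (\<lambda>y. y) t) = \<zero>\<^bsub>tensor R B C\<^esub>"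
    using tensor_map_comp[OF A C I C B C hI mod_hom_id mod_hom_incl[OF sub B] mod_hom_id t] t0 by simp
  ultimately have "tensor_map R ?I C h (\<lambda>y. y) t = \<zero>\<^bsub>tensor R ?I C\<^esub>"
    using mod_hom_inj_iff[OF tensor_module[OF I C] tensor_module[OF B C] iC] mod_hom_closed[OF hIC t]
    by simp
  from tensor_right_exact[OF A I C hI _ t this] show ?thesis by simp
qed

section \<open>Tensor products stay within the size of \<open>'u\<close>\<close>

lemma infinite_times_lepoll: "infinite A \<Longrightarrow> A \<times> A \<lesssim> A"
  using card_of_Times_same_infinite[THEN ordIso_imp_ordLeq, of A]
  by (simp add: lepoll_def card_of_ordLeq)

text \<open>Iterated pairing encodes lists of a fixed length injectively, so the length is stored
  alongside. The seed \<open>n 0\<close> is an arbitrary end value.\<close>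

lemma lists_lepoll_infinite:
  assumes "infinite (UNIV :: 'u set)"
  shows "(UNIV :: 'u list set) \<lesssim> (UNIV :: 'u set)"
proof -
  obtain p :: "'u \<times> 'u \<Rightarrow> 'u" where p: "inj p"
    using infinite_times_lepoll[OF assms] by (auto simp: lepoll_def)
  obtain n :: "nat \<Rightarrow> 'u" where n: "inj n"
    using assms by (auto simp: infinite_le_lepoll lepoll_def)
  define e where "e = foldr (\<lambda>x a. p (x, a))"
  have e: "e xs a = e ys a \<Longrightarrow> xs = ys" if "length xs = length ys" for xs ys :: "'u list" and a
    using that by (induction rule: list_induct2) (auto simp: e_def inj_eq[OF p])
  have "inj (\<lambda>xs. p (n (length xs), e xs (n 0)))"
    by (rule injI) (use e in \<open>auto simp: inj_eq[OF p] inj_eq[OF n]\<close>)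
  then show ?thesis by (auto simp: lepoll_def)
qed

text \<open>An element of a free module is encoded by a list that enumerates its graph over its support.\<close>

lemma free_module_lepoll:
  assumes inf: "infinite (UNIV :: 'u set)" and R: "carrier R \<lesssim> (UNIV :: 'u set)"
    and S: "S \<lesssim> (UNIV :: 'u set)"
  shows "carrier (free_module R S) \<lesssim> (UNIV :: 'u set)"
proof -
  obtain r :: "'a \<Rightarrow> 'u" where r: "inj_on r (carrier R)" using R by (auto simp: lepoll_def)
  obtain s :: "'c \<Rightarrow> 'u" where s: "inj_on s S" using S by (auto simp: lepoll_def)
  obtain p :: "'u \<times> 'u \<Rightarrow> 'u" where p: "inj p"
    using infinite_times_lepoll[OF inf] by (auto simp: lepoll_def)
  let ?F = "carrier (free_module R S)"
  define supp where "supp = (\<lambda>\<phi> :: 'c \<Rightarrow> 'a. {x. \<phi> x \<noteq> \<zero>\<^bsub>R\<^esub>})"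
  define l where "l = (\<lambda>\<phi>. SOME xs. set xs = supp \<phi>)"
  have l: "set (l \<phi>) = supp \<phi>" if "\<phi> \<in> ?F" for \<phi>
  proof -
    have "finite (supp \<phi>)" using that by (simp add: free_module_def supp_def)
    from someI_ex[OF finite_list[OF this]] show ?thesis by (simp add: l_def)
  qed
  define code where "code = (\<lambda>\<phi>. map (\<lambda>x. p (s x, r (\<phi> x))) (l \<phi>))"
  have dom: "x \<in> S" "\<phi> x \<in> carrier R" if "\<phi> \<in> ?F" "\<phi> x \<noteq> \<zero>\<^bsub>R\<^esub>" for \<phi> x
    using that by (auto simp: free_module_def)
  have eq: "\<psi> x = \<phi> x" if F: "\<phi> \<in> ?F" "\<psi> \<in> ?F" and "code \<phi> = code \<psi>" and x: "\<phi> x \<noteq> \<zero>\<^bsub>R\<^esub>" for \<phi> \<psi> x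
  proof -
    have "p (s x, r (\<phi> x)) \<in> set (code \<phi>)"
      using l[OF F(1)] x by (simp add: code_def supp_def)
    then have "p (s x, r (\<phi> x)) \<in> set (code \<psi>)" using that(3) by simp
    then obtain y where y: "\<psi> y \<noteq> \<zero>\<^bsub>R\<^esub>" "s x = s y" "r (\<phi> x) = r (\<psi> y)"
      using l[OF F(2)] by (auto simp: code_def supp_def inj_eq[OF p])
    then show ?thesis using inj_onD[OF s] inj_onD[OF r] dom[OF F(1) x] dom[OF F(2) y(1)] by metis
  qed
  have "inj_on code ?F"
  proof (rule inj_onI, rule ext)
    fix \<phi> \<psi> x assume "\<phi> \<in> ?F" "\<psi> \<in> ?F" "code \<phi> = code \<psi>"
    \<comment> \<open>\<open>eq\<close> speaks only of the support of its first function; used both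
      ways it covers both supports, and elsewhere both values are zero.\<close>
    then show "\<phi> x = \<psi> x" using eq[of \<phi> \<psi> x] eq[of \<psi> \<phi> x] by metis
  qed
  then have "?F \<lesssim> (UNIV :: 'u list set)" by (auto simp: lepoll_def)
  from lepoll_trans[OF this lists_lepoll_infinite[OF inf]] show ?thesis .
qed

text \<open>A tensor product is a quotient of a free module on a product of two sets that fit into
  \<open>'u\<close>. The bound lets \<open>N \<otimes> C\<close> be copied to
  \<open>'u\<close>.\<close>

lemma tensor_lepoll:
  assumes inf: "infinite (UNIV :: 'u set)" and R: "carrier R \<lesssim> (UNIV :: 'u set)"
    and M: "module R M" "carrier M \<lesssim> (UNIV :: 'u set)"
    and N: "module R N" "carrier N \<lesssim> (UNIV :: 'u set)"
  shows "carrier (tensor R M N) \<lesssim> (UNIV :: 'u set)"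
proof -
  have "carrier M \<times> carrier N \<lesssim> (UNIV :: 'u set) \<times> (UNIV :: 'u set)"
    using M N by (intro times_lepoll_mono)
  from lepoll_trans[OF this infinite_times_lepoll[OF inf]] have free: "carrier (free_module R (carrier M \<times> carrier N)) \<lesssim> (UNIV :: 'u set)"
    by (rule free_module_lepoll[OF inf R])
  have "carrier (tensor R M N) \<subseteq>
      (\<lambda>\<phi>. tensor_rel R M N +>\<^bsub>free_module R (carrier M \<times> carrier N)\<^esub> \<phi>) `
        carrier (free_module R (carrier M \<times> carrier N))"
    using tensor_carrier[OF M(1) N(1)] by blast
  from lepoll_trans[OF subset_image_lepoll[OF this] free] show ?thesis .
qed

section \<open>Torsion-free modules\<close>

text \<open>The maps \<open>g \<otimes> id\<close> and \<open>id \<otimes> f\<close> commute.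
  Performing \<open>g\<close> before \<open>f\<close> is injective by assumption, so performing
  \<open>f\<close> before \<open>g\<close> is too, and hence its inner map
  \<open>id \<otimes> f\<close> on \<open>A \<otimes> C\<close>.\<close>

lemma tensor_map_inj_factor:
  assumes A: "module R A" and B: "module R B" and C: "module R C" and D: "module R D"
    and g: "g \<in> mod_hom R A B" and f: "f \<in> mod_hom R C D"
    and inj_g: "inj_on (tensor_map R B C g (\<lambda>y. y)) (carrier (tensor R A C))"
    and inj_f: "inj_on (tensor_map R B D (\<lambda>x. x) f) (carrier (tensor R B C))"
  shows "inj_on (tensor_map R A D (\<lambda>x. x) f) (carrier (tensor R A C))"
proof (rule inj_onI)
  let ?g = "tensor_map R B C g (\<lambda>y. y)"
  have gC: "?g \<in> mod_hom R (tensor R A C) (tensor R B C)"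
    by (rule tensor_map_hom[OF A C B C g mod_hom_id])
  have eq: "tensor_map R B D (\<lambda>x. x) f (?g t) = tensor_map R B D g (\<lambda>y. y) (tensor_map R A D (\<lambda>x. x) f t)"
    if "t \<in> carrier (tensor R A C)" for t
    using that by (simp add: tensor_map_comp[OF A C B C B D g mod_hom_id mod_hom_id f]
        tensor_map_comp[OF A C A D B D mod_hom_id f g mod_hom_id])
  fix s t assume st: "s \<in> carrier (tensor R A C)" "t \<in> carrier (tensor R A C)"
    and "tensor_map R A D (\<lambda>x. x) f s = tensor_map R A D (\<lambda>x. x) f t"
  then have "tensor_map R B D (\<lambda>x. x) f (?g s) = tensor_map R B D (\<lambda>x. x) f (?g t)" by (simp add: eq)
  then have "?g s = ?g t" using inj_f st mod_hom_closed[OF gC] by (simp add: inj_on_eq_iff)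
  then show "s = t" using inj_g st by (simp add: inj_on_eq_iff)
qed

section \<open>Adjoining one generator to a submodule\<close>

definition adjoin_elem ::
  "('r, 'x) ring_scheme \<Rightarrow> ('r, 'a, 'y) module_scheme \<Rightarrow> 'a set \<Rightarrow> 'a \<Rightarrow> 'a set"
  where "adjoin_elem R M H q = {h \<oplus>\<^bsub>M\<^esub> r \<odot>\<^bsub>M\<^esub> q | h r. h \<in> H \<and> r \<in> carrier R}"

lemma (in module) adjoin_elem_submodule:
  assumes H: "submodule H R M" and q: "q \<in> carrier M"
  shows "submodule (adjoin_elem R M H q) R M" "H \<subseteq> adjoin_elem R M H q" "q \<in> adjoin_elem R M H q"
proof -
  have HM: "H \<subseteq> carrier M" using submoduleE(1)[OF H] .
  have 0: "\<zero>\<^bsub>M\<^esub> \<in> H" using H by (simp add: submodule_def subgroup.one_closed[of H "add_monoid M", simplified])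
  let ?H = "adjoin_elem R M H q"
  have I: "h \<oplus>\<^bsub>M\<^esub> r \<odot>\<^bsub>M\<^esub> q \<in> ?H" if "h \<in> H" "r \<in> carrier R" for h r
    using that by (auto simp: adjoin_elem_def)
  show sub: "H \<subseteq> ?H"
  proof
    fix h assume h: "h \<in> H"
    then show "h \<in> ?H" using I[OF h R.zero_closed] q HM by (auto simp: subset_iff)
  qed
  show "q \<in> ?H" using I[OF 0 R.one_closed] q by simp
  show "submodule ?H R M"
  proof (rule submoduleI)
    show "?H \<subseteq> carrier M" using HM q by (auto simp: adjoin_elem_def)
    show "\<zero>\<^bsub>M\<^esub> \<in> ?H" using 0 sub by blast
    have add: "(h \<oplus>\<^bsub>M\<^esub> r \<odot>\<^bsub>M\<^esub> q) \<oplus>\<^bsub>M\<^esub> (h' \<oplus>\<^bsub>M\<^esub> r' \<odot>\<^bsub>M\<^esub> q) = (h \<oplus>\<^bsub>M\<^esub> h') \<oplus>\<^bsub>M\<^esub> (r \<oplus>\<^bsub>R\<^esub> r') \<odot>\<^bsub>M\<^esub> q"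
      if "h \<in> H" "h' \<in> H" "r \<in> carrier R" "r' \<in> carrier R" for h h' r r'
      using that q HM by (simp add: subset_iff smult_l_distr M.a_ac)
    show "a \<oplus>\<^bsub>M\<^esub> b \<in> ?H" if "a \<in> ?H" "b \<in> ?H" for a b
    proof -
      obtain h r h' r' where "a = h \<oplus>\<^bsub>M\<^esub> r \<odot>\<^bsub>M\<^esub> q" "b = h' \<oplus>\<^bsub>M\<^esub> r' \<odot>\<^bsub>M\<^esub> q" "h \<in> H" "h' \<in> H"
        "r \<in> carrier R" "r' \<in> carrier R" using \<open>a \<in> ?H\<close> \<open>b \<in> ?H\<close> by (auto simp: adjoin_elem_def)
      then show ?thesis using I submoduleE(5)[OF H] by (simp add: add)
    qed
    show sm: "a \<odot>\<^bsub>M\<^esub> x \<in> ?H" if "a \<in> carrier R" "x \<in> ?H" for a x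
    proof -
      obtain h r where "x = h \<oplus>\<^bsub>M\<^esub> r \<odot>\<^bsub>M\<^esub> q" "h \<in> H" "r \<in> carrier R"
        using \<open>x \<in> ?H\<close> by (auto simp: adjoin_elem_def)
      moreover from this have "a \<odot>\<^bsub>M\<^esub> x = a \<odot>\<^bsub>M\<^esub> h \<oplus>\<^bsub>M\<^esub> (a \<otimes>\<^bsub>R\<^esub> r) \<odot>\<^bsub>M\<^esub> q"
        using that(1) q HM by (simp add: subset_iff smult_r_distr smult_assoc1)
      ultimately show ?thesis using I submoduleE(4)[OF H] that(1) by simp
    qed
    show "\<ominus>\<^bsub>M\<^esub> a \<in> ?H" if a: "a \<in> ?H" for a
    proof -
      have "a \<in> carrier M" using a q HM by (auto simp: adjoin_elem_def)
      then have "\<ominus>\<^bsub>M\<^esub> a = (\<ominus>\<^bsub>R\<^esub> \<one>\<^bsub>R\<^esub>) \<odot>\<^bsub>M\<^esub> a" by (simp add: smult_l_minus)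
      then show ?thesis using sm[OF _ a, of "\<ominus>\<^bsub>R\<^esub> \<one>\<^bsub>R\<^esub>"] by simp
    qed
  qed
qed

lemma (in module) mult_hom:
  assumes "r \<in> carrier R"
  shows "(\<lambda>x. r \<odot>\<^bsub>M\<^esub> x) \<in> mod_hom R M M"
  using assms by (auto simp: mod_hom_def smult_r_distr smult_assoc1[symmetric] R.m_comm)

lemma torsion_free_mult_inj:
  assumes "module R M" "torsion_free R M" "r \<in> carrier R" "r \<noteq> \<zero>\<^bsub>R\<^esub>"
  shows "inj_on (\<lambda>x. r \<odot>\<^bsub>M\<^esub> x) (carrier M)"
proof -
  interpret M: module R M by fact
  show ?thesis
    using assms mod_hom_inj_iff[OF assms(1,1) M.mult_hom[OF assms(3)]] by (auto simp: torsion_free_def)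
qed

text \<open>A linear form \<open>p\<close> contracts the factor \<open>M\<close> and so induces a
  map from \<open>M \<otimes> E\<close> to \<open>E\<close>. Instances are the coordinate along an
  adjoined generator and the isomorphism from \<open>R \<otimes> C\<close> to \<open>C\<close>; with
  the factors exchanged, the contraction by a counit.\<close>

lemma bilinear_map_scale_right:
  assumes "module R M" "module R E" "p \<in> mod_hom R M (regular_module R)"
  shows "bilinear_map R M E E (\<lambda>x c. p x \<odot>\<^bsub>E\<^esub> c)"
proof -
  interpret E: module R E by fact
  show ?thesis
    using assms(3)
    by (auto simp: bilinear_map_def mod_hom_def regular_module_def Pi_iff E.smult_l_distr E.smult_r_distr
        E.smult_assoc1[symmetric] E.R.m_comm)
qed

lemma bilinear_map_scale_left:
  assumes "module R M" "module R E" "p \<in> mod_hom R E (regular_module R)"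
  shows "bilinear_map R M E M (\<lambda>x c. p c \<odot>\<^bsub>M\<^esub> x)"
  using bilinear_map_scale_right[OF assms(2,1,3)] by (simp add: bilinear_map_def)

text \<open>No nonzero multiple of \<open>q\<close> lies in \<open>H\<close>, so
  \<open>H + R q\<close> is the direct sum of \<open>H\<close> and a free module of rank one. Its
  tensor product with \<open>C\<close> is \<open>H \<otimes> C\<close> plus a copy of
  \<open>C\<close>, on which the map acts as \<open>id \<otimes> f\<close> and as
  \<open>f\<close>.\<close>

lemma tensor_inj_adjoin_direct:
  assumes Q: "module R Q" and C: "module R C" and D: "module R D" and f: "f \<in> mod_hom R C D"
    and inj: "inj_on f (carrier C)"
    and H: "submodule H R Q" and q: "q \<in> carrier Q"
    and dir: "\<And>r. r \<in> carrier R \<Longrightarrow> r \<odot>\<^bsub>Q\<^esub> q \<in> H \<Longrightarrow> r = \<zero>\<^bsub>R\<^esub>"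
    and inj_H: "inj_on (tensor_map R (Q\<lparr>carrier := H\<rparr>) D (\<lambda>x. x) f) (carrier (tensor R (Q\<lparr>carrier := H\<rparr>) C))"
  shows "inj_on (tensor_map R (Q\<lparr>carrier := adjoin_elem R Q H q\<rparr>) D (\<lambda>x. x) f)
    (carrier (tensor R (Q\<lparr>carrier := adjoin_elem R Q H q\<rparr>) C))"
proof -
  interpret Q: module R Q by fact
  interpret C: module R C by fact
  interpret D: module R D by fact
  define H' where "H' = adjoin_elem R Q H q"
  let ?H = "Q\<lparr>carrier := H\<rparr>" and ?H' = "Q\<lparr>carrier := H'\<rparr>"
  have sub': "submodule H' R Q" and HH': "H \<subseteq> H'" and q': "q \<in> H'"
    unfolding H'_def by (rule Q.adjoin_elem_submodule[OF H q])+
  have mH: "module R ?H" and mH': "module R ?H'" using submodule_module[OF _ Q] H sub' by auto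
  interpret H: module R ?H by (rule mH)
  have HQ: "H \<subseteq> carrier Q" using Q.submoduleE(1)[OF H] .
  have HQ': "H' \<subseteq> carrier Q" using Q.submoduleE(1)[OF sub'] .
  have Hadd: "x \<oplus>\<^bsub>Q\<^esub> y \<in> H" if "x \<in> H" "y \<in> H" for x y using Q.submoduleE(5)[OF H] that .
  have Hsm: "r \<odot>\<^bsub>Q\<^esub> y \<in> H" if "r \<in> carrier R" "y \<in> H" for r y using Q.submoduleE(4)[OF H] that .
  \<comment> \<open>Cancelling gives \<open>(r - r') q = h' - h\<close>, an element of
    \<open>H\<close>, so \<open>dir\<close> forces \<open>r = r'\<close>.\<close>
  have unique: "h = h' \<and> r = r'"
    if hr: "h \<in> H" "h' \<in> H" "r \<in> carrier R" "r' \<in> carrier R"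
      and eq: "h \<oplus>\<^bsub>Q\<^esub> r \<odot>\<^bsub>Q\<^esub> q = h' \<oplus>\<^bsub>Q\<^esub> r' \<odot>\<^bsub>Q\<^esub> q" for h h' r r'
  proof -
    have hQ: "h \<in> carrier Q" "h' \<in> carrier Q" using hr HQ by auto
    have rr: "(r \<ominus>\<^bsub>R\<^esub> r') \<odot>\<^bsub>Q\<^esub> q = r \<odot>\<^bsub>Q\<^esub> q \<ominus>\<^bsub>Q\<^esub> r' \<odot>\<^bsub>Q\<^esub> q"
      using hr q by (simp add: a_minus_def Q.smult_l_distr Q.smult_l_minus)
    also have "r \<odot>\<^bsub>Q\<^esub> q = \<ominus>\<^bsub>Q\<^esub> h \<oplus>\<^bsub>Q\<^esub> (h \<oplus>\<^bsub>Q\<^esub> r \<odot>\<^bsub>Q\<^esub> q)"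
      using hr q hQ by (simp add: Q.M.a_assoc[symmetric] Q.M.l_neg)
    also have "\<dots> \<ominus>\<^bsub>Q\<^esub> r' \<odot>\<^bsub>Q\<^esub> q = \<ominus>\<^bsub>Q\<^esub> h \<oplus>\<^bsub>Q\<^esub> h'"
      unfolding eq using hr q hQ by (simp add: a_minus_def Q.M.a_assoc Q.M.r_neg)
    finally have "(r \<ominus>\<^bsub>R\<^esub> r') \<odot>\<^bsub>Q\<^esub> q \<in> H"
      using Hadd Q.submoduleE(3)[OF H] hr by simp
    then have "r \<ominus>\<^bsub>R\<^esub> r' = \<zero>\<^bsub>R\<^esub>" using dir hr by simp
    then have r: "r = r'" using hr by simp
    moreover have "h = h'" using eq hQ hr q unfolding r by (simp add: Q.M.add.right_cancel)
    ultimately show ?thesis by simp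
  qed
  \<comment> \<open>\<open>p\<close> and \<open>p'\<close> are the projections of the direct sum,
    chosen pointwise; uniqueness of the decomposition makes them linear.\<close>
  define dec where "dec x z \<longleftrightarrow> fst z \<in> H \<and> snd z \<in> carrier R \<and> x = fst z \<oplus>\<^bsub>Q\<^esub> snd z \<odot>\<^bsub>Q\<^esub> q" for x z
  define p where "p x = fst (SOME z. dec x z)" for x
  define p' where "p' x = snd (SOME z. dec x z)" for x
  have dec: "p x \<in> H" "p' x \<in> carrier R" "x = p x \<oplus>\<^bsub>Q\<^esub> p' x \<odot>\<^bsub>Q\<^esub> q" if "x \<in> H'" for x
  proof -
    have "\<exists>z. dec x z" using that by (fastforce simp: H'_def adjoin_elem_def dec_def)
    from someI_ex[OF this] show "p x \<in> H" "p' x \<in> carrier R" "x = p x \<oplus>\<^bsub>Q\<^esub> p' x \<odot>\<^bsub>Q\<^esub> q"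
      by (auto simp: dec_def p_def p'_def)
  qed
  have pq: "p (h \<oplus>\<^bsub>Q\<^esub> r \<odot>\<^bsub>Q\<^esub> q) = h \<and> p' (h \<oplus>\<^bsub>Q\<^esub> r \<odot>\<^bsub>Q\<^esub> q) = r" if "h \<in> H" "r \<in> carrier R" for h r
  proof -
    have "h \<oplus>\<^bsub>Q\<^esub> r \<odot>\<^bsub>Q\<^esub> q \<in> H'" using that by (auto simp: H'_def adjoin_elem_def)
    from dec[OF this] unique that show ?thesis by metis
  qed
  have p_add: "p (x \<oplus>\<^bsub>Q\<^esub> y) = p x \<oplus>\<^bsub>Q\<^esub> p y \<and> p' (x \<oplus>\<^bsub>Q\<^esub> y) = p' x \<oplus>\<^bsub>R\<^esub> p' y" if "x \<in> H'" "y \<in> H'" for x y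
  proof -
    note d = dec[OF that(1)] dec[OF that(2)]
    have "x \<oplus>\<^bsub>Q\<^esub> y = (p x \<oplus>\<^bsub>Q\<^esub> p' x \<odot>\<^bsub>Q\<^esub> q) \<oplus>\<^bsub>Q\<^esub> (p y \<oplus>\<^bsub>Q\<^esub> p' y \<odot>\<^bsub>Q\<^esub> q)" using d(3,6) by simp
    also have "\<dots> = (p x \<oplus>\<^bsub>Q\<^esub> p y) \<oplus>\<^bsub>Q\<^esub> (p' x \<oplus>\<^bsub>R\<^esub> p' y) \<odot>\<^bsub>Q\<^esub> q"
      using d(1,2,4,5) HQ q by (simp add: subset_iff Q.smult_l_distr Q.M.a_ac)
    finally show ?thesis using pq[of "p x \<oplus>\<^bsub>Q\<^esub> p y" "p' x \<oplus>\<^bsub>R\<^esub> p' y"] d(1,2,4,5) Hadd by simp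
  qed
  have p_sm: "p (r \<odot>\<^bsub>Q\<^esub> x) = r \<odot>\<^bsub>Q\<^esub> p x \<and> p' (r \<odot>\<^bsub>Q\<^esub> x) = r \<otimes>\<^bsub>R\<^esub> p' x" if "x \<in> H'" "r \<in> carrier R" for x r
  proof -
    note d = dec[OF that(1)]
    have "r \<odot>\<^bsub>Q\<^esub> x = r \<odot>\<^bsub>Q\<^esub> (p x \<oplus>\<^bsub>Q\<^esub> p' x \<odot>\<^bsub>Q\<^esub> q)" using d(3) by simp
    also have "\<dots> = r \<odot>\<^bsub>Q\<^esub> p x \<oplus>\<^bsub>Q\<^esub> (r \<otimes>\<^bsub>R\<^esub> p' x) \<odot>\<^bsub>Q\<^esub> q"
      using d(1,2) HQ q that(2) by (simp add: subset_iff Q.smult_r_distr Q.smult_assoc1)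
    finally show ?thesis using pq[of "r \<odot>\<^bsub>Q\<^esub> p x" "r \<otimes>\<^bsub>R\<^esub> p' x"] d(1,2) Hsm that(2) by simp
  qed
  have p: "p \<in> mod_hom R ?H' ?H" using dec(1) p_add p_sm by (auto simp: mod_hom_def)
  \<comment> \<open>The same projection with values in the larger module, where the identity
    \<open>split\<close> takes place.\<close>
  have p2: "p \<in> mod_hom R ?H' ?H'" using p HH' by (auto simp: mod_hom_def Pi_iff)
  have "p' \<in> mod_hom R ?H' (regular_module R)"
    using dec(2) p_add p_sm by (auto simp: mod_hom_def regular_module_def)
  note bil = bilinear_map_scale_right[OF mH' C this] bilinear_map_scale_right[OF mH' D this]
  \<comment> \<open>These maps read off the coordinate along \<open>q\<close>, with values in
    \<open>C\<close> and in \<open>D\<close>.\<close>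
  let ?l = "tensor_lift R C (\<lambda>x c. p' x \<odot>\<^bsub>C\<^esub> c)" and ?m = "tensor_lift R D (\<lambda>x c. p' x \<odot>\<^bsub>D\<^esub> c)"
  have l: "?l \<in> mod_hom R (tensor R ?H' C) C" by (rule tensor_lift_hom[OF mH' C C bil(1)])
  have m: "?m \<in> mod_hom R (tensor R ?H' D) D" by (rule tensor_lift_hom[OF mH' D D bil(2)])
  let ?f' = "tensor_map R ?H' D (\<lambda>x. x) f" and ?f = "tensor_map R ?H D (\<lambda>x. x) f"
  have f': "?f' \<in> mod_hom R (tensor R ?H' C) (tensor R ?H' D)"
    by (rule tensor_map_hom[OF mH' C mH' D mod_hom_id f])
  have f1: "?f \<in> mod_hom R (tensor R ?H C) (tensor R ?H D)"
    by (rule tensor_map_hom[OF mH C mH D mod_hom_id f])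
  let ?pC = "tensor_map R ?H C p (\<lambda>y. y)" and ?pD = "tensor_map R ?H D p (\<lambda>y. y)"
  let ?pC' = "tensor_map R ?H' C p (\<lambda>y. y)"
  have pC: "?pC \<in> mod_hom R (tensor R ?H' C) (tensor R ?H C)"
    by (rule tensor_map_hom[OF mH' C mH C p mod_hom_id])
  have pD: "?pD \<in> mod_hom R (tensor R ?H' D) (tensor R ?H D)"
    by (rule tensor_map_hom[OF mH' D mH D p mod_hom_id])
  have pC': "?pC' \<in> mod_hom R (tensor R ?H' C) (tensor R ?H' C)"
    by (rule tensor_map_hom[OF mH' C mH' C p2 mod_hom_id])
  let ?T = "tensor R ?H' C"
  interpret T: module R ?T by (rule tensor_module[OF mH' C])
  have fl: "f (?l t) = ?m (?f' t)" if t: "t \<in> carrier ?T" for t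
    by (rule tensor_hom_eq[where g = "\<lambda>t. f (?l t)" and h = "\<lambda>t. ?m (?f' t)", OF mH' C D
          mod_hom_comp[OF l f] mod_hom_comp[OF f' m] _ t])
      (use dec(2) in \<open>simp add: tensor_lift_tens[OF mH' C C bil(1)] tensor_lift_tens[OF mH' D D bil(2)]
        tensor_map_tens[OF mH' C mH' D mod_hom_id f] mod_hom_closed[OF f] mod_hom_smult[OF f]\<close>)
  \<comment> \<open>Every tensor is its \<open>H\<close>-part plus \<open>q \<otimes> c\<close>,
    where \<open>c\<close> is its coordinate along \<open>q\<close>. For a kernel element both parts
    vanish, by injectivity for \<open>H\<close> and of \<open>f\<close> respectively.\<close>
  have split: "t = ?pC' t \<oplus>\<^bsub>?T\<^esub> tens R ?H' C q (?l t)" if t: "t \<in> carrier ?T" for t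
  proof (rule tensor_hom_eq[where g = "\<lambda>t. t" and h = "\<lambda>t. ?pC' t \<oplus>\<^bsub>?T\<^esub> tens R ?H' C q (?l t)",
          OF mH' C T.module_axioms mod_hom_id _ _ t])
    have tq: "(\<lambda>t. tens R ?H' C q (?l t)) \<in> mod_hom R ?T ?T"
      using q' by (intro mod_hom_comp[OF l] tens_hom_right[OF mH' C]) simp
    show "(\<lambda>t. ?pC' t \<oplus>\<^bsub>?T\<^esub> tens R ?H' C q (?l t)) \<in> mod_hom R ?T ?T"
      using mod_hom_closed[OF tq] mod_hom_closed[OF pC'] mod_hom_add[OF tq] mod_hom_add[OF pC']
        mod_hom_smult[OF tq] mod_hom_smult[OF pC']
      unfolding mod_hom_def by (simp add: T.M.a_ac T.smult_r_distr)
    fix x c assume x: "x \<in> carrier ?H'" and c: "c \<in> carrier C"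
    then have d: "p x \<in> H" "p' x \<in> carrier R" "x = p x \<oplus>\<^bsub>Q\<^esub> p' x \<odot>\<^bsub>Q\<^esub> q" using dec by auto
    have scal: "tens R ?H' C q (p' x \<odot>\<^bsub>C\<^esub> c) = tens R ?H' C (p' x \<odot>\<^bsub>Q\<^esub> q) c"
      using tens_smult_left[OF mH' C d(2) _ c, of q] q'
        mod_hom_smult[OF tens_hom_right[OF mH' C, of q] d(2) c] by simp
    have "p' x \<odot>\<^bsub>Q\<^esub> q \<in> H'" using Q.submoduleE(4)[OF sub' d(2) q'] .
    then have sum: "tens R ?H' C x c = tens R ?H' C (p x) c \<oplus>\<^bsub>?T\<^esub> tens R ?H' C (p' x \<odot>\<^bsub>Q\<^esub> q) c"
      using tens_add_left[OF mH' C _ _ c, of "p x" "p' x \<odot>\<^bsub>Q\<^esub> q"] d(1) d(3)[symmetric] HH' by auto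
    show "tens R ?H' C x c = ?pC' (tens R ?H' C x c) \<oplus>\<^bsub>?T\<^esub> tens R ?H' C q (?l (tens R ?H' C x c))"
      unfolding tensor_lift_tens[OF mH' C C bil(1) x c] tensor_map_tens[OF mH' C mH' C p2 mod_hom_id x c] scal
      by (rule sum)
  qed
  have "t = \<zero>\<^bsub>?T\<^esub>" if t: "t \<in> carrier ?T" and t0: "?f' t = \<zero>\<^bsub>tensor R ?H' D\<^esub>" for t
  proof -
    have "?f (?pC t) = ?pD (?f' t)"
      using t by (simp add: tensor_map_comp[OF mH' C mH C mH D p mod_hom_id mod_hom_id f]
        tensor_map_comp[OF mH' C mH' D mH D mod_hom_id f p mod_hom_id])
    then have "?f (?pC t) = \<zero>\<^bsub>tensor R ?H D\<^esub>"
      using t0 mod_hom_zero[OF tensor_module[OF mH' D] tensor_module[OF mH D] pD] by simp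
    then have 1: "?pC t = \<zero>\<^bsub>tensor R ?H C\<^esub>"
      using inj_H mod_hom_inj_iff[OF tensor_module[OF mH C] tensor_module[OF mH D] f1]
        mod_hom_closed[OF pC t] by simp
    have inc: "(\<lambda>x. x) \<in> mod_hom R ?H ?H'" using HH' by (auto simp: mod_hom_def)
    have "?pC' t = tensor_map R ?H' C (\<lambda>x. x) (\<lambda>y. y) (?pC t)"
      using tensor_map_comp[OF mH' C mH C mH' C p mod_hom_id inc mod_hom_id t] by simp
    then have 2: "?pC' t = \<zero>\<^bsub>?T\<^esub>"
      using 1 mod_hom_zero[OF tensor_module[OF mH C] T.module_axioms
          tensor_map_hom[OF mH C mH' C inc mod_hom_id]] by simp
    have "f (?l t) = \<zero>\<^bsub>D\<^esub>"
      using fl[OF t] t0 mod_hom_zero[OF tensor_module[OF mH' D] D m] by simp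
    then have "?l t = \<zero>\<^bsub>C\<^esub>" using inj mod_hom_inj_iff[OF C D f] mod_hom_closed[OF l t] by simp
    then have "tens R ?H' C q (?l t) = \<zero>\<^bsub>?T\<^esub>"
      using mod_hom_zero[OF C T.module_axioms tens_hom_right[OF mH' C, of q]] q' by simp
    then show ?thesis using split[OF t] 2 by simp
  qed
  then show ?thesis
    using mod_hom_inj_iff[OF T.module_axioms tensor_module[OF mH' D] f'] by (simp add: H'_def)
qed

text \<open>Each tensor in \<open>Q \<otimes> C\<close> comes from a submodule reached from zero by
  adjoining one element per summand. So it suffices that the \<open>good\<close> submodules include
  zero and are stable under adjunction; finite generation never has to be formulated.\<close>

lemma torsion_free_tensor_inj:
  assumes dom: "domain R" and C: "module R C" and D: "module R D"
    and flat: "flat TYPE('u) R C" "flat TYPE('u) R D"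
    and f: "f \<in> mod_hom R C D" and inj: "inj_on f (carrier C)"
    and Q: "module R Q" and tf: "torsion_free R Q" and U: "carrier Q \<lesssim> (UNIV :: 'u set)"
  shows "inj_on (tensor_map R Q D (\<lambda>x. x) f) (carrier (tensor R Q C))"
proof -
  interpret R: domain R by fact
  interpret Q: module R Q by fact
  define good where "good H \<longleftrightarrow> submodule H R Q \<and>
    inj_on (tensor_map R (Q\<lparr>carrier := H\<rparr>) D (\<lambda>x. x) f) (carrier (tensor R (Q\<lparr>carrier := H\<rparr>) C))" for H
  have good_zero: "good {\<zero>\<^bsub>Q\<^esub>}"
  proof -
    have sub: "submodule {\<zero>\<^bsub>Q\<^esub>} R Q"
      by (rule Q.submoduleI) (auto simp: Q.M.add.inv_one[folded a_inv_def])
    let ?Z = "Q\<lparr>carrier := {\<zero>\<^bsub>Q\<^esub>}\<rparr>"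
    have Z: "module R ?Z" by (rule submodule_module[OF sub Q])
    interpret T: module R "tensor R ?Z C" by (rule tensor_module[OF Z C])
    have "t = \<zero>\<^bsub>tensor R ?Z C\<^esub>" if "t \<in> carrier (tensor R ?Z C)" for t
      using Z C that
    proof (induction rule: tensor_induct)
      case (add t x y)
      then show ?case using mod_hom_zero[OF Z T.module_axioms tens_hom_left[OF Z C, of y]] by simp
    qed simp
    then show ?thesis using sub unfolding good_def by (metis inj_onI)
  qed
  have good_adjoin: "good (adjoin_elem R Q H q)" if H: "good H" and q: "q \<in> carrier Q" for H q
  proof -
    have sub: "submodule H R Q" using H by (simp add: good_def)
    note sub' = Q.adjoin_elem_submodule[OF sub q]
    let ?H = "Q\<lparr>carrier := H\<rparr>" and ?H' = "Q\<lparr>carrier := adjoin_elem R Q H q\<rparr>"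
    have inj_H: "inj_on (tensor_map R ?H D (\<lambda>x. x) f) (carrier (tensor R ?H C))"
      using H by (simp add: good_def)
    have mH: "module R ?H" and mH': "module R ?H'" using submodule_module[OF _ Q] sub sub' by auto
    have "inj_on (tensor_map R ?H' D (\<lambda>x. x) f) (carrier (tensor R ?H' C))"
    \<comment> \<open>If a nonzero multiple \<open>r q\<close> falls into \<open>H\<close>, then
      multiplication by \<open>r\<close> maps all of \<open>H + R q\<close> into \<open>H\<close>;
      otherwise the sum is direct.\<close>
    proof (cases "\<exists>r\<in>carrier R. r \<noteq> \<zero>\<^bsub>R\<^esub> \<and> r \<odot>\<^bsub>Q\<^esub> q \<in> H")
      case True
      then obtain r where r: "r \<in> carrier R" "r \<noteq> \<zero>\<^bsub>R\<^esub>" "r \<odot>\<^bsub>Q\<^esub> q \<in> H" by blast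
      have HQ: "H \<subseteq> carrier Q" using Q.submoduleE(1)[OF sub] .
      have sub'Q: "adjoin_elem R Q H q \<subseteq> carrier Q" using Q.submoduleE(1)[OF sub'(1)] .
      have rH: "r \<odot>\<^bsub>Q\<^esub> x \<in> H" if x: "x \<in> adjoin_elem R Q H q" for x
      proof -
        obtain h s where hs: "x = h \<oplus>\<^bsub>Q\<^esub> s \<odot>\<^bsub>Q\<^esub> q" "h \<in> H" "s \<in> carrier R"
          using x by (auto simp: adjoin_elem_def)
        have "r \<odot>\<^bsub>Q\<^esub> x = r \<odot>\<^bsub>Q\<^esub> h \<oplus>\<^bsub>Q\<^esub> s \<odot>\<^bsub>Q\<^esub> (r \<odot>\<^bsub>Q\<^esub> q)"
          using hs r q HQ by (simp add: subset_iff Q.smult_r_distr Q.smult_assoc1[symmetric] R.m_comm)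
        then show ?thesis using hs r Q.submoduleE(4,5)[OF sub] by simp
      qed
      have m: "(\<lambda>x. r \<odot>\<^bsub>Q\<^esub> x) \<in> mod_hom R ?H' ?H"
        using rH Q.mult_hom[OF r(1)] sub'Q by (auto simp: mod_hom_def subset_iff)
      have "inj_on (\<lambda>x. r \<odot>\<^bsub>Q\<^esub> x) (carrier ?H')"
        using inj_on_subset[OF torsion_free_mult_inj[OF Q tf r(1,2)] sub'Q] by simp
      then have "inj_on (tensor_map R ?H C (\<lambda>x. r \<odot>\<^bsub>Q\<^esub> x) (\<lambda>y. y)) (carrier (tensor R ?H' C))"
        by (rule flat_inj[OF flat(1) C mH' mH submodule_lepoll[OF sub'(1) Q U] submodule_lepoll[OF sub Q U] m])
      then show ?thesis by (rule tensor_map_inj_factor[OF mH' mH C D m f _ inj_H])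
    next
      case False
      show ?thesis
        by (rule tensor_inj_adjoin_direct[OF Q C D f inj sub q _ inj_H]) (use False in blast)
    qed
    then show ?thesis using sub' by (simp add: good_def)
  qed
  let ?T = "tensor R Q C"
  interpret T: module R ?T by (rule tensor_module[OF Q C])
  let ?i = "tensor_map R Q C (\<lambda>x. x) (\<lambda>y. y)"
  \<comment> \<open>The left factor of each new summand is adjoined to the submodule that carries
    the tensor so far.\<close>
  have cover: "\<exists>H. good H \<and> t \<in> ?i ` carrier (tensor R (Q\<lparr>carrier := H\<rparr>) C)" if "t \<in> carrier ?T" for t
    using Q C that
  proof (induction rule: tensor_induct)
    case zero
    let ?Z = "Q\<lparr>carrier := {\<zero>\<^bsub>Q\<^esub>}\<rparr>"
    have sub: "submodule {\<zero>\<^bsub>Q\<^esub>} R Q" using good_zero by (simp add: good_def)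
    have Z: "module R ?Z" by (rule submodule_module[OF sub Q])
    interpret Z: module R "tensor R ?Z C" by (rule tensor_module[OF Z C])
    have "?i \<zero>\<^bsub>tensor R ?Z C\<^esub> = \<zero>\<^bsub>?T\<^esub>"
      by (rule mod_hom_zero[OF Z.module_axioms T.module_axioms
            tensor_map_hom[OF Z C Q C mod_hom_incl[OF sub Q] mod_hom_id]])
    then show ?case using good_zero Z.M.zero_closed by (metis imageI)
  next
    case (add t x c)
    then obtain H s where H: "good H" and s: "s \<in> carrier (tensor R (Q\<lparr>carrier := H\<rparr>) C)" "t = ?i s"
      by blast
    have sub: "submodule H R Q" using H by (simp add: good_def)
    note sub' = Q.adjoin_elem_submodule[OF sub add.hyps(2)]
    let ?H = "Q\<lparr>carrier := H\<rparr>" and ?H' = "Q\<lparr>carrier := adjoin_elem R Q H x\<rparr>"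
    have mH: "module R ?H" and mH': "module R ?H'" using submodule_module[OF _ Q] sub sub' by auto
    interpret T': module R "tensor R ?H' C" by (rule tensor_module[OF mH' C])
    have inc: "(\<lambda>x. x) \<in> mod_hom R ?H ?H'" using sub'(2) by (auto simp: mod_hom_def)
    let ?s = "tensor_map R ?H' C (\<lambda>x. x) (\<lambda>y. y) s"
    note i' = tensor_map_hom[OF mH' C Q C mod_hom_incl[OF sub'(1) Q] mod_hom_id]
    have s': "?s \<in> carrier (tensor R ?H' C)"
      by (rule mod_hom_closed[OF tensor_map_hom[OF mH C mH' C inc mod_hom_id] s(1)])
    have tx: "tens R ?H' C x c \<in> carrier (tensor R ?H' C)"
      using tens_closed[OF mH' C, of x c] sub'(3) add by simp
    have "t = ?i ?s"
      using tensor_map_comp[OF mH C mH' C Q C inc mod_hom_id mod_hom_incl[OF sub'(1) Q] mod_hom_id s(1)] s(2)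
      by simp
    moreover have "?i (tens R ?H' C x c) = tens R Q C x c"
      using tensor_map_tens[OF mH' C Q C mod_hom_incl[OF sub'(1) Q] mod_hom_id, of x c] sub'(3) add by simp
    ultimately have "t \<oplus>\<^bsub>?T\<^esub> tens R Q C x c = ?i (?s \<oplus>\<^bsub>tensor R ?H' C\<^esub> tens R ?H' C x c)"
      using mod_hom_add[OF i' s' tx] by simp
    then show ?case using good_adjoin[OF H add.hyps(2)] T'.M.a_closed[OF s' tx] by (metis imageI)
  qed
  let ?f = "tensor_map R Q D (\<lambda>x. x) f"
  have "t = \<zero>\<^bsub>?T\<^esub>" if t: "t \<in> carrier ?T" and t0: "?f t = \<zero>\<^bsub>tensor R Q D\<^esub>" for t
  proof -
    obtain H s where H: "good H" and s: "s \<in> carrier (tensor R (Q\<lparr>carrier := H\<rparr>) C)" "t = ?i s"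
      using cover[OF t] by blast
    let ?H = "Q\<lparr>carrier := H\<rparr>"
    have sub: "submodule H R Q" using H by (simp add: good_def)
    have mH: "module R ?H" using submodule_module[OF sub Q] .
    note inc = mod_hom_incl[OF sub Q]
    let ?g = "tensor_map R ?H D (\<lambda>x. x) f"
    note g = tensor_map_hom[OF mH C mH D mod_hom_id f]
    \<comment> \<open>Vanishing is known only in \<open>Q \<otimes> D\<close>; flatness of
      \<open>D\<close> pulls it back to \<open>H \<otimes> D\<close>, where goodness of
      \<open>H\<close> applies.\<close>
    have "inj_on (tensor_map R Q D (\<lambda>x. x) (\<lambda>y. y)) (carrier (tensor R ?H D))"
      by (rule flat_inj[OF flat(2) D mH Q submodule_lepoll[OF sub Q U] U inc]) simp
    moreover have "tensor_map R Q D (\<lambda>x. x) (\<lambda>y. y) (?g s) = \<zero>\<^bsub>tensor R Q D\<^esub>"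
      using t0 s by (simp add: tensor_map_comp[OF mH C mH D Q D mod_hom_id f inc mod_hom_id]
          tensor_map_comp[OF mH C Q C Q D inc mod_hom_id mod_hom_id f])
    ultimately have "?g s = \<zero>\<^bsub>tensor R ?H D\<^esub>"
      using mod_hom_inj_iff[OF tensor_module[OF mH D] tensor_module[OF Q D]
          tensor_map_hom[OF mH D Q D inc mod_hom_id]] mod_hom_closed[OF g s(1)] by simp
    then have "s = \<zero>\<^bsub>tensor R ?H C\<^esub>"
      using H mod_hom_inj_iff[OF tensor_module[OF mH C] tensor_module[OF mH D] g] s(1) by (simp add: good_def)
    then show ?thesis
      using s(2) mod_hom_zero[OF tensor_module[OF mH C] T.module_axioms tensor_map_hom[OF mH C Q C inc mod_hom_id]]
      by simp
  qed
  then show ?thesis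
    using mod_hom_inj_iff[OF T.module_axioms tensor_module[OF Q D] tensor_map_hom[OF Q C Q D mod_hom_id f]]
    by simp
qed

section \<open>Descent of subcomodules and homomorphisms\<close>

text \<open>\<open>M\<close> and \<open>omega R D f M\<close> share the underlying module but are
  records of different types; these rules and those below let submodules, quotients and tensor
  products be computed on \<open>M\<close>.\<close>

lemma omega_simps [simp]:
  "carrier (omega R D f M) = carrier M" "ring.add (omega R D f M) = ring.add M"
  "ring.zero (omega R D f M) = ring.zero M" "module.smult (omega R D f M) = module.smult M"
  by (simp_all add: omega_def)

lemma coact_omega: "x \<in> carrier M \<Longrightarrow> coact (omega R D f M) x = tensor_map R M D (\<lambda>y. y) f (coact M x)"
  by (simp add: omega_def)

lemma submodule_omega [simp]: "submodule N R (omega R D f M) \<longleftrightarrow> submodule N R M"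
  unfolding submodule_def submodule_axioms_def subgroup_def m_inv_def by simp

lemma mod_hom_omega [simp]: "mod_hom R (omega R D f M) (omega R D f N) = mod_hom R M N"
  by (simp add: mod_hom_def)

lemma quotient_module_omega [simp]: "quotient_module R (omega R D f M) N = quotient_module R M N"
  unfolding quotient_module_def A_RCOSETS_def a_r_coset_def set_add_def RCOSETS_def r_coset_def set_mult_def
  by simp

lemma tensor_omega [simp]:
  "tensor R (omega R D f M) E = tensor R M E"
  "tensor R ((omega R D f M)\<lparr>carrier := N\<rparr>) E = tensor R (M\<lparr>carrier := N\<rparr>) E"
  by (rule tensor_cong; simp)+

lemma tensor_map_omega [simp]: "tensor_map R (omega R D f M) E = tensor_map R M E"
  by (rule tensor_map_codomain_cong) simp_all

lemma tensor_map_zero_left: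
  assumes "module R M" "module R N" "module R M'" "module R N'"
    and "g \<in> mod_hom R M M'" "h \<in> mod_hom R N N'"
    and zero: "\<And>x. x \<in> carrier M \<Longrightarrow> g x = \<zero>\<^bsub>M'\<^esub>" and t: "t \<in> carrier (tensor R M N)"
  shows "tensor_map R M' N' g h t = \<zero>\<^bsub>tensor R M' N'\<^esub>"
proof -
  interpret T: module R "tensor R M' N'" by (rule tensor_module) fact+
  have "tens R M' N' \<zero>\<^bsub>M'\<^esub> y = \<zero>\<^bsub>tensor R M' N'\<^esub>" if "y \<in> carrier N'" for y
    using mod_hom_zero[OF assms(3) T.module_axioms tens_hom_left[OF assms(3,4) that]] .
  then show ?thesis
    by (intro tensor_hom_eq[where h = "\<lambda>t. \<zero>\<^bsub>tensor R M' N'\<^esub>",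
          OF assms(1,2) T.module_axioms tensor_map_hom _ _ t])
      (use assms in \<open>simp_all add: tensor_map_tens mod_hom_closed, simp add: mod_hom_def\<close>)
qed

text \<open>By right exactness, a coaction value that dies in \<open>Q \<otimes> C\<close>, with
  \<open>Q\<close> the quotient by \<open>N\<close>, comes from \<open>N \<otimes> C\<close>. By
  \<open>inj\<close> its vanishing may be tested in \<open>Q \<otimes> D\<close>, where it follows
  from \<open>N\<close> being a subcomodule over \<open>D\<close>.\<close>

lemma subcomodule_omega_reflect:
  assumes C: "module R C" and D: "module R D" and f: "f \<in> mod_hom R C D"
    and M: "module R M" and coact: "coact M \<in> mod_hom R M (tensor R M C)"
    and sub: "subcomodule R D (omega R D f M) N"
    and inj: "inj_on (tensor_map R (quotient_module R M N) D (\<lambda>x. x) f)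
      (carrier (tensor R (quotient_module R M N) C))"
  shows "subcomodule R C M N"
proof -
  let ?Q = "quotient_module R M N" and ?N = "M\<lparr>carrier := N\<rparr>"
  interpret M: module R M by fact
  have N: "submodule N R M" using sub by (simp add: subcomodule_def)
  have NM: "N \<subseteq> carrier M" using M.submoduleE(1)[OF N] .
  have Q: "module R ?Q" by (rule M.quotient_module_module[OF N])
  have mN: "module R ?N" by (rule submodule_module[OF N M])
  note incl = mod_hom_incl[OF N M]
  let ?q = "\<lambda>x. N +>\<^bsub>M\<^esub> x"
  note q = mod_hom_quotient[OF M N]
  let ?qC = "tensor_map R ?Q C ?q (\<lambda>y. y)" and ?qD = "tensor_map R ?Q D ?q (\<lambda>y. y)"
  note qC = tensor_map_hom[OF M C Q C q mod_hom_id] and qD = tensor_map_hom[OF M D Q D q mod_hom_id]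
  \<comment> \<open>Identifies the kernel in the conclusion of \<open>tensor_right_exact\<close>
    with \<open>N\<close>.\<close>
  have ker: "{x \<in> carrier M. ?q x = \<zero>\<^bsub>?Q\<^esub>} = N"
    using quotient_eq_zero_iff[OF M N] NM by blast
  have "coact M x \<in> tensor_map R M C (\<lambda>x. x) (\<lambda>y. y) ` carrier (tensor R ?N C)" if x: "x \<in> N" for x
  proof -
    have xM: "x \<in> carrier M" using x NM by blast
    have cx: "coact M x \<in> carrier (tensor R M C)" by (rule mod_hom_closed[OF coact xM])
    have "tensor_map R M D (\<lambda>y. y) f (coact M x) \<in> tensor_map R M D (\<lambda>x. x) (\<lambda>y. y) ` carrier (tensor R ?N D)"
      using sub x xM by (auto simp: subcomodule_def coact_omega)
    then obtain u where u: "u \<in> carrier (tensor R ?N D)"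
      "tensor_map R M D (\<lambda>y. y) f (coact M x) = tensor_map R M D (\<lambda>x. x) (\<lambda>y. y) u" by blast
    have "?qD (tensor_map R M D (\<lambda>x. x) (\<lambda>y. y) u) = tensor_map R ?Q D ?q (\<lambda>y. y) u"
      by (rule tensor_map_comp[OF mN D M D Q D incl mod_hom_id q mod_hom_id u(1)])
    also have "\<dots> = \<zero>\<^bsub>tensor R ?Q D\<^esub>"
      by (rule tensor_map_zero_left[OF mN D Q D mod_hom_comp[OF incl q] mod_hom_id _ u(1)])
        (use quotient_eq_zero_iff[OF M N] NM in auto)
    \<comment> \<open>The tensor product of the projection with \<open>f\<close> is factored in two
      ways: through \<open>M \<otimes> D\<close>, where \<open>u\<close> gives zero, and through
      \<open>Q \<otimes> C\<close>.\<close>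
    finally have "tensor_map R ?Q D (\<lambda>x. x) f (?qC (coact M x)) = \<zero>\<^bsub>tensor R ?Q D\<^esub>"
      using tensor_map_comp[OF M C Q C Q D q mod_hom_id mod_hom_id f cx]
        tensor_map_comp[OF M C M D Q D mod_hom_id f q mod_hom_id cx] u(2) by simp
    then have "?qC (coact M x) = \<zero>\<^bsub>tensor R ?Q C\<^esub>"
      using inj mod_hom_inj_iff[OF tensor_module[OF Q C] tensor_module[OF Q D]
          tensor_map_hom[OF Q C Q D mod_hom_id f]] mod_hom_closed[OF qC cx] by simp
    moreover have "carrier ?Q \<subseteq> ?q ` carrier M" using M.quotient_basic(1)[OF N] by blast
    ultimately show ?thesis using tensor_right_exact[OF M Q C q _ cx] by (simp add: ker)
  qed
  then show ?thesis using N by (auto simp: subcomodule_def)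
qed

section \<open>Induced comodules on subcomodules\<close>

lemma induced_comod_simps [simp]:
  "carrier (induced_comod R C M N) = N" "ring.add (induced_comod R C M N) = ring.add M"
  "module.smult (induced_comod R C M N) = module.smult M"
  by (simp_all add: induced_comod_def)

lemma coact_induced_comod:
  assumes "x \<in> N"
  shows "coact (induced_comod R C M N) x = (THE t. t \<in> carrier (tensor R (M\<lparr>carrier := N\<rparr>) C) \<and>
    tensor_map R M C (\<lambda>x. x) (\<lambda>y. y) t = coact M x)"
  unfolding induced_comod_def using assms by simp

text \<open>Existence in the \<open>THE\<close> is the subcomodule condition, uniqueness is flatness
  of \<open>C\<close>. Elements of \<open>M\<close> have type \<open>'u\<close>, so the size
  conditions are trivial.\<close>

lemma coact_induced:
  fixes M :: "('r, 'u, 'c) comod"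
  assumes flat: "flat TYPE('u) R C" and C: "module R C" and M: "module R M"
    and sub: "subcomodule R C M N" and x: "x \<in> N"
  shows "coact (induced_comod R C M N) x \<in> carrier (tensor R (M\<lparr>carrier := N\<rparr>) C)"
    and "tensor_map R M C (\<lambda>x. x) (\<lambda>y. y) (coact (induced_comod R C M N) x) = coact M x"
proof -
  let ?i = "tensor_map R M C (\<lambda>x. x) (\<lambda>y. y)" and ?N = "M\<lparr>carrier := N\<rparr>"
  have N: "submodule N R M" using sub by (simp add: subcomodule_def)
  have mN: "module R ?N" by (rule submodule_module[OF N M])
  have "inj_on ?i (carrier (tensor R ?N C))"
    by (rule flat_inj[OF flat C mN M lepoll_UNIV lepoll_UNIV mod_hom_incl[OF N M]]) simp
  note inj = inj_onD[OF this]
  have "coact M x \<in> ?i ` carrier (tensor R ?N C)"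
    using sub x by (simp add: subcomodule_def image_subset_iff)
  then obtain t where t: "coact M x = ?i t" "t \<in> carrier (tensor R ?N C)" by (rule imageE)
  have "(THE t. t \<in> carrier (tensor R ?N C) \<and> ?i t = coact M x) = t"
  proof (rule the_equality)
    show "s = t" if "s \<in> carrier (tensor R ?N C) \<and> ?i s = coact M x" for s
      by (rule inj[OF trans[OF conjunct2[OF that] t(1)] conjunct1[OF that] t(2)])
    show "t \<in> carrier (tensor R ?N C) \<and> ?i t = coact M x"
      by (rule conjI[OF t(2) t(1)[symmetric]])
  qed
  then have "coact (induced_comod R C M N) x = t" by (simp only: coact_induced_comod[OF x])
  then show "coact (induced_comod R C M N) x \<in> carrier (tensor R ?N C)"
    "?i (coact (induced_comod R C M N) x) = coact M x" by (simp_all only: t)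
qed

text \<open>Both coactions take \<open>N\<close> into \<open>N \<otimes> D\<close>, which embeds
  into \<open>M \<otimes> D\<close> by flatness of \<open>D\<close>; there both become the coaction
  of \<open>omega R D f M\<close>.\<close>

lemma omega_induced_comod:
  fixes M :: "('r, 'u, 'c) comod"
  assumes flat: "flat TYPE('u) R C" "flat TYPE('u) R D" and C: "module R C" and D: "module R D"
    and f: "f \<in> mod_hom R C D" and M: "module R M"
    and subC: "subcomodule R C M N" and subD: "subcomodule R D (omega R D f M) N"
    and oM: "module R (omega R D f M)"
  shows "omega R D f (induced_comod R C M N) = induced_comod R D (omega R D f M) N"
proof -
  let ?N = "M\<lparr>carrier := N\<rparr>" and ?iD = "tensor_map R M D (\<lambda>x. x) (\<lambda>y. y)"
  let ?I = "induced_comod R C M N" and ?J = "induced_comod R D (omega R D f M) N"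
  interpret M: module R M by fact
  have N: "submodule N R M" using subC by (simp add: subcomodule_def)
  have NM: "N \<subseteq> carrier M" using M.submoduleE(1)[OF N] .
  have mN: "module R ?N" by (rule submodule_module[OF N M])
  note incl = mod_hom_incl[OF N M]
  have inj: "inj_on ?iD (carrier (tensor R ?N D))"
    by (rule flat_inj[OF flat(2) D mN M lepoll_UNIV lepoll_UNIV incl]) simp
  have "tensor_map R ?I D (\<lambda>y. y) f (coact ?I x) = coact ?J x" if x: "x \<in> N" for x
  proof (rule inj_onD[OF inj])
    note c = coact_induced[OF flat(1) C M subC x]
    note d = coact_induced[OF flat(2) D oM subD x]
    have I: "tensor_map R ?I D = tensor_map R ?N D"
      by (rule tensor_map_codomain_cong) (simp_all add: induced_comod_def)
    have "?iD (tensor_map R ?N D (\<lambda>y. y) f (coact ?I x)) = tensor_map R M D (\<lambda>y. y) f (coact M x)"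
      using tensor_map_comp[OF mN C mN D M D mod_hom_id f incl mod_hom_id c(1)]
        tensor_map_comp[OF mN C M C M D incl mod_hom_id mod_hom_id f c(1)] c(2) by simp
    also have "\<dots> = ?iD (coact ?J x)" using d(2) x NM by (simp add: coact_omega subset_iff)
    finally show "?iD (tensor_map R ?I D (\<lambda>y. y) f (coact ?I x)) = ?iD (coact ?J x)" by (simp add: I)
    show "tensor_map R ?I D (\<lambda>y. y) f (coact ?I x) \<in> carrier (tensor R ?N D)"
      unfolding I by (rule mod_hom_closed[OF tensor_map_hom[OF mN C mN D mod_hom_id f] c(1)])
    show "coact ?J x \<in> carrier (tensor R ?N D)" using d(1) by simp
  qed
  then show ?thesis
    \<comment> \<open>Both coactions are restricted to \<open>N\<close>, so agreement on
      \<open>N\<close> makes them equal as total functions; the other fields coincide.\<close>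
    by (simp add: omega_def induced_comod_def restrict_def fun_eq_iff)
qed

lemma module_cong:
  assumes M: "module R M" and eq: "carrier M' = carrier M" "ring.add M' = ring.add M"
    "ring.zero M' = ring.zero M" "module.smult M' = module.smult M"
  shows "module R M'"
proof -
  interpret M: module R M by fact
  have "abelian_group M'"
  proof (rule abelian_groupI)
    show "\<exists>y\<in>carrier M'. y \<oplus>\<^bsub>M'\<^esub> x = \<zero>\<^bsub>M'\<^esub>" if "x \<in> carrier M'" for x
      using that by (intro bexI[of _ "\<ominus>\<^bsub>M\<^esub> x"]) (simp_all add: eq M.M.l_neg)
  qed (simp_all add: eq M.M.a_ac)
  then show ?thesis
    by (intro moduleI) (auto simp: eq M.R.is_cring M.smult_l_distr M.smult_r_distr M.smult_assoc1)
qed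

lemma module_omega: "module R M \<Longrightarrow> module R (omega R D f M)"
  by (rule module_cong) simp_all

section \<open>Criteria for closedness of the image and for fullness\<close>

text \<open>\<open>N\<close> itself serves as \<open>M'\<close>, so closedness reduces to
  injectivity of \<open>id \<otimes> f\<close> for the quotient by \<open>N\<close>.\<close>

lemma image_closedI:
  fixes R :: "('r, 'x) ring_scheme" and C :: "('r, 'c, 'y) coalg_scheme" and D :: "('r, 'd, 'z) coalg_scheme"
  assumes flat: "flat TYPE('u) R C" "flat TYPE('u) R D" and C: "module R C" and D: "module R D"
    and f: "f \<in> mod_hom R C D"
    and sub: "\<And>M N. \<lbrakk>comodule R C M; cls M; sub (omega R D f M) N\<rbrakk> \<Longrightarrow>
      subcomodule R D (omega R D f M) N \<and>
      inj_on (tensor_map R (quotient_module R M N) D (\<lambda>x. x) f) (carrier (tensor R (quotient_module R M N) C))"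
  shows "image_closed R C D f (cls :: ('r, 'u, 'c) comod \<Rightarrow> bool) sub"
  unfolding image_closed_def
proof (intro allI impI)
  fix M :: "('r, 'u, 'c) comod" and N
  assume *: "comodule R C M \<and> cls M" "sub (omega R D f M) N"
  then have M: "module R M" and coact: "coact M \<in> mod_hom R M (tensor R M C)"
    by (auto simp: comodule_def comodule_axioms_def)
  from sub[OF _ _ *(2)] * have subD: "subcomodule R D (omega R D f M) N"
    and inj: "inj_on (tensor_map R (quotient_module R M N) D (\<lambda>x. x) f) (carrier (tensor R (quotient_module R M N) C))"
    by auto
  have subC: "subcomodule R C M N" by (rule subcomodule_omega_reflect[OF C D f M coact subD inj])
  with omega_induced_comod[OF flat C D f M subC subD module_omega[OF M]]
  show "\<exists>M'. subcomodule R C M M' \<and> omega R D f (induced_comod R C M M') = induced_comod R D (omega R D f M) N"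
    by blast
qed

text \<open>The two sides of colinearity over \<open>C\<close> lie in \<open>N \<otimes> C\<close>
  and agree in \<open>N \<otimes> D\<close>; hence injectivity is asked of the target
  comodule.\<close>

lemma omega_fullI:
  fixes R :: "('r, 'x) ring_scheme" and C :: "('r, 'c, 'y) coalg_scheme" and D :: "('r, 'd, 'z) coalg_scheme"
  assumes C: "module R C" and D: "module R D" and f: "f \<in> mod_hom R C D"
    and inj: "\<And>N :: ('r, 'u, 'c) comod. \<lbrakk>comodule R C N; cls N\<rbrakk> \<Longrightarrow>
      inj_on (tensor_map R N D (\<lambda>x. x) f) (carrier (tensor R N C))"
  shows "omega_full R C D f (cls :: ('r, 'u, 'c) comod \<Rightarrow> bool)"
  unfolding omega_full_def
proof (intro allI impI subsetI)
  fix M N :: "('r, 'u, 'c) comod" and g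
  assume *: "comodule R C M \<and> cls M \<and> comodule R C N \<and> cls N"
    and g: "g \<in> comod_hom R D (omega R D f M) (omega R D f N)"
  then have M: "module R M" "coact M \<in> mod_hom R M (tensor R M C)"
    and N: "module R N" "coact N \<in> mod_hom R N (tensor R N C)"
    by (auto simp: comodule_def comodule_axioms_def)
  have gh: "g \<in> mod_hom R M N" using g by (simp add: comod_hom_def)
  have "coact N (g x) = tensor_map R N C g (\<lambda>y. y) (coact M x)" if x: "x \<in> carrier M" for x
  proof (rule inj_onD[OF inj])
    show cN: "coact N (g x) \<in> carrier (tensor R N C)"
      by (rule mod_hom_closed[OF N(2) mod_hom_closed[OF gh x]])
    have cM: "coact M x \<in> carrier (tensor R M C)" by (rule mod_hom_closed[OF M(2) x])
    show "tensor_map R N C g (\<lambda>y. y) (coact M x) \<in> carrier (tensor R N C)"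
      by (rule mod_hom_closed[OF tensor_map_hom[OF M(1) C N(1) C gh mod_hom_id] cM])
    have "tensor_map R N D (\<lambda>x. x) f (coact N (g x)) =
        tensor_map R N D g (\<lambda>y. y) (tensor_map R M D (\<lambda>y. y) f (coact M x))"
      using g x coact_omega[OF mod_hom_closed[OF gh x], of R D f] by (simp add: comod_hom_def coact_omega)
    also have "\<dots> = tensor_map R N D (\<lambda>x. x) f (tensor_map R N C g (\<lambda>y. y) (coact M x))"
      using cM by (simp add: tensor_map_comp[OF M(1) C M(1) D N(1) D mod_hom_id f gh mod_hom_id]
          tensor_map_comp[OF M(1) C N(1) C N(1) D gh mod_hom_id mod_hom_id f])
    finally show "tensor_map R N D (\<lambda>x. x) f (coact N (g x)) =
      tensor_map R N D (\<lambda>x. x) f (tensor_map R N C g (\<lambda>y. y) (coact M x))" .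
  qed (use * in auto)
  then show "g \<in> comod_hom R C M N" using gh by (simp add: comod_hom_def)
qed

section \<open>Cofree comodules\<close>

lemma (in cring) regular_module_module: "module R (regular_module R)"
proof (rule moduleI)
  show "abelian_group (regular_module R)"
  proof (rule abelian_groupI)
    show "\<exists>y\<in>carrier (regular_module R). y \<oplus>\<^bsub>regular_module R\<^esub> x = \<zero>\<^bsub>regular_module R\<^esub>"
      if "x \<in> carrier (regular_module R)" for x
      using that by (intro bexI[of _ "\<ominus> x"]) (simp_all add: regular_module_def l_neg)
  qed (simp_all add: regular_module_def a_ac)
qed (simp_all add: regular_module_def is_cring l_distr r_distr m_assoc)

lemma (in domain) torsion_free_regular: "torsion_free R (regular_module R)"
  by (auto simp: torsion_free_def regular_module_def dest: integral)

text \<open>Multiplication by \<open>r\<close> on \<open>N \<otimes> C\<close> is multiplication by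
  \<open>r\<close> on \<open>N\<close> tensored with the identity, so flatness keeps it injective
  for nonzero \<open>r\<close>.\<close>

lemma flat_tensor_torsion_free:
  assumes dom: "domain R" and flat: "flat TYPE('u) R C" and C: "module R C"
    and N: "module R N" and tf: "torsion_free R N" and U: "carrier N \<lesssim> (UNIV :: 'u set)"
  shows "torsion_free R (tensor R N C)"
  unfolding torsion_free_def
proof (intro ballI impI)
  let ?T = "tensor R N C"
  interpret N: module R N by fact
  interpret T: module R ?T by (rule tensor_module[OF N C])
  fix r t assume r: "r \<in> carrier R" and t: "t \<in> carrier ?T" and rt: "r \<odot>\<^bsub>?T\<^esub> t = \<zero>\<^bsub>?T\<^esub>"
  let ?r = "\<lambda>x. r \<odot>\<^bsub>N\<^esub> x"
  let ?m = "tensor_map R N C ?r (\<lambda>y. y)"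
  have m: "?m \<in> mod_hom R ?T ?T" by (rule tensor_map_hom[OF N C N C N.mult_hom[OF r] mod_hom_id])
  have "?m t = r \<odot>\<^bsub>?T\<^esub> t"
    by (rule tensor_hom_eq[OF N C T.module_axioms m T.mult_hom[OF r] _ t])
      (use r in \<open>simp add: tensor_map_tens[OF N C N C N.mult_hom[OF r] mod_hom_id] tens_smult_left[OF N C]\<close>)
  moreover have "inj_on ?m (carrier ?T)" if "r \<noteq> \<zero>\<^bsub>R\<^esub>"
    by (rule flat_inj[OF flat C N N U U N.mult_hom[OF r] torsion_free_mult_inj[OF N tf r that]])
  ultimately show "r = \<zero>\<^bsub>R\<^esub> \<or> t = \<zero>\<^bsub>?T\<^esub>"
    using rt t mod_hom_inj_iff[OF T.module_axioms T.module_axioms m] by auto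
qed

text \<open>Supplies linearity in \<open>n\<close> for expressions
  \<open>(b n \<otimes> id) s\<close>, the shape in which coactions are prescribed on pure tensors
  below.\<close>

lemma tensor_map_bilinear_left:
  assumes A: "module R A" and B: "module R B" and N: "module R N" and P: "module R P"
    and b: "bilinear_map R N A P b" and s: "s \<in> carrier (tensor R A B)"
  shows "(\<lambda>n. tensor_map R P B (b n) (\<lambda>y. y) s) \<in> mod_hom R N (tensor R P B)"
proof -
  let ?T = "tensor R P B"
  interpret T: module R ?T by (rule tensor_module[OF P B])
  interpret N: module R N by fact
  have bn: "b n \<in> mod_hom R A P" if "n \<in> carrier N" for n using b that by (simp add: bilinear_map_def)
  have ba: "(\<lambda>n. b n a) \<in> mod_hom R N P" if "a \<in> carrier A" for a using b that by (simp add: bilinear_map_def)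
  note h = tensor_map_hom[OF A B P B bn mod_hom_id]
  note tm = tensor_map_tens[OF A B P B bn mod_hom_id]
  show ?thesis unfolding mod_hom_def
  proof (intro CollectI conjI ballI funcsetI)
    show "tensor_map R P B (b n) (\<lambda>y. y) s \<in> carrier ?T" if "n \<in> carrier N" for n
      by (rule mod_hom_closed[OF h[OF that] s])
    show "tensor_map R P B (b (n \<oplus>\<^bsub>N\<^esub> n')) (\<lambda>y. y) s =
      tensor_map R P B (b n) (\<lambda>y. y) s \<oplus>\<^bsub>?T\<^esub> tensor_map R P B (b n') (\<lambda>y. y) s"
      if n: "n \<in> carrier N" "n' \<in> carrier N" for n n'
    proof (rule tensor_hom_eq[OF A B T.module_axioms h _ _ s])
      show "(\<lambda>s. tensor_map R P B (b n) (\<lambda>y. y) s \<oplus>\<^bsub>?T\<^esub> tensor_map R P B (b n') (\<lambda>y. y) s)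
        \<in> mod_hom R (tensor R A B) ?T"
        using mod_hom_closed[OF h] mod_hom_add[OF h] mod_hom_smult[OF h] n
        unfolding mod_hom_def by (simp add: T.M.a_ac T.smult_r_distr)
    qed (use n in \<open>simp_all add: tm tens_add_left[OF P B] mod_hom_closed[OF bn] mod_hom_add[OF ba]\<close>)
    show "tensor_map R P B (b (r \<odot>\<^bsub>N\<^esub> n)) (\<lambda>y. y) s = r \<odot>\<^bsub>?T\<^esub> tensor_map R P B (b n) (\<lambda>y. y) s"
      if n: "r \<in> carrier R" "n \<in> carrier N" for r n
      by (rule tensor_hom_eq[OF A B T.module_axioms h mod_hom_comp[OF h T.mult_hom] _ s])
        (use n in \<open>simp_all add: tm tens_smult_left[OF P B] mod_hom_closed[OF bn] mod_hom_smult[OF ba]\<close>)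
  qed
qed

text \<open>Carries coassociativity of \<open>C\<close> along linear maps out of \<open>C\<close>.
  The left factor of the domain is itself a tensor product, hence two reductions to pure
  tensors.\<close>

lemma tensor_assoc_natural_left:
  assumes A: "module R A" and B: "module R B" and C: "module R C" and A': "module R A'"
    and g: "g \<in> mod_hom R A A'" and u: "u \<in> carrier (tensor R (tensor R A B) C)"
  shows "tensor_assoc R A' B C (tensor_map R (tensor R A' B) C (tensor_map R A' B g (\<lambda>y. y)) (\<lambda>z. z) u) =
    tensor_map R A' (tensor R B C) g (\<lambda>y. y) (tensor_assoc R A B C u)"
proof -
  note AB = tensor_module[OF A B] and A'B = tensor_module[OF A' B] and BC = tensor_module[OF B C]
  note g1 = tensor_map_hom[OF A B A' B g mod_hom_id]
  note g2 = tensor_map_hom[OF AB C A'B C g1 mod_hom_id]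
  note g3 = tensor_map_hom[OF A BC A' BC g mod_hom_id]
  note lhs = mod_hom_comp[OF g2 tensor_assoc_hom[OF A' B C]]
    and rhs = mod_hom_comp[OF tensor_assoc_hom[OF A B C] g3]
  show ?thesis
  proof (rule tensor_hom_eq[OF AB C tensor_module[OF A' BC] lhs rhs _ u])
    fix t z assume t: "t \<in> carrier (tensor R A B)" and z: "z \<in> carrier C"
    show "tensor_assoc R A' B C (tensor_map R (tensor R A' B) C (tensor_map R A' B g (\<lambda>y. y)) (\<lambda>z. z)
        (tens R (tensor R A B) C t z)) =
      tensor_map R A' (tensor R B C) g (\<lambda>y. y) (tensor_assoc R A B C (tens R (tensor R A B) C t z))"
    proof (rule tensor_hom_eq[OF A B tensor_module[OF A' BC] mod_hom_comp[OF tens_hom_left[OF AB C z] lhs]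
          mod_hom_comp[OF tens_hom_left[OF AB C z] rhs] _ t])
      fix x y assume "x \<in> carrier A" "y \<in> carrier B"
      then show "tensor_assoc R A' B C (tensor_map R (tensor R A' B) C (tensor_map R A' B g (\<lambda>y. y)) (\<lambda>z. z)
          (tens R (tensor R A B) C (tens R A B x y) z)) =
        tensor_map R A' (tensor R B C) g (\<lambda>y. y) (tensor_assoc R A B C (tens R (tensor R A B) C (tens R A B x y) z))"
        using z by (simp add: tensor_map_tens[OF AB C A'B C g1 mod_hom_id] tensor_map_tens[OF A B A' B g mod_hom_id]
            tensor_map_tens[OF A BC A' BC g mod_hom_id] tensor_assoc_tens[OF A B C] tensor_assoc_tens[OF A' B C]
            tens_closed[OF A B] tens_closed[OF B C] mod_hom_closed[OF g])
    qed
  qed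
qed

text \<open>The cofree comodule on \<open>N\<close>, carried by a copy \<open>P\<close> of \<open>N \<otimes> C\<close>. The formula for the coaction
  says that each \<open>c \<mapsto> n \<otimes> c\<close> is a homomorphism from \<open>C\<close> into it.\<close>

locale cofree_comodule = coalgebra R C + N: module R N + P: module R P
  for R :: "('r, 'x) ring_scheme" and C :: "('r, 'c, 'y) coalg_scheme"
    and N :: "('r, 'n, 'z) module_scheme" and P :: "('r, 'm, 'c) comod" +
  fixes i :: "('n \<times> 'c \<Rightarrow> 'r) set \<Rightarrow> 'm" and j :: "'m \<Rightarrow> ('n \<times> 'c \<Rightarrow> 'r) set"
  assumes i_hom: "i \<in> mod_hom R (tensor R N C) P"
    and j_hom: "j \<in> mod_hom R P (tensor R N C)"
    and j_i: "t \<in> carrier (tensor R N C) \<Longrightarrow> j (i t) = t"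
    and i_j: "p \<in> carrier P \<Longrightarrow> i (j p) = p"
    and coact_P: "coact P \<in> mod_hom R P (tensor R P C)"
    and coact_i: "n \<in> carrier N \<Longrightarrow> c \<in> carrier C \<Longrightarrow> coact P (i (tens R N C n c)) =
      tensor_map R P C (\<lambda>c. i (tens R N C n c)) (\<lambda>y. y) (comul C c)"
begin

lemmas mods = N.module_axioms C.module_axioms P.module_axioms

definition col :: "'n \<Rightarrow> 'c \<Rightarrow> 'm" where "col n c = i (tens R N C n c)"

lemma col_hom: "n \<in> carrier N \<Longrightarrow> col n \<in> mod_hom R C P"
  unfolding col_def[abs_def] by (intro mod_hom_comp[OF tens_hom_right[OF mods(1,2)] i_hom])

lemma coact_col:
  "n \<in> carrier N \<Longrightarrow> c \<in> carrier C \<Longrightarrow> coact P (col n c) = tensor_map R P C (col n) (\<lambda>y. y) (comul C c)"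
  unfolding col_def[abs_def] by (rule coact_i)

lemma j_col: "n \<in> carrier N \<Longrightarrow> c \<in> carrier C \<Longrightarrow> j (col n c) = tens R N C n c"
  unfolding col_def by (intro j_i tens_closed[OF mods(1,2)])

text \<open>\<open>P\<close> is a copy of \<open>N \<otimes> C\<close> in which the elements
  \<open>col n c\<close> correspond to pure tensors, and these generate.\<close>

lemma cofree_hom_eq:
  assumes E: "module R E" and g: "g \<in> mod_hom R P E" and h: "h \<in> mod_hom R P E"
    and eq: "\<And>n c. n \<in> carrier N \<Longrightarrow> c \<in> carrier C \<Longrightarrow> g (col n c) = h (col n c)"
    and p: "p \<in> carrier P"
  shows "g p = h p"
  using tensor_hom_eq[OF mods(1,2) E mod_hom_comp[OF i_hom g] mod_hom_comp[OF i_hom h] _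
      mod_hom_closed[OF j_hom p]] eq p
  by (simp add: col_def i_j)

text \<open>Every \<open>col n\<close> intertwines \<open>comul C\<close> with
  \<open>coact P\<close>, and the images of these maps generate \<open>P\<close>. So the comodule
  laws for \<open>P\<close> follow from coassociativity and the right counit law of
  \<open>C\<close>.\<close>

lemma comodule: "comodule R C P"
proof (rule comodule.intro[OF coalgebra_axioms mods(3)], unfold_locales)
  note C = mods(2) and P = mods(3)
  note CC = tensor_module[OF C C] and PC = tensor_module[OF P C]
  have R': "module R (regular_module R)" by (rule C.R.regular_module_module)
  show "coact P \<in> mod_hom R P (tensor R P C)" by (rule coact_P)
  note s = mod_hom_closed[OF comul_hom]
  fix p assume p: "p \<in> carrier P"
  show "tensor_assoc R P C C (tensor_map R (tensor R P C) C (coact P) (\<lambda>y. y) (coact P p)) =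
    tensor_map R P (tensor R C C) (\<lambda>y. y) (comul C) (coact P p)"
  proof (rule cofree_hom_eq[OF tensor_module[OF P CC] mod_hom_comp[OF mod_hom_comp[OF coact_P
          tensor_map_hom[OF P C PC C coact_P mod_hom_id]] tensor_assoc_hom[OF P C C]]
        mod_hom_comp[OF coact_P tensor_map_hom[OF P C P CC mod_hom_id comul_hom]] _ p])
    fix n c assume n: "n \<in> carrier N" and c: "c \<in> carrier C"
    note g = col_hom[OF n]
    note gC = tensor_map_hom[OF C C P C g mod_hom_id]
    let ?s = "comul C c"
    have "tensor_map R (tensor R P C) C (coact P) (\<lambda>y. y) (coact P (col n c)) =
        tensor_map R (tensor R P C) C (\<lambda>c. coact P (col n c)) (\<lambda>y. y) ?s"
      using tensor_map_comp[OF C C P C PC C g mod_hom_id coact_P mod_hom_id s[OF c]]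
      by (simp add: coact_col[OF n c])
    also have "\<dots> = tensor_map R (tensor R P C) C
        (\<lambda>c. tensor_map R P C (col n) (\<lambda>y. y) (comul C c)) (\<lambda>y. y) ?s"
      by (rule tensor_map_cong[OF C C PC C mod_hom_comp[OF comul_hom gC] mod_hom_id _ _ s[OF c]])
        (simp_all add: coact_col[OF n])
    also have "\<dots> = tensor_map R (tensor R P C) C (tensor_map R P C (col n) (\<lambda>y. y)) (\<lambda>y. y)
        (tensor_map R (tensor R C C) C (comul C) (\<lambda>y. y) ?s)"
      by (rule tensor_map_comp[OF C C CC C PC C comul_hom mod_hom_id gC mod_hom_id s[OF c], symmetric])
    \<comment> \<open>Naturality of the associator pulls \<open>col n\<close> out, leaving one side
      of coassociativity for \<open>C\<close>.\<close>
    finally have "tensor_assoc R P C C (tensor_map R (tensor R P C) C (coact P) (\<lambda>y. y) (coact P (col n c))) =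
        tensor_map R P (tensor R C C) (col n) (\<lambda>y. y)
          (tensor_assoc R C C C (tensor_map R (tensor R C C) C (comul C) (\<lambda>y. y) ?s))"
      using tensor_assoc_natural_left[OF C C C P g
          mod_hom_closed[OF tensor_map_hom[OF C C CC C comul_hom mod_hom_id] s[OF c]]] by simp
    also have "\<dots> = tensor_map R P (tensor R C C) (col n) (comul C) ?s"
      using tensor_map_comp[OF C C C CC P CC mod_hom_id comul_hom g mod_hom_id s[OF c]]
      by (simp add: coassoc[OF c])
    also have "\<dots> = tensor_map R P (tensor R C C) (\<lambda>y. y) (comul C) (coact P (col n c))"
      using tensor_map_comp[OF C C P C P CC g mod_hom_id mod_hom_id comul_hom s[OF c]]
      by (simp add: coact_col[OF n c])
    finally show "tensor_assoc R P C C (tensor_map R (tensor R P C) C (coact P) (\<lambda>y. y) (coact P (col n c))) =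
      tensor_map R P (tensor R C C) (\<lambda>y. y) (comul C) (coact P (col n c))" .
  qed
  have one: "\<one>\<^bsub>R\<^esub> \<in> carrier (regular_module R)" by (simp add: regular_module_def)
  show "tensor_map R P (regular_module R) (\<lambda>y. y) (counit C) (coact P p) = tens R P (regular_module R) p \<one>\<^bsub>R\<^esub>"
  proof (rule cofree_hom_eq[OF tensor_module[OF P R'] mod_hom_comp[OF coact_P
          tensor_map_hom[OF P C P R' mod_hom_id counit_hom]] tens_hom_left[OF P R' one] _ p])
    fix n c assume n: "n \<in> carrier N" and c: "c \<in> carrier C"
    note g = col_hom[OF n]
    have "tensor_map R P (regular_module R) (\<lambda>y. y) (counit C) (coact P (col n c)) =
        tensor_map R P (regular_module R) (col n) (\<lambda>y. y)
          (tensor_map R C (regular_module R) (\<lambda>y. y) (counit C) (comul C c))"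
      using tensor_map_comp[OF C C P C P R' g mod_hom_id mod_hom_id counit_hom s[OF c]]
        tensor_map_comp[OF C C C R' P R' mod_hom_id counit_hom g mod_hom_id s[OF c]]
      by (simp add: coact_col[OF n c])
    then show "tensor_map R P (regular_module R) (\<lambda>y. y) (counit C) (coact P (col n c)) =
      tens R P (regular_module R) (col n c) \<one>\<^bsub>R\<^esub>"
      by (simp add: counit_right[OF c] tensor_map_tens[OF C R' P R' g mod_hom_id c one])
  qed
qed

end

text \<open>The usual coaction \<open>id \<otimes> comul C\<close> lands in
  \<open>N \<otimes> (C \<otimes> C)\<close>. Prescribing it on pure tensors, with values taken
  directly in \<open>P0 \<otimes> C\<close>, avoids inverting the associator.\<close>

lemma cofree_comodule_exists:
  fixes R :: "('r, 'x) ring_scheme" and C :: "('r, 'c, 'y) coalg_scheme"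
    and N :: "('r, 'n, 'z) module_scheme"
  assumes C: "coalgebra R C" and N: "module R N" and U: "carrier (tensor R N C) \<lesssim> (UNIV :: 'u set)"
  obtains P :: "('r, 'u, 'c) comod" and i j where "cofree_comodule R C N P i j"
proof -
  interpret coalgebra R C by fact
  note mC = C.module_axioms
  obtain P0 :: "('r, 'u) module" and i j where P0: "module R P0"
    and i: "i \<in> mod_hom R (tensor R N C) P0" and j: "j \<in> mod_hom R P0 (tensor R N C)"
    and ji: "\<forall>t\<in>carrier (tensor R N C). j (i t) = t" and ij: "\<forall>p\<in>carrier P0. i (j p) = p"
    by (rule module_copy[OF tensor_module[OF N mC] U])
  let ?PC = "tensor R P0 C"
  define b where "b n c = tensor_map R P0 C (\<lambda>c. i (tens R N C n c)) (\<lambda>y. y) (comul C c)" for n c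
  have bil: "bilinear_map R N C P0 (\<lambda>n c. i (tens R N C n c))"
    using mod_hom_comp[OF tens_hom_left[OF N mC] i] mod_hom_comp[OF tens_hom_right[OF N mC] i]
    by (simp add: bilinear_map_def)
  have bc: "b n \<in> mod_hom R C ?PC" if "n \<in> carrier N" for n
    unfolding b_def[abs_def] using bil that
    by (intro mod_hom_comp[OF comul_hom tensor_map_hom[OF mC mC P0 mC _ mod_hom_id]])
      (simp add: bilinear_map_def)
  have bn: "(\<lambda>n. b n c) \<in> mod_hom R N ?PC" if "c \<in> carrier C" for c
    unfolding b_def by (rule tensor_map_bilinear_left[OF mC mC N P0 bil mod_hom_closed[OF comul_hom that]])
  have bb: "bilinear_map R N C ?PC b" using bc bn by (simp add: bilinear_map_def)
  let ?l = "tensor_lift R ?PC b"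
  note PC = tensor_module[OF P0 mC]
  have l: "?l \<in> mod_hom R (tensor R N C) ?PC" by (rule tensor_lift_hom[OF N mC PC bb])
  define P :: "('r, 'u, 'c) comod" where "P = \<lparr>carrier = carrier P0, monoid.mult = monoid.mult P0, one = one P0,
    ring.zero = ring.zero P0, ring.add = ring.add P0, module.smult = module.smult P0, coact = (\<lambda>p. ?l (j p))\<rparr>"
  have P_simps: "carrier P = carrier P0" "ring.add P = ring.add P0" "ring.zero P = ring.zero P0"
    "module.smult P = module.smult P0" "coact P = (\<lambda>p. ?l (j p))" by (simp_all add: P_def)
  have P: "module R P" by (rule module_cong[OF P0]) (simp_all add: P_simps)
  have tP: "tensor R P C = ?PC" by (rule tensor_cong) (simp_all add: P_simps)
  have mP: "tensor_map R P C = tensor_map R P0 C" by (rule tensor_map_codomain_cong) (simp_all add: P_simps)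
  have "cofree_comodule R C N P i j"
  proof (intro cofree_comodule.intro cofree_comodule_axioms.intro C N P)
    show "i \<in> mod_hom R (tensor R N C) P" using i by (simp add: mod_hom_def P_simps)
    show "j \<in> mod_hom R P (tensor R N C)" using j by (simp add: mod_hom_def P_simps)
    show "coact P \<in> mod_hom R P (tensor R P C)"
      using mod_hom_comp[OF j l] by (simp add: mod_hom_def P_simps tP)
    show "j (i t) = t" if "t \<in> carrier (tensor R N C)" for t using ji that by simp
    show "i (j p) = p" if "p \<in> carrier P" for p using ij that by (simp add: P_simps)
    show "coact P (i (tens R N C n c)) =
        tensor_map R P C (\<lambda>c. i (tens R N C n c)) (\<lambda>y. y) (comul C c)"
      if "n \<in> carrier N" "c \<in> carrier C" for n c
      using ji that tens_closed[OF N mC] tensor_lift_tens[OF N mC PC bb]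
      by (simp add: P_simps mP b_def)
  qed
  then show thesis by (rule that)
qed

section \<open>The kernel of the map from \<open>N \<otimes> C\<close> to
  \<open>N \<otimes> D\<close>\<close>

locale cofree_comodule_hom = cofree_comodule R C N P i j + D: coalgebra R D
  for R :: "('r, 'x) ring_scheme" and C :: "('r, 'c, 'y) coalg_scheme"
    and N :: "('r, 'n, 'z) module_scheme" and P :: "('r, 'm, 'c) comod" and i j
    and D :: "('r, 'd, 'v) coalg_scheme" +
  fixes f :: "'c \<Rightarrow> 'd"
  assumes f: "f \<in> coalg_hom R C D"
begin

lemmas mod_D = D.C.module_axioms

lemma f_hom: "f \<in> mod_hom R C D"
  using f by (simp add: coalg_hom_def)

definition base_change :: "'m \<Rightarrow> ('n \<times> 'd \<Rightarrow> 'r) set"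
  where "base_change p = tensor_map R N D (\<lambda>x. x) f (j p)"

definition ker :: "'m set"
  where "ker = {p \<in> carrier P. base_change p = \<zero>\<^bsub>tensor R N D\<^esub>}"

lemma base_change_hom: "base_change \<in> mod_hom R P (tensor R N D)"
  unfolding base_change_def[abs_def]
  by (intro mod_hom_comp[OF j_hom tensor_map_hom[OF mods(1,2) mods(1) mod_D mod_hom_id f_hom]])

lemma base_change_col: "n \<in> carrier N \<Longrightarrow> c \<in> carrier C \<Longrightarrow> base_change (col n c) = tens R N D n (f c)"
  by (simp add: base_change_def j_col tensor_map_tens[OF mods(1,2) mods(1) mod_D mod_hom_id f_hom])

lemma ker_submodule: "submodule ker R P"
  unfolding ker_def by (rule P.kernel_submodule[OF tensor_module[OF mods(1) mod_D] base_change_hom])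

text \<open>The map \<open>N \<otimes> C \<rightarrow> N \<otimes> D\<close> is a homomorphism of \<open>D\<close>-comodules, where \<open>N \<otimes> D\<close> is cofree.\<close>

lemma base_change_comodule_hom:
  obtains \<delta> where "\<delta> \<in> mod_hom R (tensor R N D) (tensor R (tensor R N D) D)"
    "\<And>p. p \<in> carrier P \<Longrightarrow> tensor_map R (tensor R N D) D base_change f (coact P p) = \<delta> (base_change p)"
proof -
  note N = mods(1) and C = mods(2) and P = mods(3) and D = mod_D
  let ?ND = "tensor R N D"
  note ND = tensor_module[OF N D]
  \<comment> \<open>The coaction of the cofree \<open>D\<close>-comodule on pure tensors. Only
    linearity of its extension and compatibility with \<open>base_change\<close> are claimed, so no
    comodule record over \<open>'u\<close> is formed.\<close>
  define b where "b n d = tensor_map R ?ND D (tens R N D n) (\<lambda>y. y) (comul D d)" for n d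
  have bd: "b n \<in> mod_hom R D (tensor R ?ND D)" if "n \<in> carrier N" for n
    unfolding b_def[abs_def]
    by (intro mod_hom_comp[OF D.comul_hom tensor_map_hom[OF D D ND D tens_hom_right[OF N D that] mod_hom_id]])
  have bn: "(\<lambda>n. b n d) \<in> mod_hom R N (tensor R ?ND D)" if "d \<in> carrier D" for d
    unfolding b_def
    by (rule tensor_map_bilinear_left[OF D D N ND tens_bilinear[OF N D] mod_hom_closed[OF D.comul_hom that]])
  have bb: "bilinear_map R N D (tensor R ?ND D) b" using bd bn by (simp add: bilinear_map_def)
  note NDD = tensor_module[OF ND D]
  let ?\<delta> = "tensor_lift R (tensor R ?ND D) b"
  have \<delta>: "?\<delta> \<in> mod_hom R ?ND (tensor R ?ND D)" by (rule tensor_lift_hom[OF N D NDD bb])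
  have "tensor_map R ?ND D base_change f (coact P p) = ?\<delta> (base_change p)" if p: "p \<in> carrier P" for p
  proof (rule cofree_hom_eq[OF NDD mod_hom_comp[OF coact_P tensor_map_hom[OF P C ND D base_change_hom f_hom]]
        mod_hom_comp[OF base_change_hom \<delta>] _ p])
    fix n c assume n: "n \<in> carrier N" and c: "c \<in> carrier C"
    note s = mod_hom_closed[OF comul_hom c]
    note t = tens_hom_right[OF N D n]
    have "tensor_map R ?ND D base_change f (coact P (col n c)) =
        tensor_map R ?ND D (\<lambda>c. base_change (col n c)) f (comul C c)"
      using tensor_map_comp[OF C C P C ND D col_hom[OF n] mod_hom_id base_change_hom f_hom s]
      by (simp add: coact_col[OF n c])
    also have "\<dots> = tensor_map R ?ND D (\<lambda>c. tens R N D n (f c)) f (comul C c)"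
      by (rule tensor_map_cong[OF C C ND D mod_hom_comp[OF f_hom t] f_hom _ _ s])
        (simp_all add: base_change_col[OF n])
    also have "\<dots> = tensor_map R ?ND D (tens R N D n) (\<lambda>y. y) (tensor_map R D D f f (comul C c))"
      by (rule tensor_map_comp[OF C C D D ND D f_hom f_hom t mod_hom_id s, symmetric])
    \<comment> \<open>Here \<open>f\<close> enters as a homomorphism of coalgebras.\<close>
    also have "\<dots> = b n (f c)" using f c by (simp add: b_def coalg_hom_def)
    also have "\<dots> = ?\<delta> (base_change (col n c))"
      by (simp add: base_change_col[OF n c] tensor_lift_tens[OF N D NDD bb n mod_hom_closed[OF f_hom c]])
    finally show "tensor_map R ?ND D base_change f (coact P (col n c)) = ?\<delta> (base_change (col n c))" .
  qed
  with \<delta> show thesis by (rule that)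
qed

text \<open>On \<open>ker\<close>, \<open>base_change \<otimes> id\<close> kills the coaction over
  \<open>D\<close>, since colinearity rewrites the result as \<open>\<delta>\<close> of zero.
  Flatness of \<open>D\<close> then places the coaction in the image of
  \<open>ker \<otimes> D\<close>.\<close>

lemma ker_subcomodule:
  assumes flat: "flat TYPE('u) R D" and U: "carrier P \<lesssim> (UNIV :: 'u set)"
    "carrier (tensor R N D) \<lesssim> (UNIV :: 'u set)"
  shows "subcomodule R D (omega R D f P) ker"
proof -
  note N = mods(1) and C = mods(2) and P = mods(3) and D = mod_D
  let ?ND = "tensor R N D"
  note ND = tensor_module[OF N D]
  obtain \<delta> where \<delta>: "\<delta> \<in> mod_hom R ?ND (tensor R ?ND D)"
    and eq: "\<And>p. p \<in> carrier P \<Longrightarrow> tensor_map R ?ND D base_change f (coact P p) = \<delta> (base_change p)"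
    using base_change_comodule_hom by blast
  have "coact (omega R D f P) p \<in> tensor_map R P D (\<lambda>x. x) (\<lambda>y. y) ` carrier (tensor R (P\<lparr>carrier := ker\<rparr>) D)"
    if p: "p \<in> ker" for p
  proof -
    have pP: "p \<in> carrier P" and p0: "base_change p = \<zero>\<^bsub>?ND\<^esub>" using p by (auto simp: ker_def)
    have s: "coact P p \<in> carrier (tensor R P C)" by (rule mod_hom_closed[OF coact_P pP])
    let ?t = "tensor_map R P D (\<lambda>y. y) f (coact P p)"
    have t: "?t \<in> carrier (tensor R P D)"
      by (rule mod_hom_closed[OF tensor_map_hom[OF P C P D mod_hom_id f_hom] s])
    have "tensor_map R ?ND D base_change (\<lambda>y. y) ?t = \<delta> (base_change p)"
      using tensor_map_comp[OF P C P D ND D mod_hom_id f_hom base_change_hom mod_hom_id s] eq[OF pP] by simp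
    also have "\<dots> = \<zero>\<^bsub>tensor R ?ND D\<^esub>"
      unfolding p0 by (rule mod_hom_zero[OF ND tensor_module[OF ND D] \<delta>])
    finally have "?t \<in> tensor_map R P D (\<lambda>x. x) (\<lambda>y. y) ` carrier (tensor R (P\<lparr>carrier := ker\<rparr>) D)"
      unfolding ker_def by (rule flat_kernel[OF flat D P ND U base_change_hom t])
    then show ?thesis by (simp only: coact_omega[OF pP])
  qed
  then show ?thesis using ker_submodule unfolding subcomodule_def by auto
qed

text \<open>Applying the counit to the first tensor factor of the coaction recovers an element of \<open>N \<otimes> C\<close>;
  on \<open>ker\<close> the counit vanishes because it factors through \<open>D\<close>.\<close>

lemma inj_of_ker_subcomodule:
  assumes sub: "subcomodule R C P ker"
  shows "inj_on (tensor_map R N D (\<lambda>x. x) f) (carrier (tensor R N C))"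
proof -
  note N = mods(1) and C = mods(2) and P = mods(3) and D = mod_D
  let ?R = "regular_module R"
  note R' = C.R.regular_module_module
  note NC = tensor_module[OF N C] and ND = tensor_module[OF N D]
  note bC = bilinear_map_scale_left[OF N C counit_hom] and bD = bilinear_map_scale_left[OF N D D.counit_hom]
  let ?eC = "tensor_lift R N (\<lambda>n c. counit C c \<odot>\<^bsub>N\<^esub> n)" and ?eD = "tensor_lift R N (\<lambda>n c. counit D c \<odot>\<^bsub>N\<^esub> n)"
  have eD: "?eD \<in> mod_hom R (tensor R N D) N" by (rule tensor_lift_hom[OF N D N bD])
  \<comment> \<open>\<open>e\<close> is \<open>id \<otimes> counit C\<close>, read on the copy
    \<open>P\<close> of \<open>N \<otimes> C\<close>.\<close>
  define e where "e p = ?eC (j p)" for p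
  have e: "e \<in> mod_hom R P N"
    unfolding e_def[abs_def] by (intro mod_hom_comp[OF j_hom tensor_lift_hom[OF N C N bC]])
  have e_col: "e (col n c) = counit C c \<odot>\<^bsub>N\<^esub> n" if "n \<in> carrier N" "c \<in> carrier C" for n c
    using that by (simp add: e_def j_col tensor_lift_tens[OF N C N bC])
  \<comment> \<open>\<open>f\<close> preserves counits, so \<open>e\<close> factors through
    \<open>base_change\<close>.\<close>
  have "e p = ?eD (base_change p)" if p: "p \<in> carrier P" for p
  proof (rule cofree_hom_eq[OF N e mod_hom_comp[OF base_change_hom eD] _ p])
    fix n c assume n: "n \<in> carrier N" and c: "c \<in> carrier C"
    have "counit D (f c) = counit C c" using f c by (simp add: coalg_hom_def)
    then show "e (col n c) = ?eD (base_change (col n c))"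
      using n c by (simp add: e_col base_change_col tensor_lift_tens[OF N D N bD] mod_hom_closed[OF f_hom])
  qed
  then have e_ker: "e p = \<zero>\<^bsub>N\<^esub>" if "p \<in> ker" for p
    using that mod_hom_zero[OF ND N eD] by (simp add: ker_def)
  let ?E = "tensor_map R N C e (\<lambda>y. y)"
  have E: "?E \<in> mod_hom R (tensor R P C) (tensor R N C)" by (rule tensor_map_hom[OF P C N C e mod_hom_id])
  \<comment> \<open>On \<open>col n c\<close>, \<open>e\<close> contributes the counit of the first
    factor times \<open>n\<close>; the left counit law of \<open>C\<close> then leaves
    \<open>n \<otimes> c\<close>.\<close>
  have E_coact: "?E (coact P p) = j p" if p: "p \<in> carrier P" for p
  proof (rule cofree_hom_eq[OF NC mod_hom_comp[OF coact_P E] j_hom _ p])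
    fix n c assume n: "n \<in> carrier N" and c: "c \<in> carrier C"
    note s = mod_hom_closed[OF comul_hom c]
    have m: "(\<lambda>r. r \<odot>\<^bsub>N\<^esub> n) \<in> mod_hom R ?R N"
      using n by (auto simp: mod_hom_def regular_module_def N.smult_l_distr N.smult_assoc1)
    have one: "\<one>\<^bsub>R\<^esub> \<in> carrier ?R" by (simp add: regular_module_def)
    have "?E (coact P (col n c)) = tensor_map R N C (\<lambda>c. e (col n c)) (\<lambda>y. y) (comul C c)"
      using tensor_map_comp[OF C C P C N C col_hom[OF n] mod_hom_id e mod_hom_id s]
      by (simp add: coact_col[OF n c])
    also have "\<dots> = tensor_map R N C (\<lambda>c. counit C c \<odot>\<^bsub>N\<^esub> n) (\<lambda>y. y) (comul C c)"
      by (rule tensor_map_cong[OF C C N C mod_hom_comp[OF counit_hom m] mod_hom_id _ _ s])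
        (simp_all add: e_col[OF n])
    also have "\<dots> = tensor_map R N C (\<lambda>r. r \<odot>\<^bsub>N\<^esub> n) (\<lambda>y. y) (tensor_map R ?R C (counit C) (\<lambda>y. y) (comul C c))"
      by (rule tensor_map_comp[OF C C R' C N C counit_hom mod_hom_id m mod_hom_id s, symmetric])
    also have "\<dots> = tens R N C n c"
      using n by (simp add: counit_left[OF c] tensor_map_tens[OF R' C N C m mod_hom_id one c])
    finally show "?E (coact P (col n c)) = j (col n c)" by (simp add: j_col[OF n c])
  qed
  have j_ker: "j p = \<zero>\<^bsub>tensor R N C\<^esub>" if p: "p \<in> ker" for p
  proof -
    let ?K = "P\<lparr>carrier := ker\<rparr>"
    have K: "module R ?K" by (rule submodule_module[OF ker_submodule P])
    note incl = mod_hom_incl[OF ker_submodule P]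
    have "coact P p \<in> tensor_map R P C (\<lambda>x. x) (\<lambda>y. y) ` carrier (tensor R ?K C)"
      using sub p unfolding subcomodule_def by blast
    then obtain u where u: "coact P p = tensor_map R P C (\<lambda>x. x) (\<lambda>y. y) u" "u \<in> carrier (tensor R ?K C)"
      by (rule imageE)
    have "?E (coact P p) = tensor_map R N C e (\<lambda>y. y) u"
      using tensor_map_comp[OF K C P C N C incl mod_hom_id e mod_hom_id u(2)] u(1) by simp
    also have "\<dots> = \<zero>\<^bsub>tensor R N C\<^esub>"
      by (rule tensor_map_zero_left[OF K C N C mod_hom_comp[OF incl e] mod_hom_id _ u(2)]) (simp add: e_ker)
    finally show ?thesis using E_coact p by (simp add: ker_def)
  qed
  have "t = \<zero>\<^bsub>tensor R N C\<^esub>"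
    if t: "t \<in> carrier (tensor R N C)" and t0: "tensor_map R N D (\<lambda>x. x) f t = \<zero>\<^bsub>tensor R N D\<^esub>" for t
  proof -
    have "i t \<in> ker" using t t0 mod_hom_closed[OF i_hom] by (simp add: ker_def base_change_def j_i)
    from j_ker[OF this] show ?thesis using j_i[OF t] by simp
  qed
  then show ?thesis
    using mod_hom_inj_iff[OF NC ND tensor_map_hom[OF N C N D mod_hom_id f_hom]] by simp
qed

text \<open>\<open>base_change\<close> embeds the quotient by its kernel into
  \<open>N \<otimes> D\<close>, and submodules inherit torsion-freeness.\<close>

lemma quotient_ker_torsion_free:
  assumes "torsion_free R (tensor R N D)"
  shows "torsion_free R (quotient_module R P ker)"
  unfolding torsion_free_def
proof (intro ballI impI)
  note P = mods(3) and ND = tensor_module[OF mods(1) mod_D]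
  let ?Q = "quotient_module R P ker"
  fix r K assume r: "r \<in> carrier R" and K: "K \<in> carrier ?Q" and rK: "r \<odot>\<^bsub>?Q\<^esub> K = \<zero>\<^bsub>?Q\<^esub>"
  obtain p where p: "p \<in> carrier P" "K = ker +>\<^bsub>P\<^esub> p"
    using K P.quotient_basic(1)[OF ker_submodule] by blast
  have "ker +>\<^bsub>P\<^esub> (r \<odot>\<^bsub>P\<^esub> p) = \<zero>\<^bsub>?Q\<^esub>"
    using rK p r P.quotient_basic(3)[OF ker_submodule] by simp
  then have "r \<odot>\<^bsub>P\<^esub> p \<in> ker" using quotient_eq_zero_iff[OF P ker_submodule] r p by simp
  then have "r \<odot>\<^bsub>tensor R N D\<^esub> base_change p = \<zero>\<^bsub>tensor R N D\<^esub>"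
    using mod_hom_smult[OF base_change_hom r p(1)] by (simp add: ker_def)
  then have "r = \<zero>\<^bsub>R\<^esub> \<or> p \<in> ker"
    using assms r p mod_hom_closed[OF base_change_hom p(1)] by (auto simp: torsion_free_def ker_def)
  then show "r = \<zero>\<^bsub>R\<^esub> \<or> K = \<zero>\<^bsub>?Q\<^esub>" using p quotient_eq_zero_iff[OF P ker_submodule] by simp
qed

lemma P_torsion_free:
  assumes "torsion_free R (tensor R N C)"
  shows "torsion_free R P"
  unfolding torsion_free_def
proof (intro ballI impI)
  note P = mods(3) and NC = tensor_module[OF mods(1,2)]
  fix r p assume r: "r \<in> carrier R" and p: "p \<in> carrier P" and rp: "r \<odot>\<^bsub>P\<^esub> p = \<zero>\<^bsub>P\<^esub>"
  have "r \<odot>\<^bsub>tensor R N C\<^esub> j p = \<zero>\<^bsub>tensor R N C\<^esub>"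
    using mod_hom_smult[OF j_hom r p] rp mod_hom_zero[OF P NC j_hom] by simp
  then have "r = \<zero>\<^bsub>R\<^esub> \<or> j p = \<zero>\<^bsub>tensor R N C\<^esub>"
    using assms r mod_hom_closed[OF j_hom p] by (simp add: torsion_free_def)
  then show "r = \<zero>\<^bsub>R\<^esub> \<or> p = \<zero>\<^bsub>P\<^esub>" using i_j[OF p] mod_hom_zero[OF NC P i_hom] by auto
qed

lemma inj_of_image_closed:
  assumes cl: "image_closed R C D f cls sub" and P: "cls P" and sub: "sub (omega R D f P) ker"
  shows "inj_on (tensor_map R N D (\<lambda>x. x) f) (carrier (tensor R N C))"
proof (rule inj_of_ker_subcomodule)
  obtain M' where M': "subcomodule R C P M'"
    "omega R D f (induced_comod R C P M') = induced_comod R D (omega R D f P) ker"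
    using cl comodule P sub unfolding image_closed_def by blast
  \<comment> \<open>Both \<open>omega\<close> and \<open>induced_comod\<close> fix the carrier, so
    \<open>M'\<close> can only be \<open>ker\<close>.\<close>
  from arg_cong[OF M'(2), of carrier] have "M' = ker" by simp
  then show "subcomodule R C P ker" using M'(1) by simp
qed

end

text \<open>If \<open>f x = f y\<close>, then \<open>1 \<otimes> x\<close> and
  \<open>1 \<otimes> y\<close> have the same image, hence are equal; the contraction of
  \<open>R \<otimes> C\<close> to \<open>C\<close> by scalar multiplication recovers
  \<open>x\<close> and \<open>y\<close>.\<close>

lemma inj_of_regular_tensor_inj:
  assumes C: "module R C" and D: "module R D" and f: "f \<in> mod_hom R C D"
    and inj: "inj_on (tensor_map R (regular_module R) D (\<lambda>x. x) f) (carrier (tensor R (regular_module R) C))"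
  shows "inj_on f (carrier C)"
proof (rule inj_onI)
  interpret C: module R C by fact
  let ?R = "regular_module R"
  note R' = C.R.regular_module_module
  have one: "\<one>\<^bsub>R\<^esub> \<in> carrier ?R" by (simp add: regular_module_def)
  fix x y assume xy: "x \<in> carrier C" "y \<in> carrier C" "f x = f y"
  then have "tensor_map R ?R D (\<lambda>x. x) f (tens R ?R C \<one>\<^bsub>R\<^esub> x) = tensor_map R ?R D (\<lambda>x. x) f (tens R ?R C \<one>\<^bsub>R\<^esub> y)"
    by (simp add: tensor_map_tens[OF R' C R' D mod_hom_id f one])
  then have "tens R ?R C \<one>\<^bsub>R\<^esub> x = tens R ?R C \<one>\<^bsub>R\<^esub> y"
    using inj xy tens_closed[OF R' C one] by (simp add: inj_on_eq_iff)
  then have "\<one>\<^bsub>R\<^esub> \<odot>\<^bsub>C\<^esub> x = \<one>\<^bsub>R\<^esub> \<odot>\<^bsub>C\<^esub> y"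
    using tensor_lift_tens[OF R' C C bilinear_map_scale_right[OF R' C mod_hom_id] one] xy by metis
  then show "x = y" using xy by simp
qed


section \<open>Both equivalences and the fullness statements\<close>

theorem proposition2p7:
  fixes R :: "('r, 'x) ring_scheme"
    and C :: "('r, 'c) coalg" and D :: "('r, 'd) coalg" and f :: "'c \<Rightarrow> 'd"
  assumes "infinite (UNIV :: 'u set)"
    and "carrier R \<lesssim> (UNIV :: 'u set)"
    and "carrier C \<lesssim> (UNIV :: 'u set)"
    and "carrier D \<lesssim> (UNIV :: 'u set)"
    and "noetherian_domain R"
    and "coalgebra R C" and "coalgebra R D"
    and "flat TYPE('u) R C" and "flat TYPE('u) R D"
    and "f \<in> coalg_hom R C D"
  shows
    "(image_closed R C D f (\<lambda>M :: ('r, 'u, 'c) comod. torsion_free R M) (saturated_subcomodule R D)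
        \<longleftrightarrow> inj_on f (carrier C)) \<and>
     (inj_on f (carrier C) \<longrightarrow>
        image_closed R C D f (\<lambda>M :: ('r, 'u, 'c) comod. True) (saturated_subcomodule R D) \<and>
        omega_full R C D f (\<lambda>M :: ('r, 'u, 'c) comod. torsion_free R M)) \<and>
     (image_closed R C D f (\<lambda>M :: ('r, 'u, 'c) comod. True) (subcomodule R D)
        \<longleftrightarrow> inj_on f (carrier C) \<and> pure_hom TYPE('u) R C D f) \<and>
     (inj_on f (carrier C) \<and> pure_hom TYPE('u) R C D f \<longrightarrow>
        omega_full R C D f (\<lambda>M :: ('r, 'u, 'c) comod. True))"
  (is "(?sat_tf \<longleftrightarrow> ?inj) \<and> (?inj \<longrightarrow> ?sat \<and> ?full_tf) \<and> (?sub \<longleftrightarrow> ?inj \<and> ?pure) \<and> (?inj \<and> ?pure \<longrightarrow> ?full)")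
proof -
  note inf = assms(1) and UR = assms(2) and flat = assms(8,9)
  interpret C: coalgebra R C by fact
  interpret D: coalgebra R D by fact
  interpret R: noetherian_domain R by fact
  note dom = R.domain_axioms and C = C.C.module_axioms and D = D.C.module_axioms
  have f: "f \<in> mod_hom R C D" using assms(10) by (simp add: coalg_hom_def)
  note Q = module.quotient_module_module
  have comodule_module: "module R M" if "comodule R C M" for M :: "('r, 'u, 'c) comod"
    using that by (simp add: comodule_def)

  \<comment> \<open>Shared by both converses, so the class and the kind of subobject are parameters.
    The cofree comodule is obtained only inside, hence \<open>cls\<close> and \<open>sub\<close> are
    required for all choices of \<open>P\<close>, \<open>i\<close>, \<open>j\<close>.\<close>
  have tensor_inj: "inj_on (tensor_map R N D (\<lambda>x. x) f) (carrier (tensor R N C))"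
    if cl: "image_closed R C D f cls sub" and N: "module R N" and U: "carrier N \<lesssim> (UNIV :: 'u set)"
      and cls: "\<And>P i j. cofree_comodule_hom R C N P i j D f \<Longrightarrow> cls P"
      and sub: "\<And>P i j. \<lbrakk>cofree_comodule_hom R C N P i j D f;
        subcomodule R D (omega R D f P) (cofree_comodule_hom.ker R N P j D f)\<rbrakk> \<Longrightarrow>
        sub (omega R D f P) (cofree_comodule_hom.ker R N P j D f)"
    for N :: "('r, 'n) module" and cls :: "('r, 'u, 'c) comod \<Rightarrow> bool" and sub
  proof -
    obtain P :: "('r, 'u, 'c) comod" and i j where P: "cofree_comodule R C N P i j"
      by (rule cofree_comodule_exists[OF assms(6) N tensor_lepoll[OF inf UR N U C assms(3)]])
    then have P: "cofree_comodule_hom R C N P i j D f"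
      by (intro cofree_comodule_hom.intro cofree_comodule_hom_axioms.intro assms(7,10))
    then interpret P: cofree_comodule_hom R C N P i j D f .
    show ?thesis
      by (rule P.inj_of_image_closed[OF cl cls[OF P] sub[OF P P.ker_subcomodule]])
        (rule flat(2) lepoll_UNIV tensor_lepoll[OF inf UR N U D assms(4)])+
  qed

  have inj: ?inj if cl: ?sat_tf
  proof (rule inj_of_regular_tensor_inj[OF C D f])
    \<comment> \<open>\<open>R\<close> is torsion-free, so by flatness \<open>R \<otimes> C\<close>
      and \<open>R \<otimes> D\<close> are: the former puts the cofree comodule into the class, the
      latter makes the kernel saturated.\<close>
    let ?R = "regular_module R"
    have R': "module R ?R" and tf: "torsion_free R ?R" and U: "carrier ?R \<lesssim> (UNIV :: 'u set)"
      using C.C.R.regular_module_module R.torsion_free_regular UR by (simp_all add: regular_module_def)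
    show "inj_on (tensor_map R ?R D (\<lambda>x. x) f) (carrier (tensor R ?R C))"
    proof (rule tensor_inj[OF cl R' U])
      fix P :: "('r, 'u, 'c) comod" and i j assume "cofree_comodule_hom R C ?R P i j D f"
      then interpret P: cofree_comodule_hom R C ?R P i j D f .
      show "torsion_free R P"
        by (rule P.P_torsion_free[OF flat_tensor_torsion_free[OF dom flat(1) C R' tf U]])
      show "saturated_subcomodule R D (omega R D f P) P.ker" if "subcomodule R D (omega R D f P) P.ker"
        using that P.quotient_ker_torsion_free[OF flat_tensor_torsion_free[OF dom flat(2) D R' tf U]]
        by (simp add: saturated_subcomodule_def)
    qed
  qed

  have sat: ?sat if ?inj
  proof (rule image_closedI[OF flat C D f])
    fix M :: "('r, 'u, 'c) comod" and N
    assume M: "comodule R C M" and N: "saturated_subcomodule R D (omega R D f M) N"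
    then have sub: "submodule N R M" and tf: "torsion_free R (quotient_module R M N)"
      by (simp_all add: saturated_subcomodule_def subcomodule_def)
    note m = comodule_module[OF M]
    show "subcomodule R D (omega R D f M) N \<and>
      inj_on (tensor_map R (quotient_module R M N) D (\<lambda>x. x) f) (carrier (tensor R (quotient_module R M N) C))"
      using N torsion_free_tensor_inj[OF dom C D flat f that Q[OF m sub] tf
          quotient_module_lepoll[OF m sub lepoll_UNIV]]
      by (simp add: saturated_subcomodule_def)
  qed
  have sat_tf: ?sat_tf if ?inj
    using sat[OF that] by (auto simp: image_closed_def)
  have full_tf: ?full_tf if ?inj
    by (rule omega_fullI[OF C D f])
      (rule torsion_free_tensor_inj[OF dom C D flat f that comodule_module _ lepoll_UNIV])

  have sub: ?sub if ?inj ?pure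
  proof (rule image_closedI[OF flat C D f])
    fix M :: "('r, 'u, 'c) comod" and N
    assume M: "comodule R C M" and N: "subcomodule R D (omega R D f M) N"
    then have sub: "submodule N R M" by (simp add: subcomodule_def)
    note m = comodule_module[OF M]
    show "subcomodule R D (omega R D f M) N \<and>
      inj_on (tensor_map R (quotient_module R M N) D (\<lambda>x. x) f) (carrier (tensor R (quotient_module R M N) C))"
      using N pure_hom_inj[OF that(2) C D Q[OF m sub] quotient_module_lepoll[OF m sub lepoll_UNIV]] by simp
  qed
  have full: ?full if ?inj ?pure
    by (rule omega_fullI[OF C D f]) (rule pure_hom_inj[OF that(2) C D comodule_module lepoll_UNIV])

  have pure: ?pure if cl: ?sub
    unfolding pure_hom_def
  proof (intro conjI f allI impI)
    fix N :: "('r, 'u) module" assume N: "module R N"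
    have "inj_on (tensor_map R N D (\<lambda>x. x) f) (carrier (tensor R N C))"
      by (rule tensor_inj[OF cl N lepoll_UNIV]) simp_all
    then show "inj_on (tensor_map R D N f (\<lambda>x. x)) (carrier (tensor R C N))"
      by (rule tensor_map_inj_swap[OF N C N D mod_hom_id f])
  qed
  \<comment> \<open>Restricting both the comodules and the subobjects; in this way injectivity of
    \<open>f\<close> also follows from closedness under all subcomodules.\<close>
  have sub_sat: ?sat_tf if ?sub
    using that by (auto simp: image_closed_def saturated_subcomodule_def)

  show ?thesis
    using inj sat sat_tf full_tf sub full pure sub_sat by blast
qed

end
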